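(* Let $W(x,y)=-\log g_\tau(y-(\alpha+\beta x))$ be a linear-Gaussian reference potential, with $\tau$ positive definite, $\alpha\in\mathbb{R}^d$, $\beta\in\mathbb{R}^{d\times d}$ invertible. Consider the Sinkhorn bridges associated with $(\mu,\eta,\mathcal{K}_0)=(\lambda_U,\lambda_V,K_W)$. Assume that for some positive definite $u_+,v_+$, positive semi-definite $\overline u_+,\overline v_+$ and $\delta_u,\delta_v\ge0$, $$\nabla^2U(x)\ge u_+^{-1}1_{\|x\|_2\ge\delta_u}-\overline u_+1_{\|x\|_2<\delta_u},\qquad \nabla^2V(y)\ge v_+^{-1}1_{\|y\|_2\ge\delta_v}-\overline v_+1_{\|y\|_2<\delta_v}$$ for all $x,y\in\mathbb{R}^d$. Set $\rho_u:=\rho(\|u_+\|_2^{-1},\|\overline u_+\|_2,\delta_u)$, $\rho_v:=\rho(\|v_+\|_2^{-1},\|\overline v_+\|_2,\delta_v)$ and $\varepsilon_\star:=\|\tau^{-1}\beta\|_2^2\,\rho_u\,\rho_v$. Then for all $n\ge2$ and $p\ge0$ $$\mathcal{H}(P_{\mu,\eta}|\mathcal{P}_{n+p})\le\left(1+\phi(\varepsilon_\star)\right)^{-(n-2)}\mathcal{H}(P_{\mu,\eta}|\mathcal{P}_p),\qquad \phi(\epsilon):=\frac{\epsilon^{-1}}{\sqrt{1/4+\epsilon^{-1}}+1/2}.$$ If moreover $\nabla^2U\ge u_+^{-1}$ and $\nabla^2V\ge v_+^{-1}$ everywhere, the estimate holds with $\varepsilon_\star$ replaced by $\varepsilon:=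\|\tau^{-1}\beta\|_2^2\,\|u_+\|_2\,\|v_+\|_2$.
   Context: $\lambda$ is Lebesgue measure on $\mathbb{R}^d$, $g_\tau$ is the density of the centered Gaussian with covariance $\tau$. $\lambda_U(dx)=e^{-U(x)}\lambda(dx)$ and $K_W(x,dy)=e^{-W(x,y)}\lambda(dy)$; $U,V$ are smooth and $\mu=\lambda_U$, $\eta=\lambda_V$ are probability measures. $(\mu\times\mathcal{K})(d(x,y))=\mu(dx)\mathcal{K}(x,dy)$; $\mathcal{H}$ is relative entropy; $\Pi(\mu,\eta)$ is the set of couplings. The reference is $P=\mu\times K_W$; it is assumed that some $Q\in\Pi(\mu,\eta)$ has $\mathcal{H}(Q|P)<\infty$, and $P_{\mu,\eta}=\arg\min_{Q\in\Pi(\mu,\eta)}\mathcal{H}(Q|P)$. Sinkhorn: $\mathcal{K}_0=K_W$. Given $\mathcal{K}_{2n}$, put $\pi_{2n}=\mu\mathcal{K}_{2n}$, $\mathcal{P}_{2n}=\mu\times\mathcal{K}_{2n}$, and let $\mathcal{K}_{2n+1}$ be defined by $\mu(dx)\mathcal{K}_{2n}(x,dy)=\pi_{2n}(dy)\mathcal{K}_{2n+1}(y,dx)$. Then $\pi_{2n+1}=\eta\mathcal{K}_{2n+1}$, $\mathcal{P}_{2n+1}(d(x,y))=\eta(dy)\mathcal{K}_{2n+1}(y,dx)$, and $\mathcal{K}_{2(n+1)}$ is defined by $\eta(dy)\mathcal{K}_{2n+1}(y,dx)=\pi_{2n+1}(dx)\mathcal{K}_{2(n+1)}(x,dy)$.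 The log-densities of the Sinkhorn transitions are assumed smooth, with differentiation under the integral sign allowed. $\|\cdot\|_2$ is the Euclidean/spectral norm; matrix inequalities are in the Loewner order. A probability measure $\mu$ satisfies the log-Sobolev inequality $LS(\rho)$ if $\mathcal{H}(\nu|\mu)\le\frac\rho2\,\nu(\|\nabla\log(d\nu/d\mu)\|_2^2)$ for all probability measures $\nu\ll\mu$. For $a>0$, $b,\delta\ge0$, $\rho(a,b,\delta)>0$ denotes a fixed constant (depending only on $(a,b,\delta)$; such a constant exists by the Holley-Stroock perturbation lemma) such that every probability measure $\lambda_F$ with smooth $F$ satisfying $\nabla^2F(x)\ge a\,1_{\|x\|_2\ge\delta}I-b\,1_{\|x\|_2<\delta}I$ satisfies $LS(\rho(a,b,\delta))$. *)

theory Defs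
  imports "HOL-Probability.Probability"
begin

section \<open>Calculus and matrices\<close>

text \<open>\<open>dderivs [v\<^sub>1, \<dots>, v\<^sub>k] f\<close> differentiates \<open>f\<close> along \<open>v\<^sub>1\<close> first and along \<open>v\<^sub>k\<close> last. Where a
  derivative does not exist, \<^const>\<open>frechet_derivative\<close> is unspecified.\<close>

primrec dderivs ::
  "'a list \<Rightarrow> ('a::real_normed_vector \<Rightarrow> real) \<Rightarrow> 'a \<Rightarrow> real" where
  "dderivs [] f = f"
| "dderivs (v # vs) f = dderivs vs (\<lambda>x. frechet_derivative f (at x) v)"

text \<open>For finite-dimensional \<open>'a\<close> this is \<open>C\<^sup>\<infinity>\<close>: differentiability of the iterated derivatives
  implies their continuity.\<close>

definition smooth :: "('a::euclidean_space \<Rightarrow> real) \<Rightarrow> bool" where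
  "smooth f \<longleftrightarrow> (\<forall>vs. dderivs vs f differentiable_on UNIV)"

definition grad :: "(real^'d \<Rightarrow> real) \<Rightarrow> real^'d \<Rightarrow> real^'d" where
  "grad f x = (\<chi> i. frechet_derivative f (at x) (axis i 1))"

definition hess :: "(real^'d \<Rightarrow> real) \<Rightarrow> real^'d \<Rightarrow> real^'d^'d" where
  "hess f x = (\<chi> i j. dderivs [axis j 1, axis i 1] f x)"

definition pos_semidef :: "real^'d^'d \<Rightarrow> bool" where
  "pos_semidef A \<longleftrightarrow> transpose A = A \<and> (\<forall>x. 0 \<le> x \<bullet> (A *v x))"

definition pos_def :: "real^'d^'d \<Rightarrow> bool" where
  "pos_def A \<longleftrightarrow> transpose A = A \<and> (\<forall>x. x \<noteq> 0 \<longrightarrow> 0 < x \<bullet> (A *v x))"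

definition loewner_le :: "real^'d^'d \<Rightarrow> real^'d^'d \<Rightarrow> bool"  (infix \<open>\<le>\<^sub>L\<close> 50) where
  "A \<le>\<^sub>L B \<longleftrightarrow> pos_semidef (B - A)"

definition spec_norm :: "real^'d^'d \<Rightarrow> real" where
  "spec_norm A = onorm (\<lambda>x. A *v x)"

definition hess_bound ::
  "real^'d^'d \<Rightarrow> real^'d^'d \<Rightarrow> real \<Rightarrow> (real^'d \<Rightarrow> real) \<Rightarrow> bool" where
  "hess_bound A B \<delta> F \<longleftrightarrow>
     (\<forall>x. indicat_real {z. \<delta> \<le> norm z} x *\<^sub>R A - indicat_real {z. norm z < \<delta>} x *\<^sub>R B
            \<le>\<^sub>L hess F x)"

section \<open>Gibbs measures, kernels, couplings, entropy\<close>

definition gibbs :: "(real^'d \<Rightarrow> real) \<Rightarrow> (real^'d) measure" where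
  "gibbs U = density lborel (\<lambda>x. ennreal (exp (- U x)))"

definition gibbs_kernel :: "(real^'d \<Rightarrow> real^'d \<Rightarrow> real) \<Rightarrow> real^'d \<Rightarrow> (real^'d) measure" where
  "gibbs_kernel W x = gibbs (W x)"

definition gauss_density :: "real^'d^'d \<Rightarrow> real^'d \<Rightarrow> real" where
  "gauss_density \<tau> z = exp (- (z \<bullet> (matrix_inv \<tau> *v z)) / 2) / sqrt (det ((2 * pi) *\<^sub>R \<tau>))"

definition gauss_potential ::
  "real^'d^'d \<Rightarrow> real^'d \<Rightarrow> real^'d^'d \<Rightarrow> real^'d \<Rightarrow> real^'d \<Rightarrow> real" where
  "gauss_potential \<tau> \<alpha> \<beta> x y = - ln (gauss_density \<tau> (y - (\<alpha> + \<beta> *v x)))"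

text \<open>The measure \<open>\<mu>(dx) K(x, dy)\<close> on pairs \<open>(x, y)\<close>.\<close>

definition kernel_prod ::
  "(real^'d) measure \<Rightarrow> (real^'d \<Rightarrow> (real^'d) measure) \<Rightarrow> ((real^'d) \<times> (real^'d)) measure" where
  "kernel_prod \<mu> K = \<mu> \<bind> (\<lambda>x. distr (K x) borel (\<lambda>y. (x, y)))"

definition swap_measure :: "((real^'d) \<times> (real^'d)) measure \<Rightarrow> ((real^'d) \<times> (real^'d)) measure" where
  "swap_measure P = distr P borel prod.swap"

definition couplings ::
  "(real^'d) measure \<Rightarrow> (real^'d) measure \<Rightarrow> ((real^'d) \<times> (real^'d)) measure set" where
  "couplings \<mu> \<eta> = {Q. prob_space Q \<and> sets Q = sets borel \<and>
                      distr Q borel fst = \<mu> \<and> distr Q borel snd = \<eta>}"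

text \<open>Relative entropy of a probability measure \<open>\<nu>\<close> with respect to a probability measure \<open>\<mu>\<close>, with
  values in \<open>[0, \<infinity>]\<close>. The negative part of \<open>ln (d\<nu>/d\<mu>)\<close> is always \<open>\<nu>\<close>-integrable, so failure of
  integrability means that the integral is \<open>\<infinity>\<close>. Note the order of arguments of
  \<^const>\<open>KL_divergence\<close>: the reference measure comes first.\<close>

definition rel_entropy :: "'a measure \<Rightarrow> 'a measure \<Rightarrow> ereal" where
  "rel_entropy \<nu> \<mu> =
     (if absolutely_continuous \<mu> \<nu> \<and> integrable \<nu> (entropy_density (exp 1) \<mu> \<nu>)
      then ereal (KL_divergence (exp 1) \<mu> \<nu>) else \<infinity>)"

text \<open>\<open>\<nu>(\<parallel>\<nabla> log d\<nu>/d\<mu>\<parallel>\<^sup>2)\<close>, computed from a version \<open>f\<close> of the density that is differentiable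
  everywhere, and \<open>\<infinity>\<close> if there is no such version. An almost everywhere defined gradient would not do:
  piecewise constant densities would violate every log-Sobolev inequality. If \<open>\<mu>\<close> has full support,
  \<open>f\<close> is unique. Points with \<open>f x = 0\<close> are irrelevant since they form a \<open>\<nu>\<close>-null set.\<close>

definition fisher_information :: "(real^'d) measure \<Rightarrow> (real^'d) measure \<Rightarrow> ennreal" where
  "fisher_information \<nu> \<mu> =
     (INF f \<in> {f. (\<forall>x. 0 \<le> f x) \<and> f differentiable_on UNIV \<and>
                  \<nu> = density \<mu> (\<lambda>x. ennreal (f x))}.
        \<integral>\<^sup>+ x. ennreal ((norm (grad (\<lambda>z. ln (f z)) x))\<^sup>2) \<partial>\<nu>)"

definition log_sobolev :: "(real^'d) measure \<Rightarrow> real \<Rightarrow> bool" where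
  "log_sobolev \<mu> \<rho> \<longleftrightarrow>
     (\<forall>\<nu>. prob_space \<nu> \<and> sets \<nu> = sets \<mu> \<and> absolutely_continuous \<mu> \<nu> \<longrightarrow>
        rel_entropy \<nu> \<mu> \<le> ereal (\<rho> / 2) * enn2ereal (fisher_information \<nu> \<mu>))"

text \<open>The type argument fixes the dimension.\<close>

definition perturbation_constant ::
  "'d::finite itself \<Rightarrow> (real \<Rightarrow> real \<Rightarrow> real \<Rightarrow> real) \<Rightarrow> bool" where
  "perturbation_constant _ \<rho> \<longleftrightarrow>
     (\<forall>a b \<delta>. 0 < a \<and> 0 \<le> b \<and> 0 \<le> \<delta> \<longrightarrow>
        0 < \<rho> a b \<delta> \<and>
        (\<forall>F :: real^'d \<Rightarrow> real.
           smooth F \<and> prob_space (gibbs F) \<and> hess_bound (a *\<^sub>R mat 1) (b *\<^sub>R mat 1) \<delta> F \<longrightarrow>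
           log_sobolev (gibbs F) (\<rho> a b \<delta>)))"

section \<open>Sinkhorn bridges\<close>

text \<open>Disintegration determines each transition only almost everywhere, so the Sinkhorn recursion is
  a relation between \<open>\<mu>\<close>, \<open>\<eta>\<close>, \<open>K\<^sub>0\<close> and the sequence \<open>K\<close>. Here \<open>\<mu> \<bind> K (2 * n)\<close> is \<open>\<pi>\<^sub>2\<^sub>n\<close> and
  \<open>\<eta> \<bind> K (2 * n + 1)\<close> is \<open>\<pi>\<^sub>2\<^sub>n\<^sub>+\<^sub>1\<close>.\<close>

definition sinkhorn_kernels ::
  "(real^'d) measure \<Rightarrow> (real^'d) measure \<Rightarrow> (real^'d \<Rightarrow> (real^'d) measure) \<Rightarrow>
   (nat \<Rightarrow> real^'d \<Rightarrow> (real^'d) measure) \<Rightarrow> bool" where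
  "sinkhorn_kernels \<mu> \<eta> K\<^sub>0 K \<longleftrightarrow>
     K 0 = K\<^sub>0 \<and>
     (\<forall>n. K n \<in> borel \<rightarrow>\<^sub>M prob_algebra borel) \<and>
     (\<forall>n. kernel_prod \<mu> (K (2 * n)) =
            swap_measure (kernel_prod (\<mu> \<bind> K (2 * n)) (K (2 * n + 1)))) \<and>
     (\<forall>n. kernel_prod \<eta> (K (2 * n + 1)) =
            swap_measure (kernel_prod (\<eta> \<bind> K (2 * n + 1)) (K (2 * (n + 1)))))"

definition sinkhorn_bridge ::
  "(real^'d) measure \<Rightarrow> (real^'d) measure \<Rightarrow> (nat \<Rightarrow> real^'d \<Rightarrow> (real^'d) measure) \<Rightarrow>
   nat \<Rightarrow> ((real^'d) \<times> (real^'d)) measure" where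
  "sinkhorn_bridge \<mu> \<eta> K n =
     (if even n then kernel_prod \<mu> (K n) else swap_measure (kernel_prod \<eta> (K n)))"

definition diff_under_integral ::
  "(real^'d) measure \<Rightarrow> (real^'d \<Rightarrow> real^'d \<Rightarrow> real) \<Rightarrow> bool" where
  "diff_under_integral m g \<longleftrightarrow>
     smooth (\<lambda>y. \<integral>x. g x y \<partial>m) \<and>
     (\<forall>vs y. integrable m (\<lambda>x. dderivs vs (g x) y) \<and>
             dderivs vs (\<lambda>y. \<integral>x. g x y \<partial>m) y = (\<integral>x. dderivs vs (g x) y \<partial>m))"

text \<open>The transitions have smooth log-densities \<open>- w n\<close>. The integrals that may be differentiated are
  the Lebesgue densities \<open>y \<mapsto> \<integral>x. exp (- w n (x, y))\<close> of the marginals \<open>\<pi>\<^sub>n\<close>, which are the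
  normalising constants of the next transition.\<close>

definition smooth_transitions ::
  "(real^'d) measure \<Rightarrow> (real^'d) measure \<Rightarrow>
   (nat \<Rightarrow> real^'d \<Rightarrow> (real^'d) measure) \<Rightarrow> bool" where
  "smooth_transitions \<mu> \<eta> K \<longleftrightarrow>
     (\<exists>w :: nat \<Rightarrow> (real^'d) \<times> (real^'d) \<Rightarrow> real. \<forall>n.
        smooth (w n) \<and>
        K n = gibbs_kernel (\<lambda>x y. w n (x, y)) \<and>
        diff_under_integral (if even n then \<mu> else \<eta>) (\<lambda>x y. exp (- w n (x, y))))"

definition \<phi> :: "real \<Rightarrow> real" where
  "\<phi> \<epsilon> = inverse \<epsilon> / (sqrt (1 / 4 + inverse \<epsilon>) + 1 / 2)"

end

(* Write H(.|.) for relative entropy, T_k for the prescribed marginal which the k-th bridge P_k misses,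
   pi_k for the marginal that P_k has instead, and a_k = H(P|P_k), h_k = H(T_k|pi_k), h'_k = H(pi_k|T_k).

   The density of P_k with respect to P_{k+1} depends only on the missed coordinate, so
   a_k = h_k + a_{k+1}, and the optimal bridge P minimises H(.|P_k) over the couplings for every k.
   Data processing gives h'_{k+1} <= h_k. Since the reference is Gaussian, each transition is an
   exponential family: log K_k(x, dy) is a function of x plus a function of y plus x . M_k y, where M_k is
   tau^-1 beta or its transpose. Its potential in y is E plus a convex log-Laplace transform, where E is U
   or V, so the transitions inherit the Hessian bounds, hence the logarithmic Sobolev inequality, of E, and
   the log-partition functions are sub-Gaussian.

   Together with the inequality for the other marginal this yields the dual transport inequality
   eps log T_k(exp(K f / eps)) <= T_k(log K exp f), by monotonicity along a Hamilton-Jacobi interpolation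
   (respectively by Prekopa-Leindler when the marginals are strongly log-concave). Applied to
   f = sum of the log-ratios of later marginals it bounds the sum of the h_i with k + 1 < i < k + 2 + 2j
   by eps h_k, i.e. a_{k+2} - a_{k+2+2j} <= eps (a_k - a_{k+1}).

   Comparing P with an explicit coupling close to P_{2n+1} shows a_k -> 0, so that
   a_{k+2} <= eps (a_k - a_{k+1}). With phi (1 + phi) = 1 / eps, the quantity a_k + phi a_{k+1} then
   contracts by the factor 1 + phi in each step. *)

theory Submission imports Defs begin

section \<open>Prekopa-Leindler\<close>

lemma emeasure_minkowski_sum_compact_real:
  fixes A B :: "real set"
  assumes "compact A" "compact B" "A \<noteq> {}" "B \<noteq> {}"
  shows "emeasure lborel A + emeasure lborel B \<le> emeasure lborel {x + y |x y. x \<in> A \<and> y \<in> B}"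
proof -
  obtain b where b: "b \<in> B" "\<And>y. y \<in> B \<Longrightarrow> b \<le> y"
    using compact_attains_inf[OF assms(2,4)] by blast
  obtain a where a: "a \<in> A" "\<And>x. x \<in> A \<Longrightarrow> x \<le> a"
    using compact_attains_sup[OF assms(1,3)] by blast
  have m: "A \<in> sets borel" "B \<in> sets borel"
    using assms borel_compact by auto
  have s: "{x + y |x y. x \<in> A \<and> y \<in> B} \<in> sets borel"
    using borel_compact[OF compact_sums[OF assms(1,2)]] .
  let ?A = "(+) b ` A" and ?B = "(+) a ` B"
  have AB: "?A \<in> sets borel" "?B \<in> sets borel"
    using compact_translation[OF assms(1)] compact_translation[OF assms(2)] borel_compact by auto
  have int: "?A \<inter> ?B \<subseteq> {a + b}"
  proof
    fix z assume "z \<in> ?A \<inter> ?B"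
    then obtain x y where "x \<in> A" "y \<in> B" "z = b + x" "z = a + y" by auto
    with a(2)[of x] b(2)[of y] have "z = a + b" by auto
    then show "z \<in> {a + b}" by simp
  qed
  have nul: "emeasure lborel (?A \<inter> ?B) = 0"
    by (metis int AB emeasure_lborel_singleton emeasure_mono le_zero_eq sets.Int sets_lborel
        singletonI borel_singleton sets.empty_sets)
  have tr: "emeasure lborel ((+) c ` C) = emeasure lborel C" if "C \<in> sets borel" "(+) c ` C \<in> sets borel" for c :: real and C
  proof -
    have "emeasure lborel ((+) c ` C) = emeasure (distr lborel borel ((+) c)) ((+) c ` C)"
      by (simp add: lborel_distr_plus)
    also have "\<dots> = emeasure lborel ((+) c -` (+) c ` C)"
      using that by (simp add: emeasure_distr)
    also have "(+) c -` (+) c ` C = C" by auto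
    finally show ?thesis .
  qed
  have "emeasure lborel A + emeasure lborel B = emeasure lborel ?A + emeasure lborel ?B"
    using tr m AB by simp
  also have "\<dots> = emeasure lborel (?A \<union> ?B) + emeasure lborel (?A \<inter> ?B)"
    using AB by (intro emeasure_Un_Int) auto
  also have "\<dots> = emeasure lborel (?A \<union> ?B)" by (simp add: nul)
  also have "\<dots> \<le> emeasure lborel {x + y |x y. x \<in> A \<and> y \<in> B}"
  proof (rule emeasure_mono)
    show "?A \<union> ?B \<subseteq> {x + y |x y. x \<in> A \<and> y \<in> B}"
      using a(1) b(1) by (auto simp: add.commute[of b])
  qed (use s in simp)
  finally show ?thesis .
qed

lemma inner_regular_lborel_less:
  fixes A :: "'a::euclidean_space set"
  assumes "A \<in> sets borel" "c < emeasure lborel A"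
  obtains K where "compact K" "K \<subseteq> A" "c < emeasure lborel K"
proof -
  let ?B = "\<lambda>n::nat. A \<inter> cball 0 (real n)"
  have "(SUP n. emeasure lborel (?B n)) = emeasure lborel (\<Union>n. ?B n)"
    using assms(1) by (intro SUP_emeasure_incseq) (auto simp: incseq_def)
  also have "(\<Union>n. ?B n) = A"
    using real_arch_simple by (auto simp: mem_cball)
  finally have "c < (SUP n. emeasure lborel (?B n))" using assms(2) by simp
  then obtain n where n: "c < emeasure lborel (?B n)"
    unfolding less_SUP_iff by blast
  have Bm: "?B n \<in> sets borel" using assms(1) by auto
  have B: "?B n \<in> fmeasurable lborel"
  proof (rule fmeasurableI)
    show "emeasure lborel (?B n) < \<infinity>"
      using emeasure_mono[of "?B n" "cball 0 (real n)" lborel] emeasure_lborel_cball_finite[of "0::'a" "real n"]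
      by (auto simp: less_top intro: le_less_trans)
  qed (use Bm in simp)
  define m where "m = measure lborel (?B n)"
  have m: "emeasure lborel (?B n) = ennreal m"
    using B by (simp add: m_def emeasure_eq_measure2)
  obtain d where d: "c = ennreal d" "0 \<le> d" "d < m"
    using n unfolding m by (cases c) (auto simp: ennreal_less_iff)
  obtain T where T: "closed T" "T \<subseteq> ?B n" "?B n - T \<in> lmeasurable" "emeasure lebesgue (?B n - T) < ennreal (m - d)"
    using sets_lebesgue_inner_closed[of "?B n" "m - d"] Bm d(3)
    by auto
  have TB: "T \<in> sets borel" using T by auto
  have F: "T \<in> fmeasurable lborel" "?B n - T \<in> fmeasurable lborel"
    using fmeasurableI2[OF B T(2)] fmeasurable_Diff[OF B, of T] TB by auto
  have "measure lborel (?B n - T) < m - d"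
    using T(4) F Bm TB by (simp add: main_part_sets emeasure_eq_measure2 ennreal_less_iff)
  moreover have "measure lborel (?B n - T) = m - measure lborel T"
    unfolding m_def using B F TB T(2) by (intro measure_Diff) (auto simp: emeasure_eq_measure2)
  ultimately have "c < emeasure lborel T"
    using F d by (simp add: emeasure_eq_measure2 ennreal_less_iff)
  moreover have "compact T"
    using T(1,2) bounded_subset[OF bounded_cball, of T 0 "real n"] by (auto simp: compact_eq_bounded_closed)
  ultimately show ?thesis using that T by blast
qed

lemma emeasure_lborel_eq_SUP_compact:
  fixes A :: "'a::euclidean_space set"
  assumes "A \<in> sets borel" "A \<noteq> {}"
  shows "emeasure lborel A = (SUP K\<in>{K. compact K \<and> K \<noteq> {} \<and> K \<subseteq> A}. emeasure lborel K)"
proof (rule antisym)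
  show "emeasure lborel A \<le> (SUP K\<in>{K. compact K \<and> K \<noteq> {} \<and> K \<subseteq> A}. emeasure lborel K)"
  proof (rule dense_le)
    fix c assume "c < emeasure lborel A"
    then obtain K where K: "compact K" "K \<subseteq> A" "c < emeasure lborel K"
      using inner_regular_lborel_less[OF assms(1)] by blast
    then have "K \<noteq> {}" by auto
    with K show "c \<le> (SUP K\<in>{K. compact K \<and> K \<noteq> {} \<and> K \<subseteq> A}. emeasure lborel K)"
      by (intro SUP_upper2[of K]) auto
  qed
  show "(SUP K\<in>{K. compact K \<and> K \<noteq> {} \<and> K \<subseteq> A}. emeasure lborel K) \<le> emeasure lborel A"
    using assms(1) by (intro SUP_least emeasure_mono) auto
qed

lemma brunn_minkowski_real:
  fixes A B C :: "real set"
  assumes A: "A \<in> sets borel" "A \<noteq> {}" and B: "B \<in> sets borel" "B \<noteq> {}" and C: "C \<in> sets borel"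
    and t: "0 < t" "t < 1"
    and sub: "\<And>x y. x \<in> A \<Longrightarrow> y \<in> B \<Longrightarrow> (1 - t) * x + t * y \<in> C"
  shows "ennreal (1 - t) * emeasure lborel A + ennreal t * emeasure lborel B \<le> emeasure lborel C"
proof -
  let ?S = "\<lambda>A. {K. compact K \<and> K \<noteq> {} \<and> K \<subseteq> A}"
  have scale: "emeasure lborel ((*) c ` K) = ennreal c * emeasure lborel K"
    if "0 < c" "compact K" for c :: real and K
    using emeasure_lebesgue_affine[of c 0 K] that borel_compact[of K] borel_compact[OF compact_scaling[of K c]]
    by (simp add: main_part_sets)
  have cpt: "ennreal (1 - t) * emeasure lborel K + ennreal t * emeasure lborel L \<le> emeasure lborel C"
    if "K \<in> ?S A" "L \<in> ?S B" for K L
  proof -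
    have "ennreal (1 - t) * emeasure lborel K + ennreal t * emeasure lborel L
        = emeasure lborel ((*) (1 - t) ` K) + emeasure lborel ((*) t ` L)"
      using t that by (simp add: scale)
    also have "\<dots> \<le> emeasure lborel {x + y |x y. x \<in> (*) (1 - t) ` K \<and> y \<in> (*) t ` L}"
      using that compact_scaling[of K "1 - t"] compact_scaling[of L t]
      by (intro emeasure_minkowski_sum_compact_real) auto
    also have "\<dots> \<le> emeasure lborel C"
      using that sub C by (intro emeasure_mono) auto
    finally show ?thesis .
  qed
  have ne: "?S A \<noteq> {}" "?S B \<noteq> {}"
  proof -
    obtain x y where "x \<in> A" "y \<in> B" using A B by blast
    then have "{x} \<in> ?S A" "{y} \<in> ?S B" by auto
    then show "?S A \<noteq> {}" "?S B \<noteq> {}" by blast+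
  qed
  have "ennreal (1 - t) * emeasure lborel A + ennreal t * emeasure lborel B
     = (SUP K\<in>?S A. SUP L\<in>?S B. ennreal (1 - t) * emeasure lborel K + ennreal t * emeasure lborel L)"
    unfolding emeasure_lborel_eq_SUP_compact[OF A] emeasure_lborel_eq_SUP_compact[OF B] SUP_mult_left_ennreal
      ennreal_SUP_add_left[OF ne(1), symmetric] ennreal_SUP_add_right[OF ne(2), symmetric] ..
  also have "\<dots> \<le> emeasure lborel C"
    using cpt by (intro SUP_least) auto
  finally show ?thesis .
qed

definition geo_dom :: "real \<Rightarrow> ennreal \<Rightarrow> ennreal \<Rightarrow> ennreal \<Rightarrow> bool" where
  "geo_dom t a b c \<longleftrightarrow> (\<forall>r s. 0 < r \<and> 0 < s \<and> ennreal r < a \<and> ennreal s < b \<longrightarrow>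
     ennreal (r powr (1 - t) * s powr t) \<le> c)"

lemma nn_integral_layer_cake_bounded:
  fixes f :: "'a \<Rightarrow> real"
  assumes M: "sigma_finite_measure M" and [measurable]: "f \<in> borel_measurable M" and f: "\<And>x. 0 \<le> f x" "\<And>x. f x \<le> F" and F: "0 < F"
  shows "(\<integral>\<^sup>+x. ennreal (f x / F) \<partial>M) = (\<integral>\<^sup>+u\<in>{0<..<1}. emeasure M {x\<in>space M. F * u < f x} \<partial>lborel)"
proof -
  interpret M: sigma_finite_measure M by fact
  interpret pair_sigma_finite M "lborel :: real measure" ..
  have "(\<integral>\<^sup>+x. ennreal (f x / F) \<partial>M) = (\<integral>\<^sup>+x. \<integral>\<^sup>+u. indicator {z\<in>space (M \<Otimes>\<^sub>M lborel). 0 < snd z \<and> snd z < 1 \<and> F * snd z < f (fst z)} (x, u) \<partial>lborel \<partial>M)"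
  proof (intro nn_integral_cong)
    fix x assume x: "x \<in> space M"
    have "(\<integral>\<^sup>+u. indicator {z\<in>space (M \<Otimes>\<^sub>M lborel). 0 < snd z \<and> snd z < 1 \<and> F * snd z < f (fst z)} (x, u) \<partial>lborel)
       = (\<integral>\<^sup>+u. indicator {0<..<f x / F} u \<partial>lborel)"
    proof (intro nn_integral_cong)
      fix u :: real
      have "u < 1" if "F * u < f x"
        using that f(2)[of x] F by (metis less_le_trans mult.right_neutral mult_less_cancel_left_pos)
      then show "(indicator {z\<in>space (M \<Otimes>\<^sub>M lborel). 0 < snd z \<and> snd z < 1 \<and> F * snd z < f (fst z)} (x, u) :: ennreal)
          = indicator {0<..<f x / F} u"
        using F x by (auto simp: indicator_def space_pair_measure field_simps)
    qed
    also have "\<dots> = ennreal (f x / F)" using f[of x] F by (subst nn_integral_indicator) auto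
    finally show "ennreal (f x / F) = (\<integral>\<^sup>+u. indicator {z\<in>space (M \<Otimes>\<^sub>M lborel). 0 < snd z \<and> snd z < 1 \<and> F * snd z < f (fst z)} (x, u) \<partial>lborel)" by simp
  qed
  also have "\<dots> = (\<integral>\<^sup>+u. \<integral>\<^sup>+x. indicator {z\<in>space (M \<Otimes>\<^sub>M lborel). 0 < snd z \<and> snd z < 1 \<and> F * snd z < f (fst z)} (x, u) \<partial>M \<partial>lborel)"
    by (rule Fubini'[symmetric]) measurable
  also have "\<dots> = (\<integral>\<^sup>+u\<in>{0<..<1}. emeasure M {x\<in>space M. F * u < f x} \<partial>lborel)"
  proof (intro nn_integral_cong)
    fix u :: real
    have "(\<integral>\<^sup>+x. indicator {z\<in>space (M \<Otimes>\<^sub>M lborel). 0 < snd z \<and> snd z < 1 \<and> F * snd z < f (fst z)} (x, u) \<partial>M)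
       = (\<integral>\<^sup>+x. indicator {x\<in>space M. F * u < f x} x * indicator {0<..<1} u \<partial>M)"
      by (intro nn_integral_cong) (auto simp: indicator_def space_pair_measure)
    also have "\<dots> = emeasure M {x\<in>space M. F * u < f x} * indicator {0<..<1} u"
      by (subst nn_integral_multc) auto
    finally show "(\<integral>\<^sup>+x. indicator {z\<in>space (M \<Otimes>\<^sub>M lborel). 0 < snd z \<and> snd z < 1 \<and> F * snd z < f (fst z)} (x, u) \<partial>M)
       = emeasure M {x\<in>space M. F * u < f x} * indicator {0<..<1} u" .
  qed
  finally show ?thesis .
qed

lemma nn_integral_layer_cake_le:
  fixes h :: "'a \<Rightarrow> ennreal"
  assumes M: "sigma_finite_measure M" and [measurable]: "h \<in> borel_measurable M" and F: "0 < F"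
  shows "ennreal F * (\<integral>\<^sup>+u\<in>{0<..<1}. emeasure M {x\<in>space M. ennreal (F * u) \<le> h x} \<partial>lborel) \<le> (\<integral>\<^sup>+x. h x \<partial>M)"
proof -
  interpret M: sigma_finite_measure M by fact
  interpret pair_sigma_finite M "lborel :: real measure" ..
  let ?Z = "{z\<in>space (M \<Otimes>\<^sub>M lborel). 0 < snd z \<and> snd z < 1 \<and> ennreal (F * snd z) \<le> h (fst z)}"
  have Z[measurable]: "?Z \<in> sets (M \<Otimes>\<^sub>M lborel)" by measurable
  have "(\<integral>\<^sup>+u\<in>{0<..<1}. emeasure M {x\<in>space M. ennreal (F * u) \<le> h x} \<partial>lborel) = (\<integral>\<^sup>+u. \<integral>\<^sup>+x. indicator ?Z (x, u) \<partial>M \<partial>lborel)"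
  proof (intro nn_integral_cong)
    fix u :: real
    have "(\<integral>\<^sup>+x. indicator ?Z (x, u) \<partial>M)
       = (\<integral>\<^sup>+x. indicator {x\<in>space M. ennreal (F * u) \<le> h x} x * indicator {0<..<1} u \<partial>M)"
      by (intro nn_integral_cong) (auto simp: indicator_def space_pair_measure)
    also have "\<dots> = emeasure M {x\<in>space M. ennreal (F * u) \<le> h x} * indicator {0<..<1} u"
      by (subst nn_integral_multc) auto
    finally show "emeasure M {x\<in>space M. ennreal (F * u) \<le> h x} * indicator {0<..<1} u = (\<integral>\<^sup>+x. indicator ?Z (x, u) \<partial>M)" ..
  qed
  also have "\<dots> = (\<integral>\<^sup>+x. \<integral>\<^sup>+u. indicator ?Z (x, u) \<partial>lborel \<partial>M)"
    by (rule Fubini') measurable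
  finally have "ennreal F * (\<integral>\<^sup>+u\<in>{0<..<1}. emeasure M {x\<in>space M. ennreal (F * u) \<le> h x} \<partial>lborel)
    = (\<integral>\<^sup>+x. ennreal F * \<integral>\<^sup>+u. indicator ?Z (x, u) \<partial>lborel \<partial>M)"
    by (simp add: nn_integral_cmult)
  also have "\<dots> \<le> (\<integral>\<^sup>+x. h x \<partial>M)"
  proof (intro nn_integral_mono)
    fix x assume x: "x \<in> space M"
    show "ennreal F * (\<integral>\<^sup>+u. indicator ?Z (x, u) \<partial>lborel) \<le> h x"
    proof (cases "h x")
      case (real r)
      have "(\<integral>\<^sup>+u. indicator ?Z (x, u) \<partial>lborel) \<le> (\<integral>\<^sup>+u. indicator {0..r / F} u \<partial>lborel)"
        using real F by (intro nn_integral_mono) (auto simp: indicator_def field_simps)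
      also have "\<dots> = ennreal (r / F)" using real F by (subst nn_integral_indicator) auto
      finally have "ennreal F * (\<integral>\<^sup>+u. indicator ?Z (x, u) \<partial>lborel) \<le> ennreal F * ennreal (r / F)"
        by (rule mult_left_mono) simp
      also have "\<dots> = h x" using real F by (simp add: ennreal_mult[symmetric])
      finally show ?thesis .
    qed simp
  qed
  finally show ?thesis .
qed

lemma prekopa_leindler_real:
  fixes f g h :: "real \<Rightarrow> ennreal"
  assumes [measurable]: "f \<in> borel_measurable borel" "g \<in> borel_measurable borel" "h \<in> borel_measurable borel"
    and t: "0 < t" "t < 1"
    and dom: "\<And>x y. geo_dom t (f x) (g y) (h ((1 - t) * x + t * y))"
  shows "geo_dom t (\<integral>\<^sup>+x. f x \<partial>lborel) (\<integral>\<^sup>+x. g x \<partial>lborel) (\<integral>\<^sup>+x. h x \<partial>lborel)"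
  unfolding geo_dom_def
proof (intro allI impI, elim conjE)
  fix r s :: real
  assume r: "0 < r" "ennreal r < (\<integral>\<^sup>+x. f x \<partial>lborel)" and s: "0 < s" "ennreal s < (\<integral>\<^sup>+x. g x \<partial>lborel)"
  have trunc: "\<exists>F f'. f' \<in> borel_measurable borel \<and> 0 < F \<and> (\<forall>x. 0 \<le> f' x \<and> f' x \<le> F \<and> ennreal (f' x) \<le> f x) \<and>
      (\<forall>u<1. \<exists>x. F * u < f' x) \<and> ennreal (r / F) \<le> (\<integral>\<^sup>+x. ennreal (f' x / F) \<partial>lborel)"
    if [measurable]: "f \<in> borel_measurable borel" and r: "0 < r" "ennreal r < (\<integral>\<^sup>+x. f x \<partial>lborel)"
    for f :: "real \<Rightarrow> ennreal" and r :: real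
  proof -
    have "(\<integral>\<^sup>+x. f x \<partial>lborel) = (\<integral>\<^sup>+x. (SUP k::nat. min (f x) (of_nat k)) \<partial>lborel)"
    proof (intro nn_integral_cong)
      fix x
      have "(SUP k::nat. min (f x) (of_nat k)) = min (f x) (SUP k::nat. of_nat k)"
        by (simp add: inf_min[symmetric] inf_SUP)
      then show "f x = (SUP k::nat. min (f x) (of_nat k))"
        by (simp add: ennreal_SUP_of_nat_eq_top)
    qed
    also have "\<dots> = (SUP k::nat. \<integral>\<^sup>+x. min (f x) (of_nat k) \<partial>lborel)"
      by (intro nn_integral_monotone_convergence_SUP) (auto simp: incseq_def le_fun_def intro: min.coboundedI2)
    finally obtain k :: nat where k: "ennreal r < (\<integral>\<^sup>+x. min (f x) (of_nat k) \<partial>lborel)"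
      using r(2) by (auto simp: less_SUP_iff)
    define f' where "f' x = enn2real (min (f x) (of_nat k))" for x
    have f': "ennreal (f' x) = min (f x) (of_nat k)" for x
      unfolding f'_def by (intro ennreal_enn2real) (auto simp: min_less_iff_disj of_nat_less_top)
    have [measurable]: "f' \<in> borel_measurable borel" unfolding f'_def by measurable
    have bd: "0 \<le> f' x" "f' x \<le> real k" for x
      using f'[of x] unfolding f'_def
      by (auto simp: enn2real_leI ennreal_of_nat_eq_real_of_nat)
    define F where "F = (SUP x. f' x)"
    have bdd: "bdd_above (range f')" using bd by (auto intro!: bdd_aboveI[of _ "real k"])
    have up: "f' x \<le> F" for x unfolding F_def by (intro cSUP_upper bdd) auto
    have "F > 0"
    proof (rule ccontr)
      assume "\<not> 0 < F"
      then have "f' x = 0" for x using up[of x] bd[of x] by auto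
      then have "(\<integral>\<^sup>+x. min (f x) (of_nat k) \<partial>lborel) = 0" by (simp add: f'[symmetric])
      then show False using k by simp
    qed
    moreover have "\<exists>x. F * u < f' x" if "u < 1" for u
      using less_cSUP_iff[OF _ bdd, of "F * u"] that \<open>F > 0\<close> unfolding F_def[symmetric] by auto
    moreover have "ennreal (r / F) \<le> (\<integral>\<^sup>+x. ennreal (f' x / F) \<partial>lborel)"
    proof -
      have "ennreal (r / F) = ennreal (1 / F) * ennreal r" using \<open>F > 0\<close> r by (simp add: ennreal_mult[symmetric])
      also have "\<dots> \<le> ennreal (1 / F) * (\<integral>\<^sup>+x. ennreal (f' x) \<partial>lborel)"
        using k by (intro mult_left_mono) (auto simp: f')
      also have "\<dots> = (\<integral>\<^sup>+x. ennreal (f' x / F) \<partial>lborel)"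
        using \<open>F > 0\<close> bd by (simp add: nn_integral_cmult[symmetric] ennreal_mult[symmetric])
      finally show ?thesis .
    qed
    ultimately show ?thesis
      using bd up by (intro exI[of _ F] exI[of _ f']) (auto simp: f')
  qed
  from trunc[OF assms(1) r] obtain F f' where F: "f' \<in> borel_measurable borel" "0 < F" "\<And>x. 0 \<le> f' x" "\<And>x. f' x \<le> F"
    "\<And>x. ennreal (f' x) \<le> f x" "\<And>u. u < 1 \<Longrightarrow> \<exists>x. F * u < f' x" "ennreal (r / F) \<le> (\<integral>\<^sup>+x. ennreal (f' x / F) \<partial>lborel)"
    by blast
  from trunc[OF assms(2) s] obtain G g' where G: "g' \<in> borel_measurable borel" "0 < G" "\<And>x. 0 \<le> g' x" "\<And>x. g' x \<le> G"
    "\<And>x. ennreal (g' x) \<le> g x" "\<And>u. u < 1 \<Longrightarrow> \<exists>x. G * u < g' x" "ennreal (s / G) \<le> (\<integral>\<^sup>+x. ennreal (g' x / G) \<partial>lborel)"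
    by blast
  note [measurable] = F(1) G(1)
  define \<theta> where "\<theta> = F powr (1 - t) * G powr t"
  have \<theta>: "0 < \<theta>" using F G by (simp add: \<theta>_def)
  have level: "ennreal (1 - t) * emeasure lborel {x. F * u < f' x} + ennreal t * emeasure lborel {x. G * u < g' x}
      \<le> emeasure lborel {x. ennreal (\<theta> * u) \<le> h x}" if u: "0 < u" "u < 1" for u
  proof (rule brunn_minkowski_real)
    fix x y assume "x \<in> {x. F * u < f' x}" "y \<in> {x. G * u < g' x}"
    then have "ennreal (F * u) < f x" "ennreal (G * u) < g y"
      using less_le_trans[OF ennreal_lessI F(5)[of x], of "F * u"] less_le_trans[OF ennreal_lessI G(5)[of y], of "G * u"]
        mult_pos_pos[OF F(2) u(1)] mult_pos_pos[OF G(2) u(1)] by auto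
    then have "ennreal ((F * u) powr (1 - t) * (G * u) powr t) \<le> h ((1 - t) * x + t * y)"
      using dom[of x y] F(2) G(2) u unfolding geo_dom_def by auto
    also have "(F * u) powr (1 - t) * (G * u) powr t = \<theta> * (u powr (1 - t) * u powr t)"
      using F(2) G(2) u by (simp add: \<theta>_def powr_mult)
    also have "u powr (1 - t) * u powr t = u" using u by (simp add: powr_add[symmetric])
    finally show "(1 - t) * x + t * y \<in> {x. ennreal (\<theta> * u) \<le> h x}" by simp
  qed (use t F(6)[OF u(2)] G(6)[OF u(2)] in auto)
  have "ennreal (r powr (1 - t) * s powr t) = ennreal (\<theta> * ((r / F) powr (1 - t) * (s / G) powr t))"
    using F(2) G(2) r s by (simp add: \<theta>_def powr_divide)
  also have "\<dots> \<le> ennreal (\<theta> * ((1 - t) * (r / F) + t * (s / G)))"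
    using F(2) G(2) r s t \<theta> by (intro ennreal_leI mult_left_mono Youngs_inequality_0) auto
  also have "\<dots> = ennreal \<theta> * (ennreal (1 - t) * ennreal (r / F) + ennreal t * ennreal (s / G))"
    using F(2) G(2) r s t \<theta> by (simp add: ennreal_mult[symmetric] ennreal_plus[symmetric] del: ennreal_plus)
  also have "\<dots> \<le> ennreal \<theta> * (ennreal (1 - t) * (\<integral>\<^sup>+x. ennreal (f' x / F) \<partial>lborel) + ennreal t * (\<integral>\<^sup>+x. ennreal (g' x / G) \<partial>lborel))"
    using F(7) G(7) by (intro mult_left_mono add_mono) auto
  also have "\<dots> = ennreal \<theta> * (\<integral>\<^sup>+u\<in>{0<..<1}. (ennreal (1 - t) * emeasure lborel {x. F * u < f' x} + ennreal t * emeasure lborel {x. G * u < g' x}) \<partial>lborel)"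
  proof -
    have [measurable]: "(\<lambda>u. emeasure lborel {x. F * u < f' x}) \<in> borel_measurable borel"
      "(\<lambda>u. emeasure lborel {x. G * u < g' x}) \<in> borel_measurable borel"
      by (rule lborel.measurable_emeasure; measurable)+
    have "(\<integral>\<^sup>+x. ennreal (f' x / F) \<partial>lborel) = (\<integral>\<^sup>+u\<in>{0<..<1}. emeasure lborel {x. F * u < f' x} \<partial>lborel)"
      using nn_integral_layer_cake_bounded[of lborel f', OF sigma_finite_lborel _ F(3,4,2)] by simp
    moreover have "(\<integral>\<^sup>+x. ennreal (g' x / G) \<partial>lborel) = (\<integral>\<^sup>+u\<in>{0<..<1}. emeasure lborel {x. G * u < g' x} \<partial>lborel)"
      using nn_integral_layer_cake_bounded[of lborel g', OF sigma_finite_lborel _ G(3,4,2)] by simp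
    moreover have "(\<integral>\<^sup>+u\<in>{0<..<1}. (ennreal (1 - t) * emeasure lborel {x. F * u < f' x} + ennreal t * emeasure lborel {x. G * u < g' x}) \<partial>lborel)
      = ennreal (1 - t) * (\<integral>\<^sup>+u\<in>{0<..<1}. emeasure lborel {x. F * u < f' x} \<partial>lborel)
        + ennreal t * (\<integral>\<^sup>+u\<in>{0<..<1}. emeasure lborel {x. G * u < g' x} \<partial>lborel)"
      unfolding distrib_right mult.assoc by (subst nn_integral_add; simp add: nn_integral_cmult)
    ultimately show ?thesis by simp
  qed
  also have "\<dots> \<le> ennreal \<theta> * (\<integral>\<^sup>+u\<in>{0<..<1}. emeasure lborel {x. ennreal (\<theta> * u) \<le> h x} \<partial>lborel)"
    using level by (intro mult_left_mono nn_integral_mono) (auto simp: indicator_def)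
  also have "\<dots> \<le> (\<integral>\<^sup>+x. h x \<partial>lborel)"
    using nn_integral_layer_cake_le[OF sigma_finite_lborel _ \<theta>, of h] by simp
  finally show "ennreal (r powr (1 - t) * s powr t) \<le> (\<integral>\<^sup>+x. h x \<partial>lborel)" .
qed

lemma prekopa_leindler_PiM:
  fixes f g h :: "('i \<Rightarrow> real) \<Rightarrow> ennreal"
  assumes "finite I" and t: "0 < t" "t < 1"
    and "f \<in> borel_measurable (PiM I (\<lambda>_. lborel))" "g \<in> borel_measurable (PiM I (\<lambda>_. lborel))"
      "h \<in> borel_measurable (PiM I (\<lambda>_. lborel))"
    and "\<And>x y. x \<in> extensional I \<Longrightarrow> y \<in> extensional I \<Longrightarrow> geo_dom t (f x) (g y) (h (\<lambda>i\<in>I. (1 - t) * x i + t * y i))"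
  shows "geo_dom t (\<integral>\<^sup>+x. f x \<partial>PiM I (\<lambda>_. lborel)) (\<integral>\<^sup>+x. g x \<partial>PiM I (\<lambda>_. lborel)) (\<integral>\<^sup>+x. h x \<partial>PiM I (\<lambda>_. lborel))"
  using assms(1,4-)
proof (induction I arbitrary: f g h rule: finite_induct)
  case empty
  then show ?case using empty(4)[of "\<lambda>_. undefined" "\<lambda>_. undefined"]
    by (simp add: PiM_empty nn_integral_count_space_finite restrict_def)
next
  case (insert i I)
  interpret product_sigma_finite "\<lambda>_::'i. lborel :: real measure" ..
  note [measurable] = insert.prems(1-3)
  have eq: "integral\<^sup>N (PiM (insert i I) (\<lambda>_. lborel)) f = (\<integral>\<^sup>+ y. (\<integral>\<^sup>+ x. f (x(i := y)) \<partial>PiM I (\<lambda>_. lborel)) \<partial>lborel)"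
    if "f \<in> borel_measurable (PiM (insert i I) (\<lambda>_. lborel))" for f :: "('i \<Rightarrow> real) \<Rightarrow> ennreal"
    using insert.hyps that by (rule product_nn_integral_insert_rev)
  interpret I: finite_product_sigma_finite "\<lambda>_. lborel" I by standard fact
  have [measurable]: "(\<lambda>y. \<integral>\<^sup>+ x. f (x(i := y)) \<partial>PiM I (\<lambda>_. lborel)) \<in> borel_measurable borel"
    if [measurable]: "f \<in> borel_measurable (PiM (insert i I) (\<lambda>_. lborel))" for f :: "('i \<Rightarrow> real) \<Rightarrow> ennreal"
    by measurable
  have sec: "(\<lambda>x. f (x(i := y))) \<in> borel_measurable (PiM I (\<lambda>_. lborel))"
    if [measurable]: "f \<in> borel_measurable (PiM (insert i I) (\<lambda>_. lborel))" for f :: "('i \<Rightarrow> real) \<Rightarrow> ennreal" and y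
    by measurable
  show ?case
    unfolding eq[OF insert.prems(1)] eq[OF insert.prems(2)] eq[OF insert.prems(3)]
  proof (rule prekopa_leindler_real[OF _ _ _ t])
    fix a b :: real
    show "geo_dom t (\<integral>\<^sup>+ x. f (x(i := a)) \<partial>PiM I (\<lambda>_. lborel)) (\<integral>\<^sup>+ x. g (x(i := b)) \<partial>PiM I (\<lambda>_. lborel))
      (\<integral>\<^sup>+ x. h (x(i := (1 - t) * a + t * b)) \<partial>PiM I (\<lambda>_. lborel))"
    proof (rule insert.IH[OF sec sec sec])
      fix x y :: "'i \<Rightarrow> real" assume "x \<in> extensional I" "y \<in> extensional I"
      then have "geo_dom t (f (x(i := a))) (g (y(i := b))) (h (\<lambda>j\<in>insert i I. (1 - t) * (x(i := a)) j + t * (y(i := b)) j))"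
        by (intro insert.prems(4)) (auto simp: extensional_def)
      also have "(\<lambda>j\<in>insert i I. (1 - t) * (x(i := a)) j + t * (y(i := b)) j) = (\<lambda>j\<in>I. (1 - t) * x j + t * y j)(i := (1 - t) * a + t * b)"
        using insert.hyps by (auto simp: fun_eq_iff restrict_def)
      finally show "geo_dom t (f (x(i := a))) (g (y(i := b))) (h ((\<lambda>j\<in>I. (1 - t) * x j + t * y j)(i := (1 - t) * a + t * b)))" .
    qed fact+
  qed measurable
qed

theorem prekopa_leindler:
  fixes f g h :: "'a::euclidean_space \<Rightarrow> ennreal"
  assumes [measurable]: "f \<in> borel_measurable borel" "g \<in> borel_measurable borel" "h \<in> borel_measurable borel"
    and t: "0 < t" "t < 1"
    and dom: "\<And>x y. geo_dom t (f x) (g y) (h ((1 - t) *\<^sub>R x + t *\<^sub>R y))"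
  shows "geo_dom t (\<integral>\<^sup>+x. f x \<partial>lborel) (\<integral>\<^sup>+x. g x \<partial>lborel) (\<integral>\<^sup>+x. h x \<partial>lborel)"
proof -
  let ?P = "PiM (Basis::'a set) (\<lambda>_. lborel :: real measure)"
  let ?T = "\<lambda>x. \<Sum>b\<in>Basis. x b *\<^sub>R b :: 'a"
  have eq: "(\<integral>\<^sup>+x. f x \<partial>lborel) = (\<integral>\<^sup>+x. f (?T x) \<partial>?P)"
    if [measurable]: "f \<in> borel_measurable borel" for f :: "'a \<Rightarrow> ennreal"
    by (subst lborel_eq, subst nn_integral_distr) auto
  show ?thesis
    unfolding eq[OF assms(1)] eq[OF assms(2)] eq[OF assms(3)]
  proof (rule prekopa_leindler_PiM[OF _ t])
    fix x y :: "'a \<Rightarrow> real"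
    have "(1 - t) *\<^sub>R ?T x + t *\<^sub>R ?T y = ?T (\<lambda>i\<in>Basis. (1 - t) * x i + t * y i)"
      by (simp add: scaleR_sum_right sum.distrib[symmetric] algebra_simps)
    then show "geo_dom t (f (?T x)) (g (?T y)) (h (?T (\<lambda>i\<in>Basis. (1 - t) * x i + t * y i)))"
      using dom[of "?T x" "?T y"] by simp
  qed auto
qed

section \<open>Smooth functions and Hessian bounds\<close>

lemma smooth_differentiable: "smooth f \<Longrightarrow> f differentiable (at x)"
  unfolding smooth_def differentiable_on_def by (metis UNIV_I dderivs.simps(1))

lemma smooth_has_derivative: "smooth f \<Longrightarrow> (f has_derivative frechet_derivative f (at x)) (at x)"
  using smooth_differentiable frechet_derivative_works by blast

lemma smooth_frechet_derivative: "smooth f \<Longrightarrow> smooth (\<lambda>x. frechet_derivative f (at x) v)"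
  unfolding smooth_def by (metis dderivs.simps(2))

lemma smooth_continuous_on: "smooth f \<Longrightarrow> continuous_on S f"
  by (simp add: continuous_at_imp_continuous_on differentiable_imp_continuous_within smooth_differentiable)

lemma smooth_borel_measurable: "smooth f \<Longrightarrow> f \<in> borel_measurable borel"
  by (simp add: borel_measurable_continuous_onI smooth_continuous_on)

lemma smooth_compose_affine:
  fixes f :: "'b::euclidean_space \<Rightarrow> real" and L :: "'a::euclidean_space \<Rightarrow> 'b"
  assumes "smooth f" "bounded_linear L"
  shows "smooth (\<lambda>x. f (c + L x))"
proof -
  have step: "frechet_derivative (\<lambda>x. f (c + L x)) (at x) v = frechet_derivative f (at (c + L x)) (L v)"
    and diff: "(\<lambda>x. f (c + L x)) differentiable (at x)"
    if "smooth f" for f :: "'b \<Rightarrow> real" and x v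
  proof -
    have "((\<lambda>x. c + L x) has_derivative L) (at x)"
      using bounded_linear_imp_has_derivative[OF assms(2)] by (auto intro!: derivative_eq_intros)
    from diff_chain_at[OF this smooth_has_derivative[OF that, of "c + L x"]]
    have "((\<lambda>x. f (c + L x)) has_derivative frechet_derivative f (at (c + L x)) \<circ> L) (at x)"
      by (simp add: o_def)
    then show "frechet_derivative (\<lambda>x. f (c + L x)) (at x) v = frechet_derivative f (at (c + L x)) (L v)"
      "(\<lambda>x. f (c + L x)) differentiable (at x)"
      by (auto simp: frechet_derivative_at[symmetric] differentiable_def)
  qed
  have "dderivs vs (\<lambda>x. f (c + L x)) = (\<lambda>x. dderivs (map L vs) f (c + L x))" if "smooth f" for f :: "'b \<Rightarrow> real" and vs
    using that
  proof (induction vs arbitrary: f)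
    case (Cons v vs)
    then show ?case
      using Cons.IH[OF smooth_frechet_derivative[OF Cons.prems, of "L v"]] by (simp add: step)
  qed simp
  moreover have "smooth (dderivs ws f)" for ws
    using assms(1) by (induction ws arbitrary: f) (auto simp: smooth_frechet_derivative)
  ultimately show ?thesis
    using diff assms(1) unfolding smooth_def[of "\<lambda>x. f (c + L x)"] differentiable_on_def
    by (auto intro: differentiable_at_withinI)
qed

lemma smooth_section:
  fixes f :: "'a::euclidean_space \<times> 'b::euclidean_space \<Rightarrow> real"
  assumes "smooth f"
  shows "smooth (\<lambda>y. f (x, y))" "smooth (\<lambda>x. f (x, y))"
  using smooth_compose_affine[OF assms, of "\<lambda>y. (0, y)" "(x, 0)"]
    smooth_compose_affine[OF assms, of "\<lambda>x. (x, 0)" "(0, y)"]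
  by (auto simp: bounded_linear_Pair bounded_linear_ident bounded_linear_zero)

lemma smooth_has_real_derivative_line:
  assumes "smooth f"
  shows "((\<lambda>s. f (x + s *\<^sub>R e)) has_real_derivative frechet_derivative f (at (x + s *\<^sub>R e)) e) (at s)"
proof -
  have "((\<lambda>s. x + s *\<^sub>R e) has_derivative (\<lambda>s. s *\<^sub>R e)) (at s)"
    by (auto intro!: derivative_eq_intros)
  from diff_chain_at[OF this smooth_has_derivative[OF assms, of "x + s *\<^sub>R e"]]
  have "((\<lambda>s. f (x + s *\<^sub>R e)) has_derivative (\<lambda>h. frechet_derivative f (at (x + s *\<^sub>R e)) (h *\<^sub>R e))) (at s)"
    by (simp add: o_def)
  moreover have "frechet_derivative f (at (x + s *\<^sub>R e)) (h *\<^sub>R e) = frechet_derivative f (at (x + s *\<^sub>R e)) e * h" for h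
    using linear_frechet_derivative[OF smooth_differentiable[OF assms]] by (simp add: linear_cmul)
  ultimately show ?thesis by (simp add: has_field_derivative_def)
qed

lemma dderivs_swap:
  assumes f: "smooth f"
  shows "dderivs [u, v] f x = dderivs [v, u] f x"
proof (rule ccontr)
  have key: "\<exists>\<xi> \<zeta>. 0 < \<xi> \<and> \<xi> < h \<and> 0 < \<zeta> \<and> \<zeta> < h \<and>
      f (x + h *\<^sub>R u + h *\<^sub>R v) - f (x + h *\<^sub>R u) - f (x + h *\<^sub>R v) + f x
        = h * h * dderivs [u, v] f (x + \<xi> *\<^sub>R u + \<zeta> *\<^sub>R v)" if h: "0 < h" for h u v
  proof -
    let ?g = "\<lambda>s. f ((x + h *\<^sub>R v) + s *\<^sub>R u) - f (x + s *\<^sub>R u)"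
    have "(?g has_real_derivative frechet_derivative f (at ((x + h *\<^sub>R v) + s *\<^sub>R u)) u - frechet_derivative f (at (x + s *\<^sub>R u)) u) (at s)" for s
      by (intro DERIV_diff smooth_has_real_derivative_line f)
    from MVT2[OF h, OF this] obtain \<xi> where \<xi>: "0 < \<xi>" "\<xi> < h"
      "?g h - ?g 0 = h * (frechet_derivative f (at ((x + h *\<^sub>R v) + \<xi> *\<^sub>R u)) u - frechet_derivative f (at (x + \<xi> *\<^sub>R u)) u)"
      by auto
    have "((\<lambda>t. frechet_derivative f (at ((x + \<xi> *\<^sub>R u) + t *\<^sub>R v)) u) has_real_derivative
        dderivs [u, v] f ((x + \<xi> *\<^sub>R u) + t *\<^sub>R v)) (at t)" for t
      using smooth_has_real_derivative_line[OF smooth_frechet_derivative[OF f, of u], of "x + \<xi> *\<^sub>R u" v t] by simp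
    from MVT2[OF h, OF this] obtain \<zeta> where \<zeta>: "0 < \<zeta>" "\<zeta> < h"
      "frechet_derivative f (at ((x + \<xi> *\<^sub>R u) + h *\<^sub>R v)) u - frechet_derivative f (at (x + \<xi> *\<^sub>R u)) u
        = h * dderivs [u, v] f ((x + \<xi> *\<^sub>R u) + \<zeta> *\<^sub>R v)" by auto
    have "x + h *\<^sub>R v + \<xi> *\<^sub>R u = x + \<xi> *\<^sub>R u + h *\<^sub>R v" "x + h *\<^sub>R v + h *\<^sub>R u = x + h *\<^sub>R u + h *\<^sub>R v" by (simp_all add: algebra_simps)
    then show ?thesis using \<xi> \<zeta> by (intro exI[of _ \<xi>] exI[of _ \<zeta>]) (simp add: algebra_simps)
  qed
  assume ne: "dderivs [u, v] f x \<noteq> dderivs [v, u] f x"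
  define d where "d = \<bar>dderivs [u, v] f x - dderivs [v, u] f x\<bar> / 2"
  have "d > 0" using ne by (simp add: d_def)
  have cont: "isCont (dderivs [u, v] f) x" for u v
    using smooth_continuous_on[OF smooth_frechet_derivative[OF smooth_frechet_derivative[OF f]], of UNIV]
    by (simp add: continuous_on_eq_continuous_at)
  obtain r1 where r1: "r1 > 0" "\<And>z. dist z x < r1 \<Longrightarrow> dist (dderivs [u, v] f z) (dderivs [u, v] f x) < d"
    using cont[of u v] \<open>d > 0\<close> unfolding continuous_at_eps_delta dist_norm by blast
  obtain r2 where r2: "r2 > 0" "\<And>z. dist z x < r2 \<Longrightarrow> dist (dderivs [v, u] f z) (dderivs [v, u] f x) < d"
    using cont[of v u] \<open>d > 0\<close> unfolding continuous_at_eps_delta dist_norm by blast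
  define h where "h = min r1 r2 / (norm u + norm v + 1)"
  have h: "h > 0" using r1 r2 by (simp add: h_def add_nonneg_pos)
  have close: "dist (x + \<xi> *\<^sub>R u + \<zeta> *\<^sub>R v) x < min r1 r2" if "0 < \<xi>" "\<xi> < h" "0 < \<zeta>" "\<zeta> < h" for \<xi> \<zeta>
  proof -
    have "dist (x + \<xi> *\<^sub>R u + \<zeta> *\<^sub>R v) x \<le> \<xi> * norm u + \<zeta> * norm v"
      using that norm_triangle_ineq[of "\<xi> *\<^sub>R u" "\<zeta> *\<^sub>R v"] by (simp add: dist_norm add.assoc)
    also have "\<dots> \<le> h * norm u + h * norm v" using that by (intro add_mono mult_right_mono) auto
    also have "\<dots> < h * (norm u + norm v + 1)" using h by (simp add: algebra_simps)
    also have "\<dots> = min r1 r2" by (simp add: h_def add_nonneg_eq_0_iff add_nonneg_pos less_imp_neq[symmetric] field_simps)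
    finally show ?thesis .
  qed
  obtain \<xi> \<zeta> where 1: "0 < \<xi>" "\<xi> < h" "0 < \<zeta>" "\<zeta> < h"
      "f (x + h *\<^sub>R u + h *\<^sub>R v) - f (x + h *\<^sub>R u) - f (x + h *\<^sub>R v) + f x = h * h * dderivs [u, v] f (x + \<xi> *\<^sub>R u + \<zeta> *\<^sub>R v)"
    using key[OF h, of u v] by blast
  obtain \<xi>' \<zeta>' where 2: "0 < \<xi>'" "\<xi>' < h" "0 < \<zeta>'" "\<zeta>' < h"
      "f (x + h *\<^sub>R v + h *\<^sub>R u) - f (x + h *\<^sub>R v) - f (x + h *\<^sub>R u) + f x = h * h * dderivs [v, u] f (x + \<xi>' *\<^sub>R v + \<zeta>' *\<^sub>R u)"
    using key[OF h, of v u] by blast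
  have "h * h * dderivs [u, v] f (x + \<xi> *\<^sub>R u + \<zeta> *\<^sub>R v) = h * h * dderivs [v, u] f (x + \<xi>' *\<^sub>R v + \<zeta>' *\<^sub>R u)"
    using 1(5) 2(5) by (simp add: algebra_simps)
  then have "dderivs [u, v] f (x + \<xi> *\<^sub>R u + \<zeta> *\<^sub>R v) = dderivs [v, u] f (x + \<zeta>' *\<^sub>R u + \<xi>' *\<^sub>R v)"
    using h by (simp add: algebra_simps)
  moreover have "dist (dderivs [u, v] f (x + \<xi> *\<^sub>R u + \<zeta> *\<^sub>R v)) (dderivs [u, v] f x) < d"
    using close[OF 1(1-4)] by (intro r1(2)) simp
  moreover have "dist (dderivs [v, u] f (x + \<zeta>' *\<^sub>R u + \<xi>' *\<^sub>R v)) (dderivs [v, u] f x) < d"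
    using close[OF 2(3,4,1,2)] by (intro r2(2)) simp
  ultimately have "2 * d < d + d"
    using abs_triangle_ineq4[of "dderivs [u, v] f x - dderivs [u, v] f (x + \<xi> *\<^sub>R u + \<zeta> *\<^sub>R v)"
        "dderivs [v, u] f x - dderivs [u, v] f (x + \<xi> *\<^sub>R u + \<zeta> *\<^sub>R v)"]
    by (simp add: dist_real_def d_def abs_minus_commute)
  then show False by simp
qed

lemma frechet_derivative_sum_axis:
  fixes f :: "real^'d \<Rightarrow> real"
  assumes "f differentiable (at x)"
  shows "frechet_derivative f (at x) v = (\<Sum>i\<in>UNIV. v $ i * frechet_derivative f (at x) (axis i 1))"
proof -
  interpret linear "frechet_derivative f (at x)" using assms by (rule linear_frechet_derivative)
  have "frechet_derivative f (at x) v = frechet_derivative f (at x) (\<Sum>i\<in>UNIV. v $ i *s axis i 1)"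
    by (simp add: basis_expansion)
  also have "\<dots> = (\<Sum>i\<in>UNIV. v $ i * frechet_derivative f (at x) (axis i 1))"
    by (simp add: sum scale scalar_mult_eq_scaleR)
  finally show ?thesis .
qed

lemma dderivs_hess:
  fixes f :: "real^'d \<Rightarrow> real"
  assumes f: "smooth f"
  shows "dderivs [v, v] f x = v \<bullet> (hess f x *v v)"
proof -
  have D: "frechet_derivative f (at z) v = (\<Sum>j\<in>UNIV. v $ j * frechet_derivative f (at z) (axis j 1))" for z
    by (rule frechet_derivative_sum_axis[OF smooth_differentiable[OF f]])
  have "((\<lambda>z. \<Sum>j\<in>UNIV. v $ j * frechet_derivative f (at z) (axis j 1)) has_derivative
      (\<lambda>h. \<Sum>j\<in>UNIV. v $ j * frechet_derivative (\<lambda>z. frechet_derivative f (at z) (axis j 1)) (at x) h)) (at x)"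
    by (intro has_derivative_sum has_derivative_mult_right smooth_has_derivative smooth_frechet_derivative f)
  then have "dderivs [v, v] f x = (\<Sum>j\<in>UNIV. v $ j * frechet_derivative (\<lambda>z. frechet_derivative f (at z) (axis j 1)) (at x) v)"
    by (simp add: D frechet_derivative_at[symmetric])
  also have "\<dots> = (\<Sum>j\<in>UNIV. v $ j * (\<Sum>i\<in>UNIV. v $ i * hess f x $ i $ j))"
    by (subst frechet_derivative_sum_axis[OF smooth_differentiable[OF smooth_frechet_derivative[OF f]]]) (simp add: hess_def)
  also have "\<dots> = v \<bullet> (hess f x *v v)"
    unfolding sum_distrib_left by (subst sum.swap) (simp add: inner_vec_def matrix_vector_mult_def sum_distrib_left mult_ac)
  finally show ?thesis .
qed

lemma transpose_hess:
  fixes f :: "real^'d \<Rightarrow> real"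
  assumes "smooth f"
  shows "transpose (hess f x) = hess f x"
  using dderivs_swap[OF assms] by (simp add: vec_eq_iff transpose_def hess_def)

lemma hess_add_const:
  fixes f g :: "real^'d \<Rightarrow> real"
  assumes f: "smooth f" and g: "smooth g"
  shows "hess (\<lambda>x. f x + g x + c) x = hess f x + hess g x"
proof -
  have "frechet_derivative (\<lambda>x. f x + g x + c) (at x) v = frechet_derivative f (at x) v + frechet_derivative g (at x) v"
    if "smooth f" "smooth g" for f g :: "real^'d \<Rightarrow> real" and x v c
    by (rule fun_cong[OF frechet_derivative_at[symmetric]])
      (auto intro!: derivative_eq_intros smooth_has_derivative that)
  from this[OF f g] this[OF smooth_frechet_derivative[OF f] smooth_frechet_derivative[OF g], where c = 0]
  show ?thesis by (simp add: hess_def vec_eq_iff)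
qed

lemma has_real_derivative_line2:
  fixes f :: "real^'d \<Rightarrow> real"
  assumes "smooth f"
  shows "((\<lambda>s. frechet_derivative f (at (x + s *\<^sub>R e)) e) has_real_derivative e \<bullet> (hess f (x + s *\<^sub>R e) *v e)) (at s)"
  using smooth_has_real_derivative_line[OF smooth_frechet_derivative[OF assms, of e], of x e s]
  by (simp add: dderivs_hess[OF assms, symmetric])

lemma pos_semidef_hess_if_convex:
  fixes f :: "real^'d \<Rightarrow> real"
  assumes f: "smooth f" and cv: "convex_on UNIV f"
  shows "pos_semidef (hess f x)"
  unfolding pos_semidef_def
proof (intro conjI allI transpose_hess[OF f])
  fix e :: "real^'d"
  define \<phi> where "\<phi> s = f (x + s *\<^sub>R e)" for s
  have d1: "(\<phi> has_real_derivative frechet_derivative f (at (x + s *\<^sub>R e)) e) (at s)" for s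
    unfolding \<phi>_def by (rule smooth_has_real_derivative_line[OF f])
  have "convex_on UNIV \<phi>"
  proof (rule convex_onI)
    fix t r s :: real assume t: "0 < t" "t < 1"
    have "x + ((1 - t) *\<^sub>R r + t *\<^sub>R s) *\<^sub>R e = (1 - t) *\<^sub>R (x + r *\<^sub>R e) + t *\<^sub>R (x + s *\<^sub>R e)"
      by (simp add: algebra_simps)
    then show "\<phi> ((1 - t) *\<^sub>R r + t *\<^sub>R s) \<le> (1 - t) * \<phi> r + t * \<phi> s"
      using convex_onD[OF cv, of t "x + r *\<^sub>R e" "x + s *\<^sub>R e"] t by (simp add: \<phi>_def)
  qed simp
  then have tan: "\<phi> s - \<phi> r \<ge> frechet_derivative f (at (x + r *\<^sub>R e)) e * (s - r)" for r s
    using d1[of r] by (intro convex_on_imp_above_tangent) auto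
  have mono: "frechet_derivative f (at (x + r *\<^sub>R e)) e \<le> frechet_derivative f (at (x + s *\<^sub>R e)) e" if "r < s" for r s
  proof -
    have "frechet_derivative f (at (x + r *\<^sub>R e)) e * (s - r) \<le> frechet_derivative f (at (x + s *\<^sub>R e)) e * (s - r)"
      using tan[of r s] tan[of s r] by (simp add: algebra_simps)
    then show ?thesis using that by simp
  qed
  show "0 \<le> e \<bullet> (hess f x *v e)"
  proof (rule ccontr)
    assume "\<not> 0 \<le> e \<bullet> (hess f x *v e)"
    then have "e \<bullet> (hess f (x + 0 *\<^sub>R e) *v e) < 0" by simp
    from DERIV_neg_dec_right[OF has_real_derivative_line2[OF f] this] obtain d where
      "d > 0" "\<And>h. 0 < h \<Longrightarrow> h < d \<Longrightarrow> frechet_derivative f (at (x + (0 + h) *\<^sub>R e)) e < frechet_derivative f (at (x + 0 *\<^sub>R e)) e"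
      by blast
    from this(2)[of "d / 2"] mono[of 0 "d / 2"] \<open>d > 0\<close> show False by simp
  qed
qed

lemma norm_matrix_vector_le: "norm (A *v x) \<le> spec_norm A * norm x" for A :: "real^'d^'d"
  unfolding spec_norm_def by (intro onorm matrix_vector_mul_bounded_linear)

lemma spec_norm_nonneg: "0 \<le> spec_norm A" for A :: "real^'d^'d"
  unfolding spec_norm_def by (intro onorm_pos_le matrix_vector_mul_bounded_linear)

lemma inner_matrix_vector_le: "x \<bullet> (A *v x) \<le> spec_norm A * (norm x)\<^sup>2" for A :: "real^'d^'d"
  using norm_cauchy_schwarz[of x "A *v x"] mult_left_mono[OF norm_matrix_vector_le[of A x], of "norm x"]
  by (simp add: power2_eq_square mult_ac)

lemma matrix_inv_right: "invertible A \<Longrightarrow> A ** matrix_inv A = mat 1" for A :: "real^'d^'d"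
  unfolding invertible_def matrix_inv_def by (rule someI2_ex) auto

lemma pos_def_imp_invertible: "pos_def A \<Longrightarrow> invertible A" for A :: "real^'d^'d"
  unfolding invertible_left_inverse matrix_left_invertible_ker pos_def_def
  by (metis inner_zero_right less_irrefl)

lemma spec_norm_pos:
  fixes A :: "real^'d^'d"
  assumes "invertible A"
  shows "0 < spec_norm A"
proof (rule ccontr)
  assume "\<not> 0 < spec_norm A"
  then have "norm (A *v x) \<le> 0" for x
    using norm_matrix_vector_le[of A x] spec_norm_nonneg[of A] by simp
  then have "A *v x = 0" for x by simp
  then have "(1 :: real^'d) = 0"
    using assms unfolding invertible_left_inverse matrix_left_invertible_ker by blast
  then show False by (simp add: vec_eq_iff)
qed

lemma transpose_inner: "x \<bullet> (A *v y) = (transpose A *v x) \<bullet> y" for A :: "real^'d^'d"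
  by (simp add: dot_lmul_matrix[symmetric] transpose_matrix_vector)

lemma norm_transpose_mult_le: "norm (transpose A *v x) \<le> spec_norm A * norm x" for A :: "real^'d^'d"
proof (cases "transpose A *v x = 0")
  case False
  have "norm (transpose A *v x) * norm (transpose A *v x) = x \<bullet> (A *v (transpose A *v x))"
    by (simp add: transpose_inner power2_norm_eq_inner[symmetric] power2_eq_square)
  also have "\<dots> \<le> norm x * (spec_norm A * norm (transpose A *v x))"
    by (intro order_trans[OF norm_cauchy_schwarz] mult_left_mono norm_matrix_vector_le) auto
  finally show ?thesis using False by (simp add: mult_ac)
qed (simp add: spec_norm_nonneg)

lemma inner_matrix_inv_ge:
  fixes A :: "real^'d^'d"
  assumes A: "pos_def A"
  shows "inverse (spec_norm A) * (norm x)\<^sup>2 \<le> x \<bullet> (matrix_inv A *v x)"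
proof -
  define y where "y = matrix_inv A *v x"
  have x: "A *v y = x"
    using pos_def_imp_invertible[OF A] by (simp add: y_def matrix_vector_mul_assoc matrix_inv_right)
  have sym: "transpose A = A" using A by (simp add: pos_def_def)
  have nn: "0 \<le> z \<bullet> (A *v z)" for z using A unfolding pos_def_def by (cases "z = 0") (auto intro: less_imp_le)
  note s = spec_norm_pos[OF pos_def_imp_invertible[OF A]]
  let ?c = "inverse (spec_norm A)"
  \<comment> \<open>nonnegativity of the form at \<open>y - c x\<close>, the minimiser of the Cauchy-Schwarz defect\<close>
  have "0 \<le> (y - ?c *\<^sub>R x) \<bullet> (A *v (y - ?c *\<^sub>R x))" by (rule nn)
  also have "\<dots> = y \<bullet> x - ?c * (y \<bullet> (A *v x)) - ?c * (x \<bullet> x) + ?c * ?c * (x \<bullet> (A *v x))"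
    by (simp add: matrix_vector_mult_diff_distrib matrix_vector_mult_scaleR x inner_diff_left inner_diff_right algebra_simps)
  also have "y \<bullet> (A *v x) = x \<bullet> x" using transpose_inner[of y A x] by (simp add: sym x)
  also have "?c * ?c * (x \<bullet> (A *v x)) \<le> ?c * ?c * (spec_norm A * (norm x)\<^sup>2)"
    by (intro mult_left_mono inner_matrix_vector_le) simp
  also have "?c * ?c * (spec_norm A * (norm x)\<^sup>2) = ?c * (x \<bullet> x)"
    using s by (simp add: power2_norm_eq_inner)
  finally show ?thesis by (simp add: y_def power2_norm_eq_inner inner_commute)
qed

lemma hess_bound_add_convex:
  fixes E G :: "real^'d \<Rightarrow> real"
  assumes smooth: "smooth E" "smooth G" and G: "convex_on UNIV G"
    and u: "pos_def u" and E: "hess_bound (matrix_inv u) u' \<delta> E"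
  shows "hess_bound (inverse (spec_norm u) *\<^sub>R mat 1) (spec_norm u' *\<^sub>R mat 1) \<delta> (\<lambda>x. E x + G x + c)"
  unfolding hess_bound_def loewner_le_def pos_semidef_def
proof (intro allI conjI)
  fix x
  let ?H = "hess (\<lambda>x. E x + G x + c) x"
  have H: "?H = hess E x + hess G x" by (rule hess_add_const[OF smooth])
  show "transpose (?H - (indicat_real {z. \<delta> \<le> norm z} x *\<^sub>R inverse (spec_norm u) *\<^sub>R mat 1 -
      indicat_real {z. norm z < \<delta>} x *\<^sub>R spec_norm u' *\<^sub>R mat 1)) =
    ?H - (indicat_real {z. \<delta> \<le> norm z} x *\<^sub>R inverse (spec_norm u) *\<^sub>R mat 1 -
      indicat_real {z. norm z < \<delta>} x *\<^sub>R spec_norm u' *\<^sub>R mat 1)"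
    using transpose_hess[OF smooth(1), of x] transpose_hess[OF smooth(2), of x]
    unfolding H by (simp add: vec_eq_iff transpose_def mat_def)
  fix e :: "real^'d"
  have "0 \<le> e \<bullet> (hess G x *v e)"
    using pos_semidef_hess_if_convex[OF smooth(2) G] by (simp add: pos_semidef_def)
  moreover have "0 \<le> e \<bullet> ((hess E x - (indicat_real {z. \<delta> \<le> norm z} x *\<^sub>R matrix_inv u - indicat_real {z. norm z < \<delta>} x *\<^sub>R u')) *v e)"
    using E by (simp add: hess_bound_def loewner_le_def pos_semidef_def)
  ultimately show "0 \<le> e \<bullet> ((?H - (indicat_real {z. \<delta> \<le> norm z} x *\<^sub>R inverse (spec_norm u) *\<^sub>R mat 1 -
      indicat_real {z. norm z < \<delta>} x *\<^sub>R spec_norm u' *\<^sub>R mat 1)) *v e)"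
    using inner_matrix_inv_ge[OF u, of e] inner_matrix_vector_le[of e u'] unfolding H
    by (cases "\<delta> \<le> norm x")
      (simp_all add: matrix_vector_mult_diff_rdistrib matrix_vector_mult_add_rdistrib scaleR_matrix_vector_assoc[symmetric]
        inner_diff_right inner_add_right power2_norm_eq_inner)
qed

lemma strongly_convex_if_hess_ge:
  fixes E :: "real^'d \<Rightarrow> real"
  assumes E: "smooth E" and H: "\<And>x. matrix_inv u \<le>\<^sub>L hess E x" and u: "pos_def u" and t: "0 \<le> t" "t \<le> 1"
  shows "E ((1 - t) *\<^sub>R x + t *\<^sub>R y) \<le> (1 - t) * E x + t * E y - inverse (spec_norm u) / 2 * (t * (1 - t)) * (norm (x - y))\<^sup>2"
proof -
  define e where "e = y - x"
  define a where "a = inverse (spec_norm u) * (norm e)\<^sup>2"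
  define \<phi> where "\<phi> s = E (x + s *\<^sub>R e) - a / 2 * s\<^sup>2" for s
  have "convex_on UNIV \<phi>"
  proof (rule f''_ge0_imp_convex)
    fix s :: real
    show "(\<phi> has_real_derivative frechet_derivative E (at (x + s *\<^sub>R e)) e - a * s) (at s)"
      unfolding \<phi>_def by (auto intro!: derivative_eq_intros smooth_has_real_derivative_line[OF E])
    show "((\<lambda>s. frechet_derivative E (at (x + s *\<^sub>R e)) e - a * s) has_real_derivative
        e \<bullet> (hess E (x + s *\<^sub>R e) *v e) - a) (at s)"
      by (auto intro!: derivative_eq_intros has_real_derivative_line2[OF E])
    have "0 \<le> e \<bullet> ((hess E (x + s *\<^sub>R e) - matrix_inv u) *v e)"
      using H by (simp add: loewner_le_def pos_semidef_def)
    then show "0 \<le> e \<bullet> (hess E (x + s *\<^sub>R e) *v e) - a"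
      using inner_matrix_inv_ge[OF u, of e] by (simp add: a_def matrix_vector_mult_diff_rdistrib inner_diff_right)
  qed simp
  from convex_onD[OF this t, of 0 1]
  have "E (x + t *\<^sub>R e) - a / 2 * t\<^sup>2 \<le> (1 - t) * E x + t * (E (x + e) - a / 2)" by (simp add: \<phi>_def)
  then have "E (x + t *\<^sub>R e) \<le> (1 - t) * E x + t * E (x + e) - a / 2 * (t * (1 - t))"
    by (simp add: algebra_simps power2_eq_square diff_divide_distrib)
  moreover have "x + t *\<^sub>R e = (1 - t) *\<^sub>R x + t *\<^sub>R y" "x + e = y" by (simp_all add: e_def algebra_simps)
  moreover have "a = inverse (spec_norm u) * (norm (x - y))\<^sup>2" by (simp add: a_def e_def norm_minus_commute)
  ultimately show ?thesis by (simp only:) (simp add: mult_ac)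
qed

lemma hess_bound_imp_quadratic_growth:
  fixes V :: "real^'d \<Rightarrow> real"
  assumes V: "smooth V" and a: "0 < a" "0 \<le> b" "0 \<le> \<delta>" and H: "hess_bound (a *\<^sub>R mat 1) (b *\<^sub>R mat 1) \<delta> V"
  obtains C where "\<And>x. V x \<ge> a / 4 * (norm x)\<^sup>2 - C"
proof -
  define G where "G = onorm (frechet_derivative V (at 0))"
  have bl: "bounded_linear (frechet_derivative V (at 0))"
    using smooth_has_derivative[OF V] by (rule has_derivative_bounded_linear)
  define C1 where "C1 = G + (a + b) * \<delta>"
  have "G \<ge> 0" unfolding G_def by (rule onorm_pos_le[OF bl])
  have "V x \<ge> a / 4 * (norm x)\<^sup>2 - (C1\<^sup>2 / a - V 0)" for x
  proof (cases "x = 0")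
    case True
    then show ?thesis using a by simp
  next
    case False
    define e where "e = x /\<^sub>R norm x"
    have e: "norm e = 1" using False by (simp add: e_def)
    define \<phi>' where "\<phi>' s = frechet_derivative V (at (0 + s *\<^sub>R e)) e" for s
    have d2: "(\<phi>' has_real_derivative e \<bullet> (hess V (0 + s *\<^sub>R e) *v e)) (at s)" for s
      unfolding \<phi>'_def by (rule has_real_derivative_line2[OF V])
    have d1: "((\<lambda>s. V (0 + s *\<^sub>R e)) has_real_derivative \<phi>' s) (at s)" for s
      unfolding \<phi>'_def by (rule smooth_has_real_derivative_line[OF V])
    have he: "e \<bullet> (hess V (0 + s *\<^sub>R e) *v e) \<ge> (if \<delta> \<le> s then a else - b)" if "0 \<le> s" for s
    proof -
      have "0 \<le> e \<bullet> ((hess V (s *\<^sub>R e) - (indicat_real {z. \<delta> \<le> norm z} (s *\<^sub>R e) *\<^sub>R a *\<^sub>R mat 1 -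
         indicat_real {z. norm z < \<delta>} (s *\<^sub>R e) *\<^sub>R b *\<^sub>R mat 1)) *v e)"
        using H by (simp add: hess_bound_def loewner_le_def pos_semidef_def)
      then show ?thesis
        using that e by (auto simp: indicator_def matrix_vector_mult_diff_rdistrib scaleR_matrix_vector_assoc[symmetric]
          inner_diff_right power2_norm_eq_inner[symmetric] split: if_splits)
    qed
    have "\<bar>\<phi>' 0\<bar> \<le> G" using onorm[OF bl, of e] e by (simp add: \<phi>'_def G_def)
    have lo: "\<phi>' s \<ge> a * s - C1" if s: "0 \<le> s" for s
    proof (cases "s \<le> \<delta>")
      case True
      have "\<phi>' s + b * s \<ge> \<phi>' 0 + b * 0"
      proof (rule DERIV_nonneg_imp_nondecreasing[OF s])
        fix r assume "0 \<le> r" "r \<le> s"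
        then show "\<exists>y. ((\<lambda>s. \<phi>' s + b * s) has_real_derivative y) (at r) \<and> 0 \<le> y"
          using he[of r] a by (intro exI[of _ "e \<bullet> (hess V (0 + r *\<^sub>R e) *v e) + b"])
            (auto intro!: derivative_eq_intros d2 split: if_splits)
      qed
      moreover have "a * s \<le> a * \<delta>" "b * s \<le> b * \<delta>" using True a s by (auto intro!: mult_left_mono)
      ultimately show ?thesis using \<open>\<bar>\<phi>' 0\<bar> \<le> G\<close> unfolding C1_def distrib_right by linarith
    next
      case False
      have "\<phi>' \<delta> + b * \<delta> \<ge> \<phi>' 0 + b * 0"
      proof (rule DERIV_nonneg_imp_nondecreasing[OF a(3)])
        fix r assume "0 \<le> r" "r \<le> \<delta>"
        then show "\<exists>y. ((\<lambda>s. \<phi>' s + b * s) has_real_derivative y) (at r) \<and> 0 \<le> y"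
          using he[of r] a by (intro exI[of _ "e \<bullet> (hess V (0 + r *\<^sub>R e) *v e) + b"])
            (auto intro!: derivative_eq_intros d2 split: if_splits)
      qed
      moreover have "\<phi>' s - a * s \<ge> \<phi>' \<delta> - a * \<delta>"
      proof (rule DERIV_nonneg_imp_nondecreasing[where a = \<delta> and b = s and f = "\<lambda>s. \<phi>' s - a * s"])
        fix r assume "\<delta> \<le> r" "r \<le> s"
        then show "\<exists>y. ((\<lambda>s. \<phi>' s - a * s) has_real_derivative y) (at r) \<and> 0 \<le> y"
          using he[of r] a by (intro exI[of _ "e \<bullet> (hess V (0 + r *\<^sub>R e) *v e) - a"])
            (auto intro!: derivative_eq_intros d2 split: if_splits)
      qed (use False in simp)
      ultimately show ?thesis using \<open>\<bar>\<phi>' 0\<bar> \<le> G\<close> unfolding C1_def distrib_right by linarith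
    qed
    have "V (0 + norm x *\<^sub>R e) - (a / 2 * (norm x)\<^sup>2 - C1 * norm x) \<ge> V (0 + 0 *\<^sub>R e) - (a / 2 * 0\<^sup>2 - C1 * 0)"
    proof (rule DERIV_nonneg_imp_nondecreasing[where f = "\<lambda>s. V (0 + s *\<^sub>R e) - (a / 2 * s\<^sup>2 - C1 * s)", OF norm_ge_zero[of x]])
      fix r assume "0 \<le> r" "r \<le> norm x"
      then show "\<exists>y. ((\<lambda>s. V (0 + s *\<^sub>R e) - (a / 2 * s\<^sup>2 - C1 * s)) has_real_derivative y) (at r) \<and> 0 \<le> y"
        using lo[of r] by (intro exI[of _ "\<phi>' r - (a * r - C1)"]) (auto intro!: derivative_eq_intros d1[simplified])
    qed
    moreover have "norm x *\<^sub>R e = x" using False by (simp add: e_def)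
    moreover have "a / 4 * (norm x)\<^sup>2 - C1 * norm x + C1\<^sup>2 / a \<ge> 0"
    proof -
      have "a / 4 * (norm x)\<^sup>2 - C1 * norm x + C1\<^sup>2 / a = a * (norm x / 2 - C1 / a)\<^sup>2"
        using a by (simp add: power2_eq_square field_simps)
      then show ?thesis using a by simp
    qed
    ultimately show ?thesis by (simp add: algebra_simps)
  qed
  then show ?thesis using that by blast
qed

section \<open>Entropy of densities\<close>

lemma (in prob_space) gibbs_inequality:
  fixes u :: "'a \<Rightarrow> real"
  assumes [measurable]: "u \<in> borel_measurable M" and le: "(\<integral>\<^sup>+x. ennreal (exp (- u x)) \<partial>M) \<le> 1"
  shows "integrable M (\<lambda>x. max 0 (- u x))" and "integrable M u \<Longrightarrow> 0 \<le> expectation u"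
proof -
  have int: "integrable M (\<lambda>x. exp (- u x))"
    using le by (intro integrableI_bounded) (auto simp: less_top[symmetric] top_unique intro: le_less_trans)
  show "integrable M (\<lambda>x. max 0 (- u x))"
    by (rule Bochner_Integration.integrable_bound[OF int])
      (auto simp: max_def intro!: AE_I2 order.trans[OF _ exp_ge_add_one_self])
  assume u: "integrable M u"
  have "ennreal (expectation (\<lambda>x. exp (- u x))) \<le> 1"
    using le nn_integral_eq_integral[OF int] by simp
  then have "expectation (\<lambda>x. exp (- u x)) \<le> 1" by simp
  moreover have "expectation (\<lambda>x. 1 - u x) \<le> expectation (\<lambda>x. exp (- u x))"
    using u int exp_ge_add_one_self[of "- u x" for x] by (intro integral_mono) auto
  ultimately show "0 \<le> expectation u" using u by (simp add: prob_space)
qed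

lemma rel_entropy_density:
  fixes f :: "'a \<Rightarrow> real"
  assumes M: "sigma_finite_measure M" and [measurable]: "f \<in> borel_measurable M" and f: "\<And>x. 0 \<le> f x"
  shows "rel_entropy (density M f) M =
    (if integrable (density M f) (\<lambda>x. ln (f x)) then ereal (\<integral>x. ln (f x) \<partial>density M f) else \<infinity>)"
proof -
  interpret sigma_finite_measure M by fact
  let ?N = "density M (\<lambda>x. ennreal (f x))"
  have ac: "absolutely_continuous M ?N"
    by (rule absolutely_continuousI_density) simp
  have "AE x in M. RN_deriv M ?N x = ennreal (f x)"
    using RN_deriv_unique[of f ?N] by (auto elim: AE_mp)
  then have "AE x in ?N. RN_deriv M ?N x = ennreal (f x)"
    by (subst AE_density) auto
  then have ae: "AE x in ?N. entropy_density (exp 1) M ?N x = ln (f x)"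
    using f by (auto simp: entropy_density_def log_def elim!: AE_mp)
  have [measurable]: "entropy_density (exp 1) M ?N \<in> borel_measurable M"
    by (rule measurable_entropy_density)
  have "integrable ?N (entropy_density (exp 1) M ?N) \<longleftrightarrow> integrable ?N (\<lambda>x. ln (f x))"
    using ae by (intro integrable_cong_AE) auto
  moreover have "KL_divergence (exp 1) M ?N = (\<integral>x. ln (f x) \<partial>?N)"
    unfolding KL_divergence_def using ae by (intro integral_cong_AE) auto
  ultimately show ?thesis using ac by (simp add: rel_entropy_def)
qed

lemma rel_entropy_density_gibbs:
  fixes q S :: "'a::euclidean_space \<Rightarrow> real"
  assumes [measurable]: "q \<in> borel_measurable borel" "S \<in> borel_measurable borel" and q: "\<And>x. 0 \<le> q x"
  shows "rel_entropy (density lborel q) (density lborel (\<lambda>x. exp (- S x))) =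
    (if integrable (density lborel q) (\<lambda>x. ln (q x) + S x)
     then ereal (\<integral>x. ln (q x) + S x \<partial>density lborel q) else \<infinity>)"
proof -
  let ?P = "density lborel (\<lambda>x. ennreal (exp (- S x)))" and ?Q = "density lborel q"
  have P: "sigma_finite_measure ?P"
    by (subst sigma_finite_measure.sigma_finite_iff_density_finite[OF sigma_finite_lborel]) auto
  have eq: "density ?P (\<lambda>x. ennreal (q x * exp (S x))) = ?Q"
    using q by (subst density_density_eq) (auto intro!: density_cong simp: ennreal_mult[symmetric] exp_minus field_simps)
  have "AE x in ?Q. q x > 0"
    using q by (subst AE_density) (auto intro!: AE_I2)
  then have ae: "AE x in ?Q. ln (q x * exp (S x)) = ln (q x) + S x"
    by (auto simp: ln_mult elim!: AE_mp)
  then have "integrable ?Q (\<lambda>x. ln (q x * exp (S x))) \<longleftrightarrow> integrable ?Q (\<lambda>x. ln (q x) + S x)"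
    by (intro integrable_cong_AE) auto
  moreover have "(\<integral>x. ln (q x * exp (S x)) \<partial>?Q) = (\<integral>x. ln (q x) + S x \<partial>?Q)"
    using ae by (intro integral_cong_AE) auto
  ultimately show ?thesis
    using rel_entropy_density[OF P, of "\<lambda>x. q x * exp (S x)"] q unfolding eq by simp
qed

lemma rel_entropy_finite_imp_density:
  fixes S :: "'a::euclidean_space \<Rightarrow> real"
  assumes [measurable]: "S \<in> borel_measurable borel" and Q: "prob_space Q" "sets Q = sets borel"
    and fin: "rel_entropy Q (density lborel (\<lambda>x. exp (- S x))) < \<infinity>"
  obtains q where "q \<in> borel_measurable borel" "\<And>x. 0 \<le> q x" "Q = density lborel (\<lambda>x. ennreal (q x))"
proof -
  let ?P = "density lborel (\<lambda>x. ennreal (exp (- S x)))"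
  interpret Q: prob_space Q by fact
  have "absolutely_continuous ?P Q" using fin by (auto simp: rel_entropy_def split: if_splits)
  moreover have "absolutely_continuous lborel ?P" by (rule absolutely_continuousI_density) simp
  ultimately have ac: "absolutely_continuous lborel Q" by (auto simp: absolutely_continuous_def)
  define D where "D x = enn2real (RN_deriv lborel Q x)" for x
  have [measurable]: "D \<in> borel_measurable borel" unfolding D_def by measurable
  have "AE x in lborel. RN_deriv lborel Q x \<noteq> \<infinity>"
    using ac Q Q.sigma_finite_measure_axioms by (intro sigma_finite_measure.RN_deriv_finite[OF sigma_finite_lborel]) auto
  then have D: "AE x in lborel. RN_deriv lborel Q x = ennreal (D x)"
    by (auto simp: D_def less_top elim!: AE_mp)
  have "Q = density lborel (RN_deriv lborel Q)"
    using ac Q by (simp add: sigma_finite_measure.density_RN_deriv[OF sigma_finite_lborel])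
  also have "\<dots> = density lborel (\<lambda>x. ennreal (D x))" using D by (intro density_cong) auto
  finally show ?thesis by (intro that[of D]) (auto simp: D_def)
qed

lemma log_sobolev_density:
  fixes g :: "real^'d \<Rightarrow> real"
  assumes ls: "log_sobolev m \<rho>" and m: "prob_space m" "sets m = sets borel" and \<rho>: "0 < \<rho>"
    and g: "\<And>x. g differentiable (at x)" and ex: "integrable m (\<lambda>x. exp (g x))" "(\<integral>x. exp (g x) \<partial>m) = 1"
    and R: "\<And>x. (norm (grad g x))\<^sup>2 \<le> R x" "integrable m (\<lambda>x. exp (g x) * R x)"
  shows "integrable m (\<lambda>x. exp (g x) * g x)" "(\<integral>x. exp (g x) * g x \<partial>m) \<le> \<rho> / 2 * (\<integral>x. exp (g x) * R x \<partial>m)"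
proof -
  interpret prob_space m by fact
  have "continuous_on UNIV g" using g
    by (simp add: continuous_at_imp_continuous_on differentiable_imp_continuous_within)
  then have g_m: "g \<in> borel_measurable borel" by (rule borel_measurable_continuous_onI)
  then have [measurable]: "g \<in> borel_measurable m" using m(2) measurable_cong_sets by blast
  let ?\<nu> = "density m (\<lambda>x. ennreal (exp (g x)))"
  have nn: "(\<integral>\<^sup>+x. ennreal (exp (g x)) \<partial>m) = 1"
    using nn_integral_eq_integral[OF ex(1)] ex(2) by simp
  have \<nu>: "prob_space ?\<nu>" by (intro prob_spaceI) (simp add: emeasure_density nn cong: nn_integral_cong)
  have R_m: "R' \<in> borel_measurable m" if "integrable m (\<lambda>x. exp (g x) * R' x)" for R'
  proof -
    have "(\<lambda>x. exp (- g x) * (exp (g x) * R' x)) \<in> borel_measurable m"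
      using that by (intro borel_measurable_times borel_measurable_integrable[OF that]) simp
    then show ?thesis by (simp add: mult.assoc[symmetric] exp_add[symmetric])
  qed
  note [measurable] = R_m[OF R(2)]
  have R0: "0 \<le> R x" for x using R(1)[of x] by (meson order_trans zero_le_power2)
  have "fisher_information ?\<nu> m \<le> (\<integral>\<^sup>+ x. ennreal ((norm (grad (\<lambda>z. ln (exp (g z))) x))\<^sup>2) \<partial>?\<nu>)"
    unfolding fisher_information_def
  proof (rule INF_lower)
    have "((\<lambda>x. exp (g x)) has_derivative (\<lambda>h. exp (g x) * frechet_derivative g (at x) h)) (at x)" for x
      using g[of x] by (auto intro!: derivative_eq_intros simp: frechet_derivative_works[symmetric])
    then have "(\<lambda>x. exp (g x)) differentiable_on UNIV"
      by (auto simp: differentiable_on_def differentiable_def)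
    then show "(\<lambda>x. exp (g x)) \<in> {f. (\<forall>x. 0 \<le> f x) \<and> f differentiable_on UNIV \<and> ?\<nu> = density m (\<lambda>x. ennreal (f x))}"
      by simp
  qed
  also have "\<dots> \<le> (\<integral>\<^sup>+ x. ennreal (R x) \<partial>?\<nu>)"
    using R(1) by (intro nn_integral_mono) (auto intro: ennreal_leI)
  also have "\<dots> = (\<integral>\<^sup>+ x. ennreal (exp (g x) * R x) \<partial>m)"
    by (subst nn_integral_density) (auto simp: ennreal_mult R0)
  also have "\<dots> = ennreal (\<integral>x. exp (g x) * R x \<partial>m)"
    using R(2) R0 by (intro nn_integral_eq_integral) auto
  finally have fi: "fisher_information ?\<nu> m \<le> ennreal (\<integral>x. exp (g x) * R x \<partial>m)" .
  have I0: "0 \<le> (\<integral>x. exp (g x) * R x \<partial>m)" using R0 by (intro Bochner_Integration.integral_nonneg) auto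
  have "rel_entropy ?\<nu> m \<le> ereal (\<rho> / 2) * enn2ereal (fisher_information ?\<nu> m)"
    using ls \<nu> unfolding log_sobolev_def by (simp add: absolutely_continuousI_density)
  also have "\<dots> \<le> ereal (\<rho> / 2) * enn2ereal (ennreal (\<integral>x. exp (g x) * R x \<partial>m))"
    using fi \<rho> by (intro ereal_mult_left_mono) (auto simp: less_eq_ennreal.rep_eq[symmetric])
  also have "\<dots> = ereal (\<rho> / 2 * (\<integral>x. exp (g x) * R x \<partial>m))" using I0 by (simp add: enn2ereal_ennreal)
  finally have le: "rel_entropy ?\<nu> m \<le> ereal (\<rho> / 2 * (\<integral>x. exp (g x) * R x \<partial>m))" .
  have "rel_entropy ?\<nu> m = (if integrable ?\<nu> g then ereal (\<integral>x. g x \<partial>?\<nu>) else \<infinity>)"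
    using rel_entropy_density[OF sigma_finite_measure_axioms, of "\<lambda>x. exp (g x)"] by simp
  then have "integrable ?\<nu> g" "(\<integral>x. g x \<partial>?\<nu>) \<le> \<rho> / 2 * (\<integral>x. exp (g x) * R x \<partial>m)"
    using le by (auto split: if_splits)
  then show "integrable m (\<lambda>x. exp (g x) * g x)" "(\<integral>x. exp (g x) * g x \<partial>m) \<le> \<rho> / 2 * (\<integral>x. exp (g x) * R x \<partial>m)"
    by (simp_all add: integrable_real_density integral_real_density)
qed

section \<open>Exponential families and dual transport inequalities\<close>

lemma has_real_derivative_integral_bounded:
  fixes F F' :: "real \<Rightarrow> 'a \<Rightarrow> real"
  assumes "finite_measure M" and t: "t \<in> {a<..<b}"
    and F[measurable]: "\<And>s. s \<in> {a<..<b} \<Longrightarrow> F s \<in> borel_measurable M" and [measurable]: "F' t \<in> borel_measurable M"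
    and bd: "\<And>s x. s \<in> {a<..<b} \<Longrightarrow> \<bar>F s x\<bar> \<le> C"
    and d: "\<And>s x. s \<in> {a<..<b} \<Longrightarrow> ((\<lambda>s. F s x) has_real_derivative F' s x) (at s)"
    and bd': "\<And>s x. s \<in> {a<..<b} \<Longrightarrow> \<bar>F' s x\<bar> \<le> C"
  shows "((\<lambda>s. \<integral>x. F s x \<partial>M) has_real_derivative (\<integral>x. F' t x \<partial>M)) (at t)"
proof -
  interpret finite_measure M by fact
  have int: "integrable M (F s)" if "s \<in> {a<..<b}" for s
    using bd F that by (intro integrable_const_bound[of _ C]) auto
  have "((\<lambda>s. \<integral>x. F s x \<partial>M) has_real_derivative (\<integral>x. F' t x \<partial>M)) (at t within {a<..<b})"
    unfolding has_field_derivative_iff tendsto_at_iff_sequentially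
  proof (intro allI impI)
    fix X :: "nat \<Rightarrow> real" assume X: "\<forall>i. X i \<in> {a<..<b} - {t}" and lim: "X \<longlonglongrightarrow> t"
    have "(\<lambda>i. \<integral>x. (F (X i) x - F t x) / (X i - t) \<partial>M) \<longlonglongrightarrow> (\<integral>x. F' t x \<partial>M)"
    proof (rule integral_dominated_convergence)
      show "integrable M (\<lambda>_. C)" by simp
      show "AE x in M. (\<lambda>i. (F (X i) x - F t x) / (X i - t)) \<longlonglongrightarrow> F' t x"
      proof (rule AE_I2)
        fix x
        have "((\<lambda>y. (F y x - F t x) / (y - t)) \<longlongrightarrow> F' t x) (at t)"
          using d[OF t, of x] by (simp add: has_field_derivative_iff)
        then show "(\<lambda>i. (F (X i) x - F t x) / (X i - t)) \<longlonglongrightarrow> F' t x"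
          using X lim by (auto simp: tendsto_at_iff_sequentially o_def)
      qed
      show "AE x in M. norm ((F (X i) x - F t x) / (X i - t)) \<le> C" for i
      proof (rule AE_I2)
        fix x
        have "norm (F (X i) x - F t x) \<le> C * norm (X i - t)"
          using d bd' X t by (intro field_differentiable_bound[of "{a<..<b}" _ "\<lambda>s. F' s x"])
            (auto intro: has_field_derivative_at_within)
        then show "norm ((F (X i) x - F t x) / (X i - t)) \<le> C"
          using X by (simp add: divide_le_eq)
      qed
      show "(\<lambda>x. (F (X i) x - F t x) / (X i - t)) \<in> borel_measurable M" for i
        using X t F by (intro borel_measurable_divide borel_measurable_diff) auto
    qed simp
    moreover have "(\<integral>x. (F (X i) x - F t x) / (X i - t) \<partial>M) = ((\<integral>x. F (X i) x \<partial>M) - (\<integral>x. F t x \<partial>M)) / (X i - t)" for i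
    proof -
      have "X i \<noteq> t" "X i \<in> {a<..<b}" using X by auto
      then show ?thesis using int[of "X i"] int[OF t] by simp
    qed
    ultimately show "((\<lambda>y. ((\<integral>x. F y x \<partial>M) - (\<integral>x. F t x \<partial>M)) / (y - t)) \<circ> X) \<longlonglongrightarrow> (\<integral>x. F' t x \<partial>M)"
      unfolding o_def by (simp only:)
  qed
  then show ?thesis unfolding at_within_open[OF t open_greaterThanLessThan] .
qed

lemma measurable_matrix_vector_mult[measurable (raw)]:
  fixes A :: "real^'d^'d"
  shows "f \<in> borel_measurable M \<Longrightarrow> (\<lambda>x. A *v f x) \<in> borel_measurable M"
  by (rule measurable_compose[OF _ borel_measurable_continuous_onI])
    (auto intro!: linear_continuous_on matrix_vector_mul_bounded_linear)

lemma exp_quadratic_remainder: "\<bar>exp z - 1 - z\<bar> \<le> z\<^sup>2 * exp \<bar>z\<bar>" for z :: real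
proof -
  obtain t where t: "\<bar>t\<bar> \<le> \<bar>z\<bar>" "exp z = (\<Sum>m<2. z ^ m / fact m) + exp t / fact 2 * z\<^sup>2"
    using Maclaurin_exp_le[of z 2] by blast
  then have eq: "exp z - 1 - z = z\<^sup>2 * (exp t / 2)" by (simp add: numeral_2_eq_2)
  have "\<bar>exp z - 1 - z\<bar> = z\<^sup>2 * (exp t / 2)" unfolding eq by (simp add: abs_mult)
  also have "\<dots> \<le> z\<^sup>2 * exp \<bar>z\<bar>"
  proof (rule mult_left_mono)
    have "exp t \<le> exp \<bar>z\<bar>" using t(1) by simp
    then show "exp t / 2 \<le> exp \<bar>z\<bar>" using exp_gt_zero[of t] by linarith
  qed simp
  finally show ?thesis .
qed

lemma exp_norm_le_sum_exp:
  fixes a :: "real^'d"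
  assumes "0 \<le> c"
  shows "exp (c * norm a) \<le> (\<Sum>i\<in>UNIV. exp (c * CARD('d) * a $ i) + exp (- (c * CARD('d) * a $ i)))"
proof -
  let ?m = "Max (range (\<lambda>i. \<bar>a $ i\<bar>))"
  have "?m \<in> range (\<lambda>i. \<bar>a $ i\<bar>)" by (rule Max_in) auto
  then obtain i where i: "\<bar>a $ i\<bar> = ?m" by (metis rangeE)
  have "norm a \<le> (\<Sum>j\<in>UNIV. \<bar>a $ j\<bar>)" by (rule norm_le_l1_cart)
  also have "\<dots> \<le> (\<Sum>j\<in>(UNIV::'d set). ?m)" by (intro sum_mono Max_ge) auto
  finally have "c * norm a \<le> c * (CARD('d) * \<bar>a $ i\<bar>)" using assms i by (intro mult_left_mono) auto
  then have "exp (c * norm a) \<le> exp (c * CARD('d) * \<bar>a $ i\<bar>)" by (simp add: mult.assoc)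
  also have "\<dots> \<le> exp (c * CARD('d) * a $ i) + exp (- (c * CARD('d) * a $ i))"
    by (cases "a $ i \<ge> 0") auto
  also have "\<dots> \<le> (\<Sum>i\<in>UNIV. exp (c * CARD('d) * a $ i) + exp (- (c * CARD('d) * a $ i)))"
    by (rule member_le_sum) (auto simp: add_nonneg_nonneg)
  finally show ?thesis .
qed

locale tilted_family =
  fixes M :: "real^'d^'d" and B :: "real^'d \<Rightarrow> real"
  assumes invertible_M: "invertible M"
    and measurable_B[measurable]: "B \<in> borel_measurable borel"
    and integrable_weight: "\<And>b. integrable lborel (\<lambda>a. exp (b \<bullet> (M *v a) - B a))"
begin

definition wt :: "real^'d \<Rightarrow> real^'d \<Rightarrow> real" where
  "wt b a = exp (b \<bullet> (M *v a) - B a)"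

definition I :: "(real^'d \<Rightarrow> real) \<Rightarrow> real^'d \<Rightarrow> real" where
  "I h b = (\<integral>a. h a * wt b a \<partial>lborel)"

definition J :: "(real^'d \<Rightarrow> real) \<Rightarrow> real^'d \<Rightarrow> real^'d" where
  "J h b = (\<integral>a. (h a * wt b a) *\<^sub>R (M *v a) \<partial>lborel)"

definition L :: "real^'d \<Rightarrow> real" where
  "L b = ln (I (\<lambda>_. 1) b)"

definition mean :: "real^'d \<Rightarrow> real^'d" where
  "mean b = J (\<lambda>_. 1) b /\<^sub>R I (\<lambda>_. 1) b"

lemma measurable_wt[measurable]: "wt b \<in> borel_measurable borel"
  unfolding wt_def by measurable

lemma wt_pos: "0 < wt b a"
  by (simp add: wt_def)

lemma wt_add: "wt (b + e) a = exp (e \<bullet> (M *v a)) * wt b a"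
  by (simp add: wt_def inner_add_left exp_add[symmetric] exp_diff algebra_simps)

lemma integrable_wt: "integrable lborel (wt b)"
  unfolding wt_def by (rule integrable_weight)

lemma integrable_exp_norm_wt: "integrable lborel (\<lambda>a. exp (c * norm a) * wt b a)"
proof -
  have *: "integrable lborel (\<lambda>a. exp (s * a $ i) * wt b a)" for s :: real and i
  proof -
    define e where "e = transpose (matrix_inv M) *v (s *\<^sub>R axis i 1)"
    have "e \<bullet> (M *v a) = s * a $ i" for a
    proof -
      have "matrix_inv M ** M = mat 1"
        using invertible_M unfolding invertible_def matrix_inv_def by (rule someI2_ex) auto
      then have "e \<bullet> (M *v a) = (s *\<^sub>R axis i 1) \<bullet> a"
        unfolding e_def transpose_inner[symmetric] by (simp add: matrix_vector_mul_assoc)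
      then show ?thesis by (simp add: inner_axis' )
    qed
    then have "(\<lambda>a. exp (s * a $ i) * wt b a) = wt (b + e)"
      by (simp add: wt_add fun_eq_iff)
    then show ?thesis by (simp add: integrable_wt)
  qed
  have "integrable lborel (\<lambda>a. \<Sum>i\<in>UNIV. exp (\<bar>c\<bar> * CARD('d) * a $ i) * wt b a + exp (- (\<bar>c\<bar> * CARD('d)) * a $ i) * wt b a)"
    by (intro Bochner_Integration.integrable_sum Bochner_Integration.integrable_add *)
  then show ?thesis
  proof (rule Bochner_Integration.integrable_bound)
    show "AE a in lborel. norm (exp (c * norm a) * wt b a)
      \<le> norm (\<Sum>i\<in>UNIV. exp (\<bar>c\<bar> * CARD('d) * a $ i) * wt b a + exp (- (\<bar>c\<bar> * CARD('d)) * a $ i) * wt b a)"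
    proof (rule AE_I2)
      fix a :: "real^'d"
      have "exp (c * norm a) \<le> exp (\<bar>c\<bar> * norm a)" by (simp add: mult_right_mono)
      also note exp_norm_le_sum_exp[of "\<bar>c\<bar>" a]
      finally have "exp (c * norm a) * wt b a \<le> (\<Sum>i\<in>UNIV. exp (\<bar>c\<bar> * CARD('d) * a $ i) + exp (- (\<bar>c\<bar> * CARD('d) * a $ i))) * wt b a"
        using wt_pos[of b a] by (intro mult_right_mono) auto
      also have "\<dots> = (\<Sum>i\<in>UNIV. exp (\<bar>c\<bar> * CARD('d) * a $ i) * wt b a + exp (- (\<bar>c\<bar> * CARD('d)) * a $ i) * wt b a)"
        by (simp add: sum_distrib_right distrib_right)
      finally show "norm (exp (c * norm a) * wt b a)
        \<le> norm (\<Sum>i\<in>UNIV. exp (\<bar>c\<bar> * CARD('d) * a $ i) * wt b a + exp (- (\<bar>c\<bar> * CARD('d)) * a $ i) * wt b a)"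
        using wt_pos[of b a] by (simp add: abs_of_nonneg)
    qed
  qed measurable
qed

lemma integrable_mult_wt:
  fixes g :: "real^'d \<Rightarrow> 'b::{banach, second_countable_topology}"
  assumes [measurable]: "g \<in> borel_measurable borel" and g: "\<And>a. norm (g a) \<le> C * exp (c * norm a)"
  shows "integrable lborel (\<lambda>a. wt b a *\<^sub>R g a)"
proof (rule Bochner_Integration.integrable_bound)
  show "integrable lborel (\<lambda>a. C * (exp (c * norm a) * wt b a))"
    by (intro integrable_mult_right integrable_exp_norm_wt)
  show "AE a in lborel. norm (wt b a *\<^sub>R g a) \<le> norm (C * (exp (c * norm a) * wt b a))"
  proof (rule AE_I2)
    fix a
    have "norm (wt b a *\<^sub>R g a) \<le> wt b a * (C * exp (c * norm a))"
      using g[of a] wt_pos[of b a] by (simp add: mult_left_mono)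
    also have "\<dots> \<le> norm (C * (exp (c * norm a) * wt b a))" by (simp add: mult_ac)
    finally show "norm (wt b a *\<^sub>R g a) \<le> norm (C * (exp (c * norm a) * wt b a))" .
  qed
qed measurable

context
  fixes h :: "real^'d \<Rightarrow> real" and N :: real
  assumes h[measurable]: "h \<in> borel_measurable borel" and hN: "\<And>a. \<bar>h a\<bar> \<le> N"
begin

lemma N_nonneg: "0 \<le> N"
  using hN[of 0] by linarith

lemma integrable_bounded_wt: "integrable lborel (\<lambda>a. h a * wt b a)"
  using integrable_mult_wt[of h N 0 b] hN by (simp add: mult.commute)

lemma integrable_bounded_wt_mult: "integrable lborel (\<lambda>a. (h a * wt b a) *\<^sub>R (M *v a))"
proof -
  have "integrable lborel (\<lambda>a. wt b a *\<^sub>R (h a *\<^sub>R (M *v a)))"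
  proof (rule integrable_mult_wt[where C = "N * spec_norm M" and c = 1])
    fix a
    have "norm (h a *\<^sub>R (M *v a)) \<le> N * (spec_norm M * norm a)"
      using hN[of a] N_nonneg norm_matrix_vector_le[of M a] by (simp add: mult_mono)
    also have "norm a \<le> exp (1 * norm a)"
      using exp_ge_add_one_self[of "norm a"] unfolding mult_1 by linarith
    finally show "norm (h a *\<^sub>R (M *v a)) \<le> N * spec_norm M * exp (1 * norm a)"
      using N_nonneg spec_norm_nonneg[of M] by (simp add: mult.assoc mult_left_mono)
  qed measurable
  then show ?thesis by (simp add: mult.commute)
qed

lemma inner_J: "e \<bullet> J h b = (\<integral>a. h a * (e \<bullet> (M *v a)) * wt b a \<partial>lborel)"
  and integrable_inner_J: "integrable lborel (\<lambda>a. h a * (e \<bullet> (M *v a)) * wt b a)"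
proof -
  have eq: "e \<bullet> ((h a * wt b a) *\<^sub>R (M *v a)) = h a * (e \<bullet> (M *v a)) * wt b a" for a by simp
  show "e \<bullet> J h b = (\<integral>a. h a * (e \<bullet> (M *v a)) * wt b a \<partial>lborel)"
    unfolding J_def eq[symmetric] using integrable_bounded_wt_mult by (intro integral_inner_right[symmetric]) simp
  show "integrable lborel (\<lambda>a. h a * (e \<bullet> (M *v a)) * wt b a)"
    unfolding eq[symmetric] using integrable_bounded_wt_mult by (rule integrable_inner_right) 
qed

lemma has_derivative_I: "(I h has_derivative (\<lambda>e. e \<bullet> J h b)) (at b)"
proof (rule has_derivativeI_sandwich[where e = 1])
  define \<kappa> where "\<kappa> = spec_norm M"
  have \<kappa>: "0 \<le> \<kappa>" unfolding \<kappa>_def by (rule spec_norm_nonneg)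
  define C where "C = (\<integral>a. 2 * N * (exp (2 * \<kappa> * norm a) * wt b a) \<partial>lborel)"
  have int: "integrable lborel (\<lambda>a. 2 * N * (exp (2 * \<kappa> * norm a) * wt b a))"
    by (intro integrable_mult_right integrable_exp_norm_wt)
  show "bounded_linear (\<lambda>e. e \<bullet> J h b)" by (rule bounded_linear_inner_left)
  show "norm (I h b' - I h b - (b' - b) \<bullet> J h b) / norm (b' - b) \<le> C * norm (b' - b)"
    if b': "b' \<noteq> b" "dist b' b < 1" for b'
  proof -
    define e where "e = b' - b"
    have e: "norm e < 1" "e \<noteq> 0" "b' = b + e" using b' by (auto simp: e_def dist_norm)
    have eq: "h a * (exp (e \<bullet> (M *v a)) - 1 - e \<bullet> (M *v a)) * wt b a
        = h a * wt b' a - h a * wt b a - h a * (e \<bullet> (M *v a)) * wt b a" for a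
      by (simp add: e(3) wt_add algebra_simps)
    have int3: "integrable lborel (\<lambda>a. h a * wt b' a)" "integrable lborel (\<lambda>a. h a * wt b a)"
      "integrable lborel (\<lambda>a. h a * (e \<bullet> (M *v a)) * wt b a)"
      by (rule integrable_bounded_wt integrable_inner_J)+
    have "I h b' - I h b - e \<bullet> J h b = (\<integral>a. h a * (exp (e \<bullet> (M *v a)) - 1 - e \<bullet> (M *v a)) * wt b a \<partial>lborel)"
      unfolding I_def inner_J eq using int3 by simp
    also have "norm \<dots> \<le> (\<integral>a. norm (h a * (exp (e \<bullet> (M *v a)) - 1 - e \<bullet> (M *v a)) * wt b a) \<partial>lborel)"
      by (rule integral_norm_bound)
    also have "\<dots> \<le> (\<integral>a. (norm e)\<^sup>2 * (2 * N * (exp (2 * \<kappa> * norm a) * wt b a)) \<partial>lborel)"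
    proof (rule integral_mono)
      show "integrable lborel (\<lambda>a. norm (h a * (exp (e \<bullet> (M *v a)) - 1 - e \<bullet> (M *v a)) * wt b a))"
        unfolding eq using int3 by (intro integrable_norm Bochner_Integration.integrable_diff)
      show "integrable lborel (\<lambda>a. (norm e)\<^sup>2 * (2 * N * (exp (2 * \<kappa> * norm a) * wt b a)))"
        using int by (rule integrable_mult_right)
      fix a
      let ?z = "e \<bullet> (M *v a)"
      have z: "\<bar>?z\<bar> \<le> norm e * (\<kappa> * norm a)"
        using Cauchy_Schwarz_ineq2[of e "M *v a"] mult_left_mono[OF norm_matrix_vector_le[of M a], of "norm e"]
        by (simp add: \<kappa>_def)
      have z1: "\<bar>?z\<bar> \<le> \<kappa> * norm a"
        using z mult_right_mono[of "norm e" 1 "\<kappa> * norm a"] e \<kappa> by simp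
      have x2: "x\<^sup>2 \<le> 2 * exp x" if "0 \<le> x" for x :: real
        using exp_lower_Taylor_quadratic[OF that] that by simp
      have "\<bar>exp ?z - 1 - ?z\<bar> \<le> ?z\<^sup>2 * exp \<bar>?z\<bar>" by (rule exp_quadratic_remainder)
      also have "\<dots> \<le> (norm e * (\<kappa> * norm a))\<^sup>2 * exp (\<kappa> * norm a)"
        using z z1 by (intro mult_mono) (auto simp: abs_le_square_iff[symmetric])
      also have "\<dots> = (norm e)\<^sup>2 * ((\<kappa> * norm a)\<^sup>2 * exp (\<kappa> * norm a))" by (simp add: power_mult_distrib)
      also have "\<dots> \<le> (norm e)\<^sup>2 * (2 * exp (\<kappa> * norm a) * exp (\<kappa> * norm a))"
        using x2[of "\<kappa> * norm a"] \<kappa> by (intro mult_left_mono mult_right_mono) auto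
      also have "\<dots> = (norm e)\<^sup>2 * (2 * exp (2 * \<kappa> * norm a))" by (simp add: exp_add[symmetric] mult.assoc)
      finally have "\<bar>h a\<bar> * \<bar>exp ?z - 1 - ?z\<bar> \<le> N * ((norm e)\<^sup>2 * (2 * exp (2 * \<kappa> * norm a)))"
        using hN[of a] N_nonneg by (intro mult_mono) auto
      then have "\<bar>h a\<bar> * \<bar>exp ?z - 1 - ?z\<bar> * wt b a \<le> N * ((norm e)\<^sup>2 * (2 * exp (2 * \<kappa> * norm a))) * wt b a"
        using wt_pos[of b a] by (intro mult_right_mono) auto
      then show "norm (h a * (exp ?z - 1 - ?z) * wt b a) \<le> (norm e)\<^sup>2 * (2 * N * (exp (2 * \<kappa> * norm a) * wt b a))"
        using wt_pos[of b a] by (simp add: abs_mult mult_ac)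
    qed
    also have "\<dots> = (norm e)\<^sup>2 * C" by (simp add: C_def)
    finally show ?thesis
      using e by (simp add: e_def[symmetric] divide_le_eq power2_eq_square mult_ac)
  qed
  show "((\<lambda>b'. C * norm (b' - b)) \<longlongrightarrow> 0) (at b)"
    by (auto intro!: tendsto_eq_intros)
qed simp

lemma measurable_I[measurable]: "I h \<in> borel_measurable borel"
  using has_derivative_I has_derivative_continuous
  by (intro borel_measurable_continuous_onI continuous_at_imp_continuous_on) blast

end

lemma I_mono: "(\<And>a. \<bar>h a\<bar> \<le> N) \<Longrightarrow> (\<And>a. \<bar>g a\<bar> \<le> N') \<Longrightarrow> h \<in> borel_measurable borel \<Longrightarrow> g \<in> borel_measurable borel \<Longrightarrow>
    (\<And>a. h a \<le> g a) \<Longrightarrow> I h b \<le> I g b"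
  unfolding I_def using wt_pos[of b]
  by (intro integral_mono integrable_bounded_wt mult_right_mono) (auto intro: less_imp_le)

lemma I_pos:
  assumes [measurable]: "h \<in> borel_measurable borel" and hN: "\<And>a. \<bar>h a\<bar> \<le> N" and pos: "\<And>a. 0 < h a"
  shows "0 < I h b"
proof (rule ccontr)
  assume "\<not> 0 < I h b"
  moreover have nn: "AE a in lborel. 0 \<le> h a * wt b a"
    using pos wt_pos by (auto intro!: less_imp_le)
  ultimately have "(\<integral>a. h a * wt b a \<partial>lborel) = 0"
    using integral_nonneg_AE[OF nn] by (simp add: I_def)
  then have "AE a in lborel. h a * wt b a = 0"
    using integral_nonneg_eq_0_iff_AE[OF integrable_bounded_wt[OF assms(1,2)] nn] by simp
  moreover have "h a * wt b a \<noteq> 0" for a using pos[of a] wt_pos[of b a] by simp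
  ultimately have "AE a::real^'d in lborel. False" by simp
  then show False by (simp add: AE_iff_null null_sets_def)
qed

text \<open>Convexity of the log-partition function along simultaneous changes of \<open>f\<close> and \<open>b\<close>; this is
  nonnegativity of the relative entropy of the two tilted measures.\<close>

lemma gibbs_tilt:
  assumes [measurable]: "f \<in> borel_measurable borel" "g \<in> borel_measurable borel"
    and f: "\<And>a. \<bar>f a\<bar> \<le> N" and g: "\<And>a. \<bar>g a\<bar> \<le> N"
  shows "(I (\<lambda>a. (g a - f a) * exp (f a)) b + (b' - b) \<bullet> J (\<lambda>a. exp (f a)) b) / I (\<lambda>a. exp (f a)) b
    \<le> ln (I (\<lambda>a. exp (g a)) b') - ln (I (\<lambda>a. exp (f a)) b)"
proof -
  have ebd: "\<bar>exp (f a)\<bar> \<le> exp N" "\<bar>exp (g a)\<bar> \<le> exp N" for a using f[of a] g[of a] by auto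
  have gbd: "\<bar>(g a - f a) * exp (f a)\<bar> \<le> 2 * N * exp N" for a
    unfolding abs_mult using f[of a] g[of a] by (intro mult_mono) auto
  define Zf Zg where "Zf = I (\<lambda>a. exp (f a)) b" and "Zg = I (\<lambda>a. exp (g a)) b'"
  have Z: "0 < Zf" "0 < Zg" unfolding Zf_def Zg_def using ebd by (auto intro!: I_pos[where N = "exp N"])
  have intf: "integrable lborel (\<lambda>a. exp (f a) * wt b a)" and intg: "integrable lborel (\<lambda>a. exp (g a) * wt b' a)"
    using ebd by (auto intro!: integrable_bounded_wt[where N = "exp N"])
  define D where "D a = exp (f a) * wt b a / Zf" for a
  have D: "0 < D a" for a using Z wt_pos[of b a] by (simp add: D_def)
  have Dm[measurable]: "D \<in> borel_measurable borel" unfolding D_def by measurable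
  let ?\<nu> = "density lborel (\<lambda>a. ennreal (D a))"
  have "(\<integral>\<^sup>+a. ennreal (D a) \<partial>lborel) = ennreal (\<integral>a. D a \<partial>lborel)"
    using D intf by (intro nn_integral_eq_integral) (auto simp: D_def intro!: less_imp_le)
  also have "(\<integral>a. D a \<partial>lborel) = 1" using Z by (simp add: D_def Zf_def I_def)
  finally have "prob_space ?\<nu>" by (intro prob_spaceI) (simp add: emeasure_density cong: nn_integral_cong)
  then interpret \<nu>: prob_space ?\<nu> .
  define u where "u a = (f a - g a) - (b' - b) \<bullet> (M *v a) + (ln Zg - ln Zf)" for a
  have [measurable]: "u \<in> borel_measurable borel" unfolding u_def by measurable
  have eq: "D a * u a = - ((g a - f a) * exp (f a) * wt b a) / Zf - (exp (f a) * ((b' - b) \<bullet> (M *v a)) * wt b a) / Zf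
      + (ln Zg - ln Zf) * (exp (f a) * wt b a) / Zf" for a
    using Z by (simp add: D_def u_def field_simps)
  have i1: "integrable lborel (\<lambda>a. (g a - f a) * exp (f a) * wt b a)"
    using gbd by (intro integrable_bounded_wt) auto
  have i2: "integrable lborel (\<lambda>a. exp (f a) * ((b' - b) \<bullet> (M *v a)) * wt b a)"
    using ebd by (intro integrable_inner_J) auto
  have int: "integrable lborel (\<lambda>a. D a * u a)"
    unfolding eq using i1 i2 intf by (intro Bochner_Integration.integrable_add Bochner_Integration.integrable_diff integrable_divide_zero integrable_mult_right integrable_minus) auto
  have val: "(\<integral>a. D a * u a \<partial>lborel) = - I (\<lambda>a. (g a - f a) * exp (f a)) b / Zf - (b' - b) \<bullet> J (\<lambda>a. exp (f a)) b / Zf + (ln Zg - ln Zf)"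
  proof -
    have J: "(b' - b) \<bullet> J (\<lambda>a. exp (f a)) b = (\<integral>a. exp (f a) * ((b' - b) \<bullet> (M *v a)) * wt b a \<partial>lborel)"
      using ebd by (intro inner_J) auto
    show ?thesis unfolding eq J
      using i1 i2 intf Z by (simp add: I_def[of "\<lambda>a. (g a - f a) * exp (f a)"]) (simp add: Zf_def I_def)
  qed
  have "(\<integral>\<^sup>+a. ennreal (exp (- u a)) \<partial>?\<nu>) = (\<integral>\<^sup>+a. ennreal (exp (g a) * wt b' a / Zg) \<partial>lborel)"
  proof (subst nn_integral_density; (intro nn_integral_cong)?)
    fix a
    have "D a * exp (- u a) = exp (g a) * wt b' a / Zg"
      using Z wt_add[of b "b' - b" a]
      by (simp add: D_def u_def exp_diff exp_add exp_minus field_simps)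
    then show "ennreal (D a) * ennreal (exp (- u a)) = ennreal (exp (g a) * wt b' a / Zg)"
      using D[of a] by (simp add: ennreal_mult[symmetric])
  qed auto
  also have "\<dots> = ennreal (\<integral>a. exp (g a) * wt b' a / Zg \<partial>lborel)"
    using intg Z wt_pos[of b'] by (intro nn_integral_eq_integral) (auto intro!: less_imp_le)
  also have "\<dots> = 1" using Z by (simp add: Zg_def I_def)
  finally have "0 \<le> \<nu>.expectation u"
    using int D by (intro \<nu>.gibbs_inequality(2)) (auto simp: integrable_real_density less_imp_le)
  also have "\<nu>.expectation u = (\<integral>a. D a * u a \<partial>lborel)"
    using D by (simp add: integral_real_density less_imp_le)
  finally show ?thesis using Z by (simp add: val Zf_def[symmetric] Zg_def[symmetric] add_divide_distrib)
qed

end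

context tilted_family
begin

definition subgaussian :: "real \<Rightarrow> bool" where
  "subgaussian \<sigma> \<longleftrightarrow> (\<forall>b b'. L b' - L b - (b' - b) \<bullet> mean b \<le> \<sigma> / 2 * (norm (b' - b))\<^sup>2)"

lemma I_cmult: "I (\<lambda>a. c * h a) b = c * I h b"
  by (simp add: I_def mult.assoc)

lemma I_one_pos: "0 < I (\<lambda>_. 1) b"
  by (rule I_pos[where N = 1]) auto

lemma exp_le_exp_if_abs_le: "\<bar>x\<bar> \<le> N \<Longrightarrow> \<bar>exp x\<bar> \<le> exp N" for x N :: real
  by auto

lemma mean_deviation_le:
  assumes sg: "subgaussian \<sigma>" and \<sigma>: "0 < \<sigma>"
    and [measurable]: "f \<in> borel_measurable borel" and f: "\<And>a. \<bar>f a\<bar> \<le> N"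
  shows "(norm (J (\<lambda>a. exp (f a)) b /\<^sub>R I (\<lambda>a. exp (f a)) b - mean b))\<^sup>2
    \<le> 2 * \<sigma> * (I (\<lambda>a. f a * exp (f a)) b / I (\<lambda>a. exp (f a)) b - (ln (I (\<lambda>a. exp (f a)) b) - L b))"
proof -
  define Z where "Z = I (\<lambda>a. exp (f a)) b"
  define m where "m = J (\<lambda>a. exp (f a)) b /\<^sub>R Z"
  define v where "v = m - mean b"
  define H where "H = I (\<lambda>a. f a * exp (f a)) b / Z - (ln Z - L b)"
  have N: "0 \<le> N" using f[of 0] by linarith
  let ?b = "b + (1 / \<sigma>) *\<^sub>R v"
  have "(I (\<lambda>a. (0 - f a) * exp (f a)) b + (?b - b) \<bullet> J (\<lambda>a. exp (f a)) b) / Z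
    \<le> ln (I (\<lambda>a. exp 0) ?b) - ln Z"
    unfolding Z_def using f N by (intro gibbs_tilt) auto
  moreover have "I (\<lambda>a. (0 - f a) * exp (f a)) b = - I (\<lambda>a. f a * exp (f a)) b"
    using I_cmult[of "-1" "\<lambda>a. f a * exp (f a)" b] by simp
  moreover have "(?b - b) \<bullet> J (\<lambda>a. exp (f a)) b / Z = (1 / \<sigma>) * (v \<bullet> m)"
    by (simp add: m_def divide_inverse mult_ac)
  ultimately have "(1 / \<sigma>) * (v \<bullet> m) \<le> H + (L ?b - L b)"
    by (simp add: H_def L_def add_divide_distrib)
  also have "L ?b - L b \<le> (?b - b) \<bullet> mean b + \<sigma> / 2 * (norm (?b - b))\<^sup>2"
    using sg[unfolded subgaussian_def, rule_format, of ?b b] by simp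
  also have "\<sigma> / 2 * (norm (?b - b))\<^sup>2 = (norm v)\<^sup>2 / (2 * \<sigma>)"
    using \<sigma> by (simp add: power_mult_distrib power2_eq_square)
  finally have "(1 / \<sigma>) * (v \<bullet> m) \<le> H + ((1 / \<sigma>) * (v \<bullet> mean b) + (norm v)\<^sup>2 / (2 * \<sigma>))" by simp
  moreover have "(norm v)\<^sup>2 = v \<bullet> m - v \<bullet> mean b"
    by (simp add: power2_norm_eq_inner v_def inner_diff_right)
  ultimately have "(norm v)\<^sup>2 / \<sigma> \<le> H + (norm v)\<^sup>2 / (2 * \<sigma>)"
    by (simp add: diff_divide_distrib)
  then have "(norm v)\<^sup>2 \<le> 2 * \<sigma> * H" using \<sigma> by (simp add: field_simps)
  then show ?thesis by (simp add: v_def m_def H_def Z_def)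
qed

lemma tilted_cost_le:
  assumes sg: "subgaussian \<sigma>"
    and [measurable]: "f \<in> borel_measurable borel" and f: "\<And>a. \<bar>f a\<bar> \<le> N"
  shows "I f b' / I (\<lambda>_. 1) b' - (ln (I (\<lambda>a. exp (f a)) b) - L b) \<le> \<sigma> / 2 * (norm (b - b'))\<^sup>2"
proof -
  have N: "0 \<le> N" using f[of 0] by linarith
  have "(I (\<lambda>a. (f a - 0) * exp 0) b' + (b - b') \<bullet> J (\<lambda>a. exp 0) b') / I (\<lambda>a. exp 0) b'
    \<le> ln (I (\<lambda>a. exp (f a)) b) - ln (I (\<lambda>a. exp 0) b')"
    using f N by (intro gibbs_tilt) auto
  moreover have "(b - b') \<bullet> J (\<lambda>_. 1) b' / I (\<lambda>_. 1) b' = (b - b') \<bullet> mean b'"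
    by (simp add: mean_def divide_inverse)
  ultimately have "I f b' / I (\<lambda>_. 1) b' + (b - b') \<bullet> mean b' \<le> ln (I (\<lambda>a. exp (f a)) b) - L b'"
    by (simp add: L_def add_divide_distrib)
  then show ?thesis using sg[unfolded subgaussian_def, rule_format, of b b'] by linarith
qed

context
  fixes f :: "real^'d \<Rightarrow> real" and N :: real
  assumes f[measurable]: "f \<in> borel_measurable borel" and fN: "\<And>a. \<bar>f a\<bar> \<le> N"
begin

definition c :: "real \<Rightarrow> real^'d \<Rightarrow> real" where
  "c t b = ln (I (\<lambda>a. exp (t * f a)) b) - L b"

definition c' :: "real \<Rightarrow> real^'d \<Rightarrow> real" where
  "c' t b = I (\<lambda>a. f a * exp (t * f a)) b / I (\<lambda>a. exp (t * f a)) b"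

lemma tf_le: "\<bar>t * f a\<bar> \<le> \<bar>t\<bar> * N"
  unfolding abs_mult using fN[of a] by (intro mult_left_mono) auto

lemma exp_tf_le: "\<bar>exp (t * f a)\<bar> \<le> exp (\<bar>t\<bar> * N)"
  using tf_le by (rule exp_le_exp_if_abs_le)

lemma f_exp_tf_le: "\<bar>f a * exp (t * f a)\<bar> \<le> N * exp (\<bar>t\<bar> * N)"
  unfolding abs_mult using fN[of a] exp_tf_le[of t a] by (intro mult_mono) auto

lemma I_exp_pos: "0 < I (\<lambda>a. exp (t * f a)) b"
  using exp_tf_le by (rule I_pos[rotated]) auto

lemma measurable_c[measurable]: "c t \<in> borel_measurable borel" "c' t \<in> borel_measurable borel"
proof -
  have [measurable]: "I (\<lambda>a. exp (t * f a)) \<in> borel_measurable borel"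
    using exp_tf_le by (rule measurable_I[rotated]) simp
  have [measurable]: "I (\<lambda>a. f a * exp (t * f a)) \<in> borel_measurable borel"
    using f_exp_tf_le by (rule measurable_I[rotated]) simp
  have [measurable]: "I (\<lambda>a. 1) \<in> borel_measurable borel"
    by (rule measurable_I[where N = 1]) auto
  show "c t \<in> borel_measurable borel" "c' t \<in> borel_measurable borel"
    unfolding c_def c'_def L_def by measurable
qed

lemma abs_c_le: "\<bar>c t b\<bar> \<le> \<bar>t\<bar> * N"
proof -
  have "I (\<lambda>a. exp (- (\<bar>t\<bar> * N)) * 1) b \<le> I (\<lambda>a. exp (t * f a)) b"
    using tf_le[of t] exp_tf_le by (intro I_mono[of _ "exp (- (\<bar>t\<bar> * N))" _ "exp (\<bar>t\<bar> * N)"]) (auto simp: abs_le_iff minus_le_iff)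
  moreover have "I (\<lambda>a. exp (t * f a)) b \<le> I (\<lambda>a. exp (\<bar>t\<bar> * N) * 1) b"
    using tf_le[of t] exp_tf_le by (intro I_mono[of _ "exp (\<bar>t\<bar> * N)" _ "exp (\<bar>t\<bar> * N)"]) (auto simp: abs_le_iff)
  ultimately have "ln (exp (- (\<bar>t\<bar> * N)) * I (\<lambda>_. 1) b) \<le> ln (I (\<lambda>a. exp (t * f a)) b)"
    "ln (I (\<lambda>a. exp (t * f a)) b) \<le> ln (exp (\<bar>t\<bar> * N) * I (\<lambda>_. 1) b)"
    using I_one_pos[of b] I_exp_pos[of t b] unfolding I_cmult by auto
  then show ?thesis using I_one_pos[of b] by (simp add: c_def L_def ln_mult abs_le_iff)
qed

lemma abs_c'_le: "\<bar>c' t b\<bar> \<le> N"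
proof -
  have N: "0 \<le> N" using fN[of 0] by linarith
  have lo: "- N * exp (t * f a) \<le> f a * exp (t * f a)" and up: "f a * exp (t * f a) \<le> N * exp (t * f a)" for a
    using fN[of a] mult_right_mono[of "- N" "f a" "exp (t * f a)"] mult_right_mono[of "f a" N "exp (t * f a)"] by (auto simp: abs_le_iff)
  have Nb: "\<bar>N * exp (t * f a)\<bar> \<le> N * exp (\<bar>t\<bar> * N)" "\<bar>- N * exp (t * f a)\<bar> \<le> N * exp (\<bar>t\<bar> * N)" for a
    using exp_tf_le[of t a] N by (simp_all add: abs_mult mult_left_mono)
  have "I (\<lambda>a. - N * exp (t * f a)) b \<le> I (\<lambda>a. f a * exp (t * f a)) b"
    by (rule I_mono[OF Nb(2) f_exp_tf_le _ _ lo]) auto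
  moreover have "I (\<lambda>a. f a * exp (t * f a)) b \<le> I (\<lambda>a. N * exp (t * f a)) b"
    by (rule I_mono[OF f_exp_tf_le Nb(1) _ _ up]) auto
  ultimately show ?thesis
    using I_exp_pos[of t b] unfolding I_cmult by (simp add: c'_def abs_le_iff divide_le_eq minus_le_iff le_divide_eq)
qed

lemma has_real_derivative_c: "((\<lambda>t. c t b) has_real_derivative c' t b) (at t)"
proof -
  let ?W = "density lborel (\<lambda>a. ennreal (wt b a))"
  have W: "finite_measure ?W"
    using integrable_wt[of b] wt_pos[of b]
    by (intro finite_measureI) (simp add: emeasure_density integrable_iff_bounded less_imp_le less_top cong: nn_integral_cong)
  have eq: "(\<integral>a. h a \<partial>?W) = I h b" if [measurable]: "h \<in> borel_measurable borel" for h
    using wt_pos[of b] by (subst integral_real_density) (auto simp: I_def mult.commute less_imp_le)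
  have bd: "\<bar>exp (s * f a)\<bar> \<le> (N + 1) * exp ((\<bar>t\<bar> + 1) * N)" "\<bar>f a * exp (s * f a)\<bar> \<le> (N + 1) * exp ((\<bar>t\<bar> + 1) * N)"
    if "s \<in> {t - 1<..<t + 1}" for s a
  proof -
    have N: "0 \<le> N" using fN[of 0] by linarith
    have "\<bar>s\<bar> * N \<le> (\<bar>t\<bar> + 1) * N" using that N by (intro mult_right_mono) auto
    then have e: "exp (\<bar>s\<bar> * N) \<le> exp ((\<bar>t\<bar> + 1) * N)" by simp
    then have "1 * exp (\<bar>s\<bar> * N) \<le> (N + 1) * exp ((\<bar>t\<bar> + 1) * N)" "N * exp (\<bar>s\<bar> * N) \<le> (N + 1) * exp ((\<bar>t\<bar> + 1) * N)"
      using N by (intro mult_mono; simp)+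
    then show "\<bar>exp (s * f a)\<bar> \<le> (N + 1) * exp ((\<bar>t\<bar> + 1) * N)" "\<bar>f a * exp (s * f a)\<bar> \<le> (N + 1) * exp ((\<bar>t\<bar> + 1) * N)"
      using exp_tf_le[of s a] f_exp_tf_le[of a s] by linarith+
  qed
  have "((\<lambda>s. \<integral>a. exp (s * f a) \<partial>?W) has_real_derivative (\<integral>a. f a * exp (t * f a) \<partial>?W)) (at t)"
    by (rule has_real_derivative_integral_bounded[OF W, where a = "t - 1" and b = "t + 1"
          and C = "(N + 1) * exp ((\<bar>t\<bar> + 1) * N)" and F = "\<lambda>s a. exp (s * f a)" and F' = "\<lambda>s a. f a * exp (s * f a)"])
      (simp, measurable, rule bd(1), assumption, auto intro!: derivative_eq_intros, rule bd(2), simp)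
  then have "((\<lambda>s. I (\<lambda>a. exp (s * f a)) b) has_real_derivative I (\<lambda>a. f a * exp (t * f a)) b) (at t)"
    by (simp add: eq)
  then show ?thesis
    unfolding c_def c'_def using I_exp_pos[of t b] by (auto intro!: derivative_eq_intros)
qed

lemma has_derivative_c:
  "(c t has_derivative (\<lambda>e. e \<bullet> (J (\<lambda>a. exp (t * f a)) b /\<^sub>R I (\<lambda>a. exp (t * f a)) b - mean b))) (at b)"
proof -
  have "(I (\<lambda>a. exp (t * f a)) has_derivative (\<lambda>e. e \<bullet> J (\<lambda>a. exp (t * f a)) b)) (at b)"
    by (rule has_derivative_I[OF _ exp_tf_le]) simp
  moreover have "(I (\<lambda>a. 1) has_derivative (\<lambda>e. e \<bullet> J (\<lambda>a. 1) b)) (at b)"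
    by (rule has_derivative_I[where N = 1]) auto
  ultimately show ?thesis
    unfolding c_def L_def mean_def using I_exp_pos[of t b] I_one_pos[of b]
    by (auto intro!: derivative_eq_intros simp: inner_diff_right divide_inverse mult_ac)
qed

lemma grad_sq_le:
  assumes "subgaussian \<sigma>" "0 < \<sigma>"
  shows "(norm (grad (\<lambda>b. r * c t b + d) b))\<^sup>2 \<le> r\<^sup>2 * (2 * \<sigma> * (t * c' t b - c t b))"
proof -
  let ?v = "J (\<lambda>a. exp (t * f a)) b /\<^sub>R I (\<lambda>a. exp (t * f a)) b - mean b"
  have "((\<lambda>b. r * c t b + d) has_derivative (\<lambda>e. r * (e \<bullet> ?v))) (at b)"
    by (auto intro!: derivative_eq_intros has_derivative_c)
  then have "frechet_derivative (\<lambda>b. r * c t b + d) (at b) = (\<lambda>e. r * (e \<bullet> ?v))"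
    by (rule frechet_derivative_at[symmetric])
  then have "grad (\<lambda>b. r * c t b + d) b = r *\<^sub>R ?v"
    by (simp add: grad_def vec_eq_iff inner_axis')
  then have eq: "(norm (grad (\<lambda>b. r * c t b + d) b))\<^sup>2 = r\<^sup>2 * (norm ?v)\<^sup>2"
    by (simp add: power_mult_distrib)
  have "(norm ?v)\<^sup>2 \<le> 2 * \<sigma> * (I (\<lambda>a. t * f a * exp (t * f a)) b / I (\<lambda>a. exp (t * f a)) b - (ln (I (\<lambda>a. exp (t * f a)) b) - L b))"
    by (rule mean_deviation_le[OF assms _ tf_le]) simp
  also have "I (\<lambda>a. t * f a * exp (t * f a)) b = t * I (\<lambda>a. f a * exp (t * f a)) b"
    unfolding mult.assoc by (rule I_cmult)
  finally have "(norm ?v)\<^sup>2 \<le> 2 * \<sigma> * (t * c' t b - c t b)" by (simp add: c_def c'_def)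
  then show ?thesis unfolding eq by (rule mult_left_mono) simp
qed

lemma jensen_c: "t * (I f b / I (\<lambda>_. 1) b) \<le> c t b"
proof -
  have "(I (\<lambda>a. (t * f a - 0) * exp 0) b + (b - b) \<bullet> J (\<lambda>a. exp 0) b) / I (\<lambda>a. exp 0) b
    \<le> ln (I (\<lambda>a. exp (t * f a)) b) - ln (I (\<lambda>a. exp 0) b)"
    using tf_le[of t] fN[of 0] by (intro gibbs_tilt[where N = "\<bar>t\<bar> * N"]) (auto intro: order_trans[OF abs_ge_zero])
  then show ?thesis by (simp add: c_def L_def I_cmult)
qed

lemma lyapunov_c:
  assumes "0 \<le> t" "t \<le> 1"
  shows "c t b \<le> t * c 1 b"
proof -
  have "(I (\<lambda>a. (f a - t * f a) * exp (t * f a)) b + (b - b) \<bullet> J (\<lambda>a. exp (t * f a)) b) / I (\<lambda>a. exp (t * f a)) b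
    \<le> ln (I (\<lambda>a. exp (f a)) b) - ln (I (\<lambda>a. exp (t * f a)) b)"
  proof (rule gibbs_tilt)
    have "0 \<le> N" using fN[of 0] by linarith
    then show "\<bar>t * f a\<bar> \<le> N" for a
      using tf_le[of t a] mult_right_mono[of t 1 N] assms by simp
  qed (use fN in auto)
  also have "(\<lambda>a. (f a - t * f a) * exp (t * f a)) = (\<lambda>a. (1 - t) * (f a * exp (t * f a)))"
    by (simp add: fun_eq_iff algebra_simps)
  finally have 1: "(1 - t) * c' t b \<le> c 1 b - c t b"
    by (simp add: I_cmult c_def c'_def)
  have "(I (\<lambda>a. (0 - t * f a) * exp (t * f a)) b + (b - b) \<bullet> J (\<lambda>a. exp (t * f a)) b) / I (\<lambda>a. exp (t * f a)) b
    \<le> ln (I (\<lambda>a. exp 0) b) - ln (I (\<lambda>a. exp (t * f a)) b)"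
    using tf_le[of t] by (intro gibbs_tilt[where N = "\<bar>t\<bar> * N"]) (auto intro: order_trans[OF abs_ge_zero])
  also have "(\<lambda>a. (0 - t * f a) * exp (t * f a)) = (\<lambda>a. (- t) * (f a * exp (t * f a)))"
    by (simp add: fun_eq_iff)
  finally have 2: "- t * c' t b \<le> - c t b"
    unfolding I_cmult by (simp add: c_def c'_def L_def)
  have "t * ((1 - t) * c' t b) \<le> t * (c 1 b - c t b)" using 1 assms by (intro mult_left_mono)
  moreover have "(1 - t) * (- t * c' t b) \<le> (1 - t) * (- c t b)" using 2 assms by (intro mult_left_mono) auto
  ultimately show ?thesis by (simp add: algebra_simps)
qed

text \<open>Along \<open>q(t) = (1 - t) / \<epsilon>\<close> the quantity \<open>ln \<eta>(exp (q \<phi>\<^sub>t)) / q\<close> with \<open>\<phi>\<^sub>t = c t / t\<close> is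
  nondecreasing: \<open>\<phi>\<close> is a supersolution of a Hamilton-Jacobi equation by \<open>mean_deviation_le\<close>, and the
  logarithmic Sobolev inequality is applied to the measures proportional to \<open>exp (q \<phi>\<^sub>t) \<eta>\<close>. At \<open>t = 0\<close> and
  \<open>t = 1\<close> it equals the two sides of the claim.\<close>

lemma dual_transport_if_log_sobolev:
  assumes sg: "subgaussian \<sigma>" and \<sigma>: "0 < \<sigma>" and \<eta>: "prob_space \<eta>" "sets \<eta> = sets borel"
    and ls: "log_sobolev \<eta> \<rho>" and \<rho>: "0 < \<rho>"
  shows "\<sigma> * \<rho> * ln (\<integral>b. exp (I f b / I (\<lambda>_. 1) b / (\<sigma> * \<rho>)) \<partial>\<eta>) \<le> (\<integral>b. c 1 b \<partial>\<eta>)"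
proof -
  interpret \<eta>: prob_space \<eta> by fact
  have [measurable]: "c t \<in> borel_measurable \<eta>" "c' t \<in> borel_measurable \<eta>" for t
    using measurable_c \<eta>(2) measurable_cong_sets by blast+
  have [measurable]: "(\<lambda>b. I f b / I (\<lambda>_. 1) b) \<in> borel_measurable \<eta>"
  proof -
    have "(\<lambda>b. I f b / I (\<lambda>_. 1) b) \<in> borel_measurable borel"
      by (intro borel_measurable_divide measurable_I[OF f fN] measurable_I[where N = 1]) auto
    then show ?thesis using \<eta>(2) measurable_cong_sets by blast
  qed
  define \<epsilon> where "\<epsilon> = \<sigma> * \<rho>"
  have \<epsilon>: "0 < \<epsilon>" using \<sigma> \<rho> by (simp add: \<epsilon>_def)
  have N: "0 \<le> N" using fN[of 0] by linarith
  define r where "r t = (1 - t) / (\<epsilon> * t)" for t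
  define Z where "Z t = (\<integral>b. exp (r t * c t b) \<partial>\<eta>)" for t
  have r0: "0 \<le> r t" if "0 < t" "t \<le> 1" for t using that \<epsilon> by (simp add: r_def)
  have cN: "\<bar>c t b\<bar> \<le> N" if "0 \<le> t" "t \<le> 1" for t b
    using abs_c_le[of t b] mult_right_mono[of t 1 N] that N by simp
  have rc: "\<bar>r t * c t b\<bar> \<le> r t * N" if "0 < t" "t \<le> 1" for t b
    unfolding abs_mult using r0[OF that] cN[of t b] that by (simp add: mult_left_mono)
  have erc: "\<bar>exp (r t * c t b)\<bar> \<le> exp (r t * N)" if "0 < t" "t \<le> 1" for t b
    using rc[OF that] by (rule exp_le_exp_if_abs_le)
  have int_erc: "integrable \<eta> (\<lambda>b. exp (r t * c t b))" if "0 < t" "t \<le> 1" for t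
    using erc[OF that] by (intro \<eta>.integrable_const_bound[of _ "exp (r t * N)"]) auto
  have int_bd: "integrable \<eta> (\<lambda>b. h b * exp (r t * c t b))" if "0 < t" "t \<le> 1" and [measurable]: "h \<in> borel_measurable \<eta>" and "\<And>b. \<bar>h b\<bar> \<le> N" for t h
  proof (rule \<eta>.integrable_const_bound[of _ "N * exp (r t * N)"])
    show "AE b in \<eta>. norm (h b * exp (r t * c t b)) \<le> N * exp (r t * N)"
      unfolding real_norm_def abs_mult using that erc[OF that(1,2)] N by (intro AE_I2 mult_mono) auto
  qed measurable
  have Zpos: "0 < Z t" if "0 < t" "t \<le> 1" for t
  proof -
    have "(\<integral>b. exp (- (r t * N)) \<partial>\<eta>) \<le> Z t"
      unfolding Z_def using rc[OF that] by (intro integral_mono int_erc that) (auto simp: abs_le_iff minus_le_iff)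
    then have "exp (- (r t * N)) \<le> Z t" using \<eta>.prob_space by simp
    then show ?thesis by (rule less_le_trans[OF exp_gt_zero])
  qed
  define X where "X t = (\<integral>b. c t b * exp (r t * c t b) \<partial>\<eta>) / Z t" for t
  define Y where "Y t = (\<integral>b. c' t b * exp (r t * c t b) \<partial>\<eta>) / Z t" for t
  have dZ: "(Z has_real_derivative (- 1 / (\<epsilon> * t\<^sup>2) * X t + r t * Y t) * Z t) (at t)" if t: "0 < t" "t < 1" for t
  proof -
    define R where "R = 2 / (\<epsilon> * t)"
    define R' where "R' = 4 / (\<epsilon> * t\<^sup>2)"
    define C where "C = (1 + R' * N + R * N) * exp (R * N)"
    define F' where "F' s b = (- 1 / (\<epsilon> * s\<^sup>2) * c s b + r s * c' s b) * exp (r s * c s b)" for s b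
    have R0: "0 \<le> R" "0 \<le> R'" using \<epsilon> t by (auto simp: R_def R'_def)
    then have RN: "0 \<le> R * N" "0 \<le> R' * N" using N by auto
    have s: "0 < s" "s \<le> 1" "r s \<le> R" "1 / (\<epsilon> * s\<^sup>2) \<le> R'" if "s \<in> {t / 2<..<1}" for s
    proof -
      show s: "0 < s" "s \<le> 1" using that t by auto
      have "r s \<le> 1 / (\<epsilon> * (t / 2))" unfolding r_def using that t \<epsilon> s by (intro frac_le) auto
      then show "r s \<le> R" by (simp add: R_def field_simps)
      have "1 / (\<epsilon> * s\<^sup>2) \<le> 1 / (\<epsilon> * (t / 2)\<^sup>2)" using that t \<epsilon> s by (intro frac_le mult_left_mono power_mono) auto
      then show "1 / (\<epsilon> * s\<^sup>2) \<le> R'" by (simp add: R'_def power_divide)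
    qed
    have e: "exp (r s * c s b) \<le> exp (R * N)" if "s \<in> {t / 2<..<1}" for s b
    proof -
      have "r s * c s b \<le> r s * N" using rc[of s b] s[OF that] by (simp add: abs_le_iff)
      also have "\<dots> \<le> R * N" using s[OF that] N by (intro mult_right_mono) auto
      finally show ?thesis by simp
    qed
    have "((\<lambda>s. \<integral>b. exp (r s * c s b) \<partial>\<eta>) has_real_derivative (\<integral>b. F' t b \<partial>\<eta>)) (at t)"
    proof (rule has_real_derivative_integral_bounded[where a = "t / 2" and b = 1 and C = C])
      show "finite_measure \<eta>" by unfold_locales
      show "t \<in> {t / 2<..<1}" using t by simp
      show "\<bar>exp (r s * c s b)\<bar> \<le> C" if "s \<in> {t / 2<..<1}" for s b
      proof -
        have "1 * exp (r s * c s b) \<le> C" unfolding C_def using e[OF that] RN by (intro mult_mono) auto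
        then show ?thesis by simp
      qed
      show "\<bar>F' s b\<bar> \<le> C" if "s \<in> {t / 2<..<1}" for s b
      proof -
        have 1: "\<bar>- 1 / (\<epsilon> * s\<^sup>2) * c s b\<bar> \<le> R' * N"
          unfolding abs_mult using s[OF that] cN[of s b] \<epsilon> R0 by (intro mult_mono) (auto simp: abs_mult)
        have 2: "\<bar>r s * c' s b\<bar> \<le> R * N"
          unfolding abs_mult using s[OF that] abs_c'_le[of s b] r0[of s] N R0 by (intro mult_mono) auto
        have 3: "\<bar>- 1 / (\<epsilon> * s\<^sup>2) * c s b + r s * c' s b\<bar> \<le> 1 + R' * N + R * N"
          using 1 2 abs_triangle_ineq[of "- 1 / (\<epsilon> * s\<^sup>2) * c s b" "r s * c' s b"] by linarith
        show ?thesis unfolding C_def F'_def abs_mult using 3 e[OF that, of b] by (intro mult_mono) auto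
      qed
      show "((\<lambda>s. exp (r s * c s b)) has_real_derivative F' s b) (at s)" if "s \<in> {t / 2<..<1}" for s b
      proof -
        have r: "(r has_real_derivative - 1 / (\<epsilon> * s\<^sup>2)) (at s)"
          unfolding r_def using s[OF that] \<epsilon> by (auto intro!: derivative_eq_intros simp: field_simps power2_eq_square)
        show ?thesis unfolding F'_def
          by (auto intro!: derivative_eq_intros has_real_derivative_c r)
      qed
    qed (auto simp: F'_def)
    moreover have "(\<integral>b. F' t b \<partial>\<eta>) = (- 1 / (\<epsilon> * t\<^sup>2) * X t + r t * Y t) * Z t"
    proof -
      have F': "F' t b = (- 1 / (\<epsilon> * t\<^sup>2)) * (c t b * exp (r t * c t b)) + r t * (c' t b * exp (r t * c t b))" for b
        by (simp add: F'_def algebra_simps)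
      have i: "integrable \<eta> (\<lambda>b. c t b * exp (r t * c t b))" "integrable \<eta> (\<lambda>b. c' t b * exp (r t * c t b))"
        using t cN abs_c'_le by (auto intro!: int_bd)
      have "(\<integral>b. c t b * exp (r t * c t b) \<partial>\<eta>) = X t * Z t" "(\<integral>b. c' t b * exp (r t * c t b) \<partial>\<eta>) = Y t * Z t"
        using Zpos[of t] t by (simp_all add: X_def Y_def)
      then show ?thesis unfolding F' using i by (simp add: right_diff_distrib mult_ac)
    qed
    ultimately show ?thesis unfolding Z_def[abs_def] by simp
  qed
  have lsi: "r t * X t - ln (Z t) \<le> \<epsilon> * (r t)\<^sup>2 * (t * Y t - X t)" if t: "0 < t" "t < 1" for t
  proof -
    let ?g = "\<lambda>b. r t * c t b + - ln (Z t)"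
    let ?R = "\<lambda>b. (r t)\<^sup>2 * (2 * \<sigma> * (t * c' t b - c t b))"
    have Z: "0 < Z t" using Zpos t by simp
    have eg: "exp (?g b) = exp (r t * c t b) / Z t" for b using Z by (simp add: exp_diff)
    have i: "integrable \<eta> (\<lambda>b. c t b * exp (r t * c t b))" "integrable \<eta> (\<lambda>b. c' t b * exp (r t * c t b))" "integrable \<eta> (\<lambda>b. exp (r t * c t b))"
      using t cN abs_c'_le int_erc by (auto intro!: int_bd)
    have eR: "exp (?g b) * ?R b = (2 * \<sigma> * (r t)\<^sup>2 / Z t) * (t * (c' t b * exp (r t * c t b)) - c t b * exp (r t * c t b))" for b
      unfolding eg by (simp add: field_simps)
    have egg: "exp (?g b) * ?g b = (r t / Z t) * (c t b * exp (r t * c t b)) - (ln (Z t) / Z t) * exp (r t * c t b)" for b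
      unfolding eg using Z by (simp add: field_simps)
    have "(\<integral>b. exp (?g b) * ?g b \<partial>\<eta>) \<le> \<rho> / 2 * (\<integral>b. exp (?g b) * ?R b \<partial>\<eta>)"
    proof (rule log_sobolev_density(2)[OF ls \<eta> \<rho>])
      show "?g differentiable (at b)" for b
      proof -
        have "c t differentiable (at b)" using has_derivative_c unfolding differentiable_def by blast
        then show ?thesis by (intro differentiable_add differentiable_mult differentiable_const)
      qed
      show "integrable \<eta> (\<lambda>b. exp (?g b))" unfolding eg using i by simp
      show "(\<integral>b. exp (?g b) \<partial>\<eta>) = 1" unfolding eg using Z by (simp add: Z_def)
      show "(norm (grad ?g b))\<^sup>2 \<le> ?R b" for b by (rule grad_sq_le[OF sg \<sigma>])
      show "integrable \<eta> (\<lambda>b. exp (?g b) * ?R b)" unfolding eR using i by simp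
    qed
    also have "(\<integral>b. exp (?g b) * ?g b \<partial>\<eta>) = r t * X t - ln (Z t)"
      unfolding egg using i Z by (simp add: X_def Z_def)
    also have "(\<integral>b. exp (?g b) * ?R b \<partial>\<eta>) = 2 * \<sigma> * (r t)\<^sup>2 * (t * Y t - X t)"
    proof -
      have "(\<integral>b. exp (?g b) * ?R b \<partial>\<eta>) = (2 * \<sigma> * (r t)\<^sup>2 / Z t) *
          (t * (\<integral>b. c' t b * exp (r t * c t b) \<partial>\<eta>) - (\<integral>b. c t b * exp (r t * c t b) \<partial>\<eta>))"
        unfolding eR using i by simp
      then show ?thesis using Z by (simp add: X_def Y_def field_simps)
    qed
    finally show ?thesis by (simp add: \<epsilon>_def mult_ac)
  qed
  define G where "G t = \<epsilon> * ln (Z t) / (1 - t)" for t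
  have mono: "G t \<le> G s" if "0 < t" "t \<le> s" "s < 1" for t s
  proof (rule DERIV_nonneg_imp_nondecreasing[OF that(2)])
    fix x assume "t \<le> x" "x \<le> s"
    then have x: "0 < x" "x < 1" using that by auto
    define l where "l = - 1 / (\<epsilon> * x\<^sup>2) * X x + r x * Y x"
    have Z: "0 < Z x" using Zpos x by simp
    have "(G has_real_derivative \<epsilon> * ((1 - x) * l + ln (Z x)) / (1 - x)\<^sup>2) (at x)"
      unfolding G_def using Z x dZ[OF x, folded l_def]
      by (auto intro!: derivative_eq_intros simp: power2_eq_square) (simp add: algebra_simps)
    moreover have "0 \<le> \<epsilon> * ((1 - x) * l + ln (Z x)) / (1 - x)\<^sup>2"
    proof -
      have "(1 - x) * l + (r x * X x - \<epsilon> * (r x)\<^sup>2 * (x * Y x - X x)) = 0"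
        using x \<epsilon> by (simp add: l_def r_def divide_simps power2_eq_square) (simp add: algebra_simps)
      then have "0 \<le> (1 - x) * l + ln (Z x)" using lsi[OF x] by linarith
      then show ?thesis using \<epsilon> by simp
    qed
    ultimately show "\<exists>y. (G has_real_derivative y) (at x) \<and> 0 \<le> y" by blast
  qed
  define x where "x = (\<integral>b. c 1 b \<partial>\<eta>)"
  have int_c1: "integrable \<eta> (c 1)"
    using cN[of 1] by (intro \<eta>.integrable_const_bound[of _ N]) auto
  have up: "G s \<le> x + (1 - s) * (N\<^sup>2 * exp N / \<epsilon>)" if s: "0 < s" "s < 1" "(1 - s) / \<epsilon> \<le> 1" for s
  proof -
    define q where "q = (1 - s) / \<epsilon>"
    have q: "0 < q" "q \<le> 1" using s \<epsilon> by (auto simp: q_def)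
    have i: "integrable \<eta> (\<lambda>b. q * c 1 b + q\<^sup>2 * (N\<^sup>2 * exp N))" using int_c1 by simp
    have "Z s - 1 = (\<integral>b. exp (r s * c s b) - 1 \<partial>\<eta>)"
      unfolding Z_def using int_erc s \<eta>.prob_space by simp
    also have "\<dots> \<le> (\<integral>b. q * c 1 b + q\<^sup>2 * (N\<^sup>2 * exp N) \<partial>\<eta>)"
    proof (rule integral_mono[OF _ i])
      show "integrable \<eta> (\<lambda>b. exp (r s * c s b) - 1)" using int_erc s by simp
      fix b
      have "r s * c s b \<le> r s * (s * c 1 b)" using lyapunov_c[of s b] s r0[of s] by (intro mult_left_mono) auto
      also have "\<dots> = q * c 1 b" using s \<epsilon> by (simp add: r_def q_def)
      finally have "exp (r s * c s b) \<le> exp (q * c 1 b)" by simp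
      also have "\<dots> \<le> 1 + q * c 1 b + (q * c 1 b)\<^sup>2 * exp \<bar>q * c 1 b\<bar>"
        using exp_quadratic_remainder[of "q * c 1 b"] by linarith
      also have "(q * c 1 b)\<^sup>2 * exp \<bar>q * c 1 b\<bar> \<le> (q * N)\<^sup>2 * exp N"
      proof (rule mult_mono)
        have 1: "\<bar>q * c 1 b\<bar> \<le> q * N" unfolding abs_mult using q cN[of 1 b] by (simp add: mult_left_mono)
        then show "(q * c 1 b)\<^sup>2 \<le> (q * N)\<^sup>2" using q N by (simp add: abs_le_square_iff[symmetric])
        have "q * N \<le> 1 * N" using q N by (intro mult_right_mono) auto
        then show "exp \<bar>q * c 1 b\<bar> \<le> exp N" using 1 by simp
      qed auto
      finally show "exp (r s * c s b) - 1 \<le> q * c 1 b + q\<^sup>2 * (N\<^sup>2 * exp N)" by (simp add: power_mult_distrib mult.assoc)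
    qed
    also have "\<dots> = q * x + q\<^sup>2 * (N\<^sup>2 * exp N)" using int_c1 \<eta>.prob_space by (simp add: x_def)
    finally have "ln (Z s) \<le> q * x + q\<^sup>2 * (N\<^sup>2 * exp N)" using ln_le_minus_one[OF Zpos[of s]] s by simp
    then have "ln (Z s) / q \<le> (q * x + q\<^sup>2 * (N\<^sup>2 * exp N)) / q" using q by (intro divide_right_mono) auto
    also have "\<dots> = x + q * (N\<^sup>2 * exp N)" using q by (simp add: field_simps power2_eq_square)
    also have "ln (Z s) / q = G s" by (simp add: G_def q_def mult_ac)
    finally show ?thesis by (simp add: q_def)
  qed
  have Gx: "G t \<le> x" if t: "0 < t" "t < 1" for t
  proof (rule tendsto_lowerbound)
    show "((\<lambda>s. x + (1 - s) * (N\<^sup>2 * exp N / \<epsilon>)) \<longlongrightarrow> x) (at_left 1)"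
      using \<epsilon> by (auto intro!: tendsto_eq_intros)
    show "\<forall>\<^sub>F s in at_left 1. G t \<le> x + (1 - s) * (N\<^sup>2 * exp N / \<epsilon>)"
    proof -
      have "\<forall>\<^sub>F s in at_left (1::real). max t (1 - \<epsilon>) < s \<and> s < 1"
        using t \<epsilon> by (intro eventually_at_leftI[of "max t (1 - \<epsilon>)"]) auto
      then show ?thesis
      proof eventually_elim
        case (elim s)
        then have "G t \<le> G s" using t by (intro mono) auto
        also have "\<dots> \<le> x + (1 - s) * (N\<^sup>2 * exp N / \<epsilon>)" using elim t \<epsilon> by (intro up) auto
        finally show ?case .
      qed
    qed
  qed simp
  define K where "K b = I f b / I (\<lambda>_. 1) b" for b
  have [measurable]: "K \<in> borel_measurable \<eta>" unfolding K_def by measurable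
  have KN: "\<bar>K b\<bar> \<le> N" for b using abs_c'_le[of 0 b] by (simp add: c'_def K_def)
  have KN': "\<bar>K b / \<epsilon>\<bar> \<le> N / \<epsilon>" for b using KN[of b] \<epsilon> by (simp add: divide_right_mono)
  define E where "E = (\<integral>b. exp (K b / \<epsilon>) \<partial>\<eta>)"
  have intE: "integrable \<eta> (\<lambda>b. exp (K b / \<epsilon>))"
    using exp_le_exp_if_abs_le[OF KN'] by (intro \<eta>.integrable_const_bound[of _ "exp (N / \<epsilon>)"] AE_I2) auto
  have Epos: "0 < E"
  proof -
    have "(\<integral>b. exp (- (N / \<epsilon>)) \<partial>\<eta>) \<le> E"
      unfolding E_def
    proof (intro integral_mono intE)
      fix b
      have "- N \<le> K b" using KN[of b] by linarith
      then have "- N / \<epsilon> \<le> K b / \<epsilon>" using \<epsilon> by (intro divide_right_mono) auto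
      then show "exp (- (N / \<epsilon>)) \<le> exp (K b / \<epsilon>)" by simp
    qed simp
    then have "exp (- (N / \<epsilon>)) \<le> E" using \<eta>.prob_space by simp
    then show ?thesis by (rule less_le_trans[OF exp_gt_zero])
  qed
  have lower: "\<epsilon> * ln E \<le> (1 - t) * x + t * N" if t: "0 < t" "t < 1" for t
  proof -
    have "E \<le> (\<integral>b. exp (t * N / \<epsilon>) * exp (r t * c t b) \<partial>\<eta>)"
      unfolding E_def
    proof (intro integral_mono intE)
      show "integrable \<eta> (\<lambda>b. exp (t * N / \<epsilon>) * exp (r t * c t b))" using int_erc t by simp
      fix b
      have "r t * (t * K b) \<le> r t * c t b" using jensen_c[of t b, folded K_def] r0[of t] t by (intro mult_left_mono) auto
      then have 1: "(1 - t) * K b / \<epsilon> \<le> r t * c t b" using t \<epsilon> by (simp add: r_def)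
      have 2: "t * K b / \<epsilon> \<le> t * N / \<epsilon>" using KN[of b] t \<epsilon> by (intro divide_right_mono mult_left_mono) (auto simp: abs_le_iff)
      have "K b / \<epsilon> = t * K b / \<epsilon> + (1 - t) * K b / \<epsilon>" unfolding add_divide_distrib[symmetric] by (simp add: left_diff_distrib)
      then have "K b / \<epsilon> \<le> t * N / \<epsilon> + r t * c t b" using 1 2 by linarith
      then show "exp (K b / \<epsilon>) \<le> exp (t * N / \<epsilon>) * exp (r t * c t b)" by (simp add: exp_add[symmetric])
    qed
    also have "\<dots> = exp (t * N / \<epsilon>) * Z t" by (simp add: Z_def)
    finally have "ln E \<le> ln (exp (t * N / \<epsilon>) * Z t)" using Epos Zpos[of t] t by simp
    also have "\<dots> = t * N / \<epsilon> + ln (Z t)" using Zpos[of t] t by (simp add: ln_mult)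
    finally have "\<epsilon> * ln E \<le> t * N + \<epsilon> * ln (Z t)" using \<epsilon> by (simp add: field_simps)
    moreover have "\<epsilon> * ln (Z t) \<le> (1 - t) * x" using Gx[OF t] t by (simp add: G_def field_simps)
    ultimately show ?thesis by linarith
  qed
  have "\<epsilon> * ln E \<le> x"
  proof (rule tendsto_lowerbound)
    show "((\<lambda>t. (1 - t) * x + t * N) \<longlongrightarrow> x) (at_right 0)"
      by (auto intro!: tendsto_eq_intros)
    show "\<forall>\<^sub>F t in at_right 0. \<epsilon> * ln E \<le> (1 - t) * x + t * N"
      using lower by (intro eventually_at_rightI[of 0 1]) auto
  qed simp
  then show ?thesis by (simp add: E_def K_def x_def \<epsilon>_def)
qed

end

end

lemma geo_dom_exp:
  assumes t: "0 < t" "t < 1" and le: "(1 - t) * p + t * q \<le> z"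
  shows "geo_dom t (ennreal (exp p)) (ennreal (exp q)) (ennreal (exp z))"
  unfolding geo_dom_def
proof (intro allI impI, elim conjE)
  fix r s :: real assume rs: "0 < r" "0 < s" "ennreal r < ennreal (exp p)" "ennreal s < ennreal (exp q)"
  then have "r \<le> exp p" "s \<le> exp q" by (auto simp: ennreal_less_iff)
  then have "r powr (1 - t) * s powr t \<le> exp p powr (1 - t) * exp q powr t"
    using rs t by (intro mult_mono powr_mono2) auto
  also have "\<dots> = exp ((1 - t) * p + t * q)" by (simp add: powr_def exp_add mult.commute)
  also have "\<dots> \<le> exp z" using le by simp
  finally show "ennreal (r powr (1 - t) * s powr t) \<le> ennreal (exp z)" by (rule ennreal_leI)
qed

lemma prekopa_leindler_exp:
  fixes p q z :: "'a::euclidean_space \<Rightarrow> real"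
  assumes [measurable]: "p \<in> borel_measurable borel" "q \<in> borel_measurable borel" "z \<in> borel_measurable borel"
    and t: "0 < t" "t < 1"
    and int: "integrable lborel (\<lambda>x. exp (p x))" "integrable lborel (\<lambda>x. exp (q x))" "integrable lborel (\<lambda>x. exp (z x))"
    and pos: "0 < (\<integral>x. exp (p x) \<partial>lborel)" "0 < (\<integral>x. exp (q x) \<partial>lborel)"
    and le: "\<And>x y. (1 - t) * p x + t * q y \<le> z ((1 - t) *\<^sub>R x + t *\<^sub>R y)"
  shows "(1 - t) * ln (\<integral>x. exp (p x) \<partial>lborel) + t * ln (\<integral>x. exp (q x) \<partial>lborel) \<le> ln (\<integral>x. exp (z x) \<partial>lborel)"
proof -
  define P Q Z where "P = (\<integral>x. exp (p x) \<partial>lborel)" and "Q = (\<integral>x. exp (q x) \<partial>lborel)" and "Z = (\<integral>x. exp (z x) \<partial>lborel)"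
  have nn: "(\<integral>\<^sup>+x. ennreal (exp (p x)) \<partial>lborel) = ennreal P" "(\<integral>\<^sup>+x. ennreal (exp (q x)) \<partial>lborel) = ennreal Q"
    "(\<integral>\<^sup>+x. ennreal (exp (z x)) \<partial>lborel) = ennreal Z"
    unfolding P_def Q_def Z_def using int by (auto intro!: nn_integral_eq_integral)
  have dom: "geo_dom t (ennreal P) (ennreal Q) (ennreal Z)"
    unfolding nn[symmetric] by (rule prekopa_leindler[OF _ _ _ t]) (auto intro!: geo_dom_exp[OF t le])
  have P: "0 < P" and Q: "0 < Q" using pos by (simp_all add: P_def Q_def)
  have Z0: "0 \<le> Z" unfolding Z_def by (intro Bochner_Integration.integral_nonneg) simp
  have d: "(k * P) powr (1 - t) * (k * Q) powr t \<le> Z" if "0 < k" "k < 1" for k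
  proof -
    have "ennreal (k * P) < ennreal P" "ennreal (k * Q) < ennreal Q"
      using that P Q by (auto intro!: ennreal_lessI)
    then have "ennreal ((k * P) powr (1 - t) * (k * Q) powr t) \<le> ennreal Z"
      using dom that P Q unfolding geo_dom_def by auto
    then show ?thesis using Z0 by simp
  qed
  have "k * (P powr (1 - t) * Q powr t) \<le> Z" if "0 < k" "k < 1" for k
  proof -
    have "k powr (1 - t) * k powr t = k" using that by (simp add: powr_add[symmetric])
    then have "(k * P) powr (1 - t) * (k * Q) powr t = k * (P powr (1 - t) * Q powr t)"
      using that P Q by (simp add: powr_mult)
    then show ?thesis using d[OF that] by simp
  qed
  then have "P powr (1 - t) * Q powr t \<le> Z"
    by (rule field_le_mult_one_interval)
  then have "ln (P powr (1 - t) * Q powr t) \<le> ln Z" using P Q by (intro ln_mono) auto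
  then show ?thesis using P Q by (simp add: P_def[symmetric] Q_def[symmetric] Z_def[symmetric] ln_mult ln_powr)
qed

text \<open>The dual form of Talagrand's transport inequality for a strongly log-concave measure: Prekopa-Leindler
  with weights \<open>1 - t\<close>, \<open>t\<close>, to first order in \<open>t\<close>.\<close>

lemma dual_transport_if_strongly_convex:
  fixes V \<phi>\<^sub>1 \<phi>\<^sub>2 :: "real^'d \<Rightarrow> real"
  assumes [measurable]: "V \<in> borel_measurable borel" "\<phi>\<^sub>1 \<in> borel_measurable borel" "\<phi>\<^sub>2 \<in> borel_measurable borel"
    and prob: "prob_space (gibbs V)" and bd: "\<And>x. \<bar>\<phi>\<^sub>1 x\<bar> \<le> N" "\<And>x. \<bar>\<phi>\<^sub>2 x\<bar> \<le> N"
    and a: "0 < a" and \<sigma>: "0 < \<sigma>"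
    and V: "\<And>x y t. 0 \<le> t \<Longrightarrow> t \<le> 1 \<Longrightarrow>
      V ((1 - t) *\<^sub>R x + t *\<^sub>R y) \<le> (1 - t) * V x + t * V y - a / 2 * (t * (1 - t)) * (norm (x - y))\<^sup>2"
    and cost: "\<And>x y. \<phi>\<^sub>2 x - \<phi>\<^sub>1 y \<le> \<sigma> / 2 * (norm (y - x))\<^sup>2"
  shows "\<sigma> / a * ln (\<integral>x. exp (\<phi>\<^sub>2 x / (\<sigma> / a)) \<partial>gibbs V) \<le> (\<integral>x. \<phi>\<^sub>1 x \<partial>gibbs V)"
proof -
  interpret prob_space "gibbs V" by fact
  define \<epsilon> where "\<epsilon> = \<sigma> / a"
  have \<epsilon>: "0 < \<epsilon>" using a \<sigma> by (simp add: \<epsilon>_def)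
  have [measurable_cong]: "sets (gibbs V) = sets borel" by (simp add: gibbs_def)
  have eq: "(\<integral>x. h x \<partial>gibbs V) = (\<integral>x. exp (- V x) * h x \<partial>lborel)" if [measurable]: "h \<in> borel_measurable borel" for h :: "_ \<Rightarrow> real"
    unfolding gibbs_def by (subst integral_real_density) auto
  have eqi: "integrable (gibbs V) h \<longleftrightarrow> integrable lborel (\<lambda>x. exp (- V x) * h x)" if [measurable]: "h \<in> borel_measurable borel" for h :: "_ \<Rightarrow> real"
    unfolding gibbs_def by (subst integrable_real_density) auto
  have bint: "integrable (gibbs V) h" if [measurable]: "h \<in> borel_measurable borel" and "\<And>x. \<bar>h x\<bar> \<le> C" for h :: "_ \<Rightarrow> real" and C
    using that by (intro integrable_const_bound[of _ C]) auto
  have ebd: "\<bar>exp (k * \<phi>\<^sub>1 x)\<bar> \<le> exp (\<bar>k\<bar> * N)" "\<bar>exp (k * \<phi>\<^sub>2 x)\<bar> \<le> exp (\<bar>k\<bar> * N)" for k x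
  proof -
    have "\<bar>k * \<phi>\<^sub>1 x\<bar> \<le> \<bar>k\<bar> * N" "\<bar>k * \<phi>\<^sub>2 x\<bar> \<le> \<bar>k\<bar> * N" unfolding abs_mult using bd[of x] by (auto intro: mult_left_mono)
    then show "\<bar>exp (k * \<phi>\<^sub>1 x)\<bar> \<le> exp (\<bar>k\<bar> * N)" "\<bar>exp (k * \<phi>\<^sub>2 x)\<bar> \<le> exp (\<bar>k\<bar> * N)" by auto
  qed
  have Epos: "0 < expectation (\<lambda>x. exp (h x))" if [measurable]: "h \<in> borel_measurable borel" and h: "\<And>x. \<bar>h x\<bar> \<le> C" for h :: "_ \<Rightarrow> real" and C
  proof -
    have "expectation (\<lambda>x. exp (- C)) \<le> expectation (\<lambda>x. exp (h x))"
    proof (rule integral_mono)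
      show "integrable (gibbs V) (\<lambda>x. exp (h x))" using h by (intro bint[of _ "exp C"]) (auto simp: abs_le_iff)
      show "exp (- C) \<le> exp (h x)" for x using h[of x] by (simp add: abs_le_iff)
    qed simp
    then have "exp (- C) \<le> expectation (\<lambda>x. exp (h x))" using prob_space by simp
    then show ?thesis by (rule less_le_trans[OF exp_gt_zero])
  qed
  have N: "0 \<le> N" using bd(1)[of 0] by linarith
  have bdk: "\<bar>k * \<phi>\<^sub>1 x\<bar> \<le> \<bar>k\<bar> * N" "\<bar>k * \<phi>\<^sub>2 x\<bar> \<le> \<bar>k\<bar> * N" for k x
    unfolding abs_mult using bd[of x] by (auto intro: mult_left_mono)
  have main: "ln (expectation (\<lambda>x. exp ((1 - t) / \<epsilon> * \<phi>\<^sub>2 x))) \<le> (1 - t) / \<epsilon> * expectation \<phi>\<^sub>1"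
    if t: "0 < t" "t < 1" for t
  proof -
    define s where "s = 1 - t"
    have s: "0 < s" using t by (simp add: s_def)
    have ex: "exp (k * h x - V x) = exp (- V x) * exp (k * h x)" for k and h :: "_ \<Rightarrow> real" and x by (simp add: exp_diff exp_minus field_simps)
    \<comment> \<open>Prekopa-Leindler with the weight \<open>t\<close> on \<open>\<phi>\<^sub>2\<close>\<close>
    have "(1 - s) * ln (\<integral>x. exp (s / \<epsilon> * \<phi>\<^sub>2 x - V x) \<partial>lborel) + s * ln (\<integral>x. exp (- (t / \<epsilon>) * \<phi>\<^sub>1 x - V x) \<partial>lborel)
        \<le> ln (\<integral>x. exp (- V x) \<partial>lborel)"
    proof (rule prekopa_leindler_exp)
      show "0 < s" "s < 1" using t by (auto simp: s_def)
      show "integrable lborel (\<lambda>x. exp (s / \<epsilon> * \<phi>\<^sub>2 x - V x))"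
        unfolding ex by (subst eqi[symmetric], measurable, rule bint[OF _ ebd(2)], measurable)
      show "integrable lborel (\<lambda>x. exp (- (t / \<epsilon>) * \<phi>\<^sub>1 x - V x))"
        unfolding ex by (subst eqi[symmetric], measurable, rule bint[OF _ ebd(1)], measurable)
      show "integrable lborel (\<lambda>x. exp (- V x))"
        using eqi[of "\<lambda>_. 1"] by simp
      show "0 < (\<integral>x. exp (s / \<epsilon> * \<phi>\<^sub>2 x - V x) \<partial>lborel)"
        unfolding ex by (subst eq[symmetric], measurable, rule Epos[OF _ bdk(2)], measurable)
      show "0 < (\<integral>x. exp (- (t / \<epsilon>) * \<phi>\<^sub>1 x - V x) \<partial>lborel)"
        unfolding ex by (subst eq[symmetric], measurable, rule Epos[OF _ bdk(1)], measurable)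
      fix x y
      have "(1 - s) * (s / \<epsilon> * \<phi>\<^sub>2 x) + s * (- (t / \<epsilon>) * \<phi>\<^sub>1 y) = s * t / \<epsilon> * (\<phi>\<^sub>2 x - \<phi>\<^sub>1 y)"
        using \<epsilon> by (simp add: s_def field_simps)
      also have "\<dots> \<le> s * t / \<epsilon> * (\<sigma> / 2 * (norm (y - x))\<^sup>2)"
        using s t \<epsilon> by (intro mult_left_mono cost) auto
      also have "\<dots> = a / 2 * (s * (1 - s)) * (norm (x - y))\<^sup>2"
        using a \<sigma> by (simp add: \<epsilon>_def s_def norm_minus_commute)
      finally have "(1 - s) * (s / \<epsilon> * \<phi>\<^sub>2 x) + s * (- (t / \<epsilon>) * \<phi>\<^sub>1 y) \<le> a / 2 * (s * (1 - s)) * (norm (x - y))\<^sup>2" .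
      moreover have "V ((1 - s) *\<^sub>R x + s *\<^sub>R y) \<le> (1 - s) * V x + s * V y - a / 2 * (s * (1 - s)) * (norm (x - y))\<^sup>2"
        using s t by (intro V) (auto simp: s_def)
      ultimately show "(1 - s) * (s / \<epsilon> * \<phi>\<^sub>2 x - V x) + s * (- (t / \<epsilon>) * \<phi>\<^sub>1 y - V y) \<le> - V ((1 - s) *\<^sub>R x + s *\<^sub>R y)"
        unfolding right_diff_distrib by linarith
    qed measurable
    also have "(\<integral>x. exp (- V x) \<partial>lborel) = 1" using eq[of "\<lambda>_. 1"] prob_space by simp
    finally have "t * ln (expectation (\<lambda>x. exp (s / \<epsilon> * \<phi>\<^sub>2 x))) + s * ln (expectation (\<lambda>x. exp (- (t / \<epsilon>) * \<phi>\<^sub>1 x))) \<le> 0"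
      unfolding ex by (simp add: eq s_def)
    moreover have "- (t / \<epsilon>) * expectation \<phi>\<^sub>1 \<le> ln (expectation (\<lambda>x. exp (- (t / \<epsilon>) * \<phi>\<^sub>1 x)))"
    proof -
      have i: "integrable (gibbs V) (\<lambda>x. - (t / \<epsilon>) * \<phi>\<^sub>1 x)" by (rule bint[OF _ bdk(1)]) measurable
      have "exp (expectation (\<lambda>x. - (t / \<epsilon>) * \<phi>\<^sub>1 x)) \<le> expectation (\<lambda>x. exp (- (t / \<epsilon>) * \<phi>\<^sub>1 x))"
        using ebd(1)[of "- (t / \<epsilon>)"]
        by (intro jensens_inequality[OF i, where I = UNIV] bint[of _ "exp (\<bar>- (t / \<epsilon>)\<bar> * N)"]) (auto intro: exp_convex)
      then have "ln (exp (expectation (\<lambda>x. - (t / \<epsilon>) * \<phi>\<^sub>1 x))) \<le> ln (expectation (\<lambda>x. exp (- (t / \<epsilon>) * \<phi>\<^sub>1 x)))"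
        by (intro ln_mono) (auto intro: less_le_trans[OF exp_gt_zero])
      then show ?thesis by simp
    qed
    ultimately have "t * ln (expectation (\<lambda>x. exp (s / \<epsilon> * \<phi>\<^sub>2 x))) + s * (- (t / \<epsilon>) * expectation \<phi>\<^sub>1) \<le> 0"
      using mult_left_mono[of "- (t / \<epsilon>) * expectation \<phi>\<^sub>1" "ln (expectation (\<lambda>x. exp (- (t / \<epsilon>) * \<phi>\<^sub>1 x)))" s] s by linarith
    then have "t * ln (expectation (\<lambda>x. exp (s / \<epsilon> * \<phi>\<^sub>2 x))) \<le> t * (s / \<epsilon> * expectation \<phi>\<^sub>1)" by (simp add: mult_ac)
    then show ?thesis by (simp only: mult_le_cancel_left_pos[OF t(1)] s_def)
  qed
  have "\<epsilon> * ln (expectation (\<lambda>x. exp (\<phi>\<^sub>2 x / \<epsilon>))) \<le> expectation \<phi>\<^sub>1"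
  proof (rule tendsto_lowerbound)
    show "((\<lambda>t. (1 - t) * expectation \<phi>\<^sub>1 + t * N) \<longlongrightarrow> expectation \<phi>\<^sub>1) (at_right 0)"
      by (auto intro!: tendsto_eq_intros)
    have "\<epsilon> * ln (expectation (\<lambda>x. exp (\<phi>\<^sub>2 x / \<epsilon>))) \<le> (1 - t) * expectation \<phi>\<^sub>1 + t * N" if t: "0 < t" "t < 1" for t
    proof -
      have b: "\<bar>\<phi>\<^sub>2 x / \<epsilon>\<bar> \<le> N / \<epsilon>" for x using bd(2)[of x] \<epsilon> by (simp add: divide_right_mono)
      have "expectation (\<lambda>x. exp (\<phi>\<^sub>2 x / \<epsilon>)) \<le> expectation (\<lambda>x. exp (t * N / \<epsilon>) * exp ((1 - t) / \<epsilon> * \<phi>\<^sub>2 x))"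
      proof (rule integral_mono)
        show "integrable (gibbs V) (\<lambda>x. exp (\<phi>\<^sub>2 x / \<epsilon>))" using abs_le_D1[OF b] by (intro bint[of _ "exp (N / \<epsilon>)"]) auto
        show "integrable (gibbs V) (\<lambda>x. exp (t * N / \<epsilon>) * exp ((1 - t) / \<epsilon> * \<phi>\<^sub>2 x))"
          by (intro integrable_mult_right bint[OF _ ebd(2)]) auto
        fix x
        have "t * \<phi>\<^sub>2 x / \<epsilon> \<le> t * N / \<epsilon>" using bd(2)[of x] t \<epsilon> by (intro divide_right_mono mult_left_mono) (auto simp: abs_le_iff)
        moreover have "\<phi>\<^sub>2 x / \<epsilon> = t * \<phi>\<^sub>2 x / \<epsilon> + (1 - t) / \<epsilon> * \<phi>\<^sub>2 x" using \<epsilon> by (simp add: field_simps)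
        ultimately show "exp (\<phi>\<^sub>2 x / \<epsilon>) \<le> exp (t * N / \<epsilon>) * exp ((1 - t) / \<epsilon> * \<phi>\<^sub>2 x)" by (simp add: exp_add[symmetric])
      qed
      also have "\<dots> = exp (t * N / \<epsilon>) * expectation (\<lambda>x. exp ((1 - t) / \<epsilon> * \<phi>\<^sub>2 x))" by simp
      finally have "ln (expectation (\<lambda>x. exp (\<phi>\<^sub>2 x / \<epsilon>))) \<le> ln (exp (t * N / \<epsilon>) * expectation (\<lambda>x. exp ((1 - t) / \<epsilon> * \<phi>\<^sub>2 x)))"
        using Epos[of "\<lambda>x. \<phi>\<^sub>2 x / \<epsilon>", OF _ b] by (intro ln_mono) auto
      also have "\<dots> = t * N / \<epsilon> + ln (expectation (\<lambda>x. exp ((1 - t) / \<epsilon> * \<phi>\<^sub>2 x)))"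
        using Epos[of "\<lambda>x. (1 - t) / \<epsilon> * \<phi>\<^sub>2 x", OF _ bdk(2)] by (simp add: ln_mult)
      also have "\<dots> \<le> t * N / \<epsilon> + (1 - t) / \<epsilon> * expectation \<phi>\<^sub>1" using main[OF t] by simp
      finally show ?thesis using \<epsilon> by (simp add: field_simps)
    qed
    then show "\<forall>\<^sub>F t in at_right 0. \<epsilon> * ln (expectation (\<lambda>x. exp (\<phi>\<^sub>2 x / \<epsilon>))) \<le> (1 - t) * expectation \<phi>\<^sub>1 + t * N"
      by (intro eventually_at_rightI[of 0 1]) auto
  qed simp
  then show ?thesis by (simp add: \<epsilon>_def)
qed

lemma grad_linear: "grad (\<lambda>a. e \<bullet> (A *v a) + d) x = transpose A *v e" for A :: "real^'d^'d"
proof -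
  have "((\<lambda>a. e \<bullet> (A *v a) + d) has_derivative (\<lambda>h. e \<bullet> (A *v h))) (at x)"
    by (auto intro!: derivative_eq_intros bounded_linear_imp_has_derivative matrix_vector_mul_bounded_linear)
  then have "frechet_derivative (\<lambda>a. e \<bullet> (A *v a) + d) (at x) = (\<lambda>h. (transpose A *v e) \<bullet> h)"
    by (simp add: frechet_derivative_at[symmetric] transpose_inner)
  then show ?thesis by (simp add: grad_def vec_eq_iff inner_axis)
qed

context tilted_family
begin

lemma exp_L: "exp (L b) = I (\<lambda>_. 1) b"
  by (simp add: L_def I_one_pos)

definition kernel :: "real^'d \<Rightarrow> (real^'d) measure" where
  "kernel b = gibbs (\<lambda>a. B a + L b - b \<bullet> (M *v a))"

lemma kernel_eq: "kernel b = density lborel (\<lambda>a. ennreal (wt b a / I (\<lambda>_. 1) b))"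
proof -
  have "exp (- (B a + L b - b \<bullet> (M *v a))) = wt b a / I (\<lambda>_. 1) b" for a
    by (simp add: exp_L[symmetric] wt_def exp_diff[symmetric] algebra_simps)
  then show ?thesis by (simp add: kernel_def gibbs_def)
qed

lemma integral_kernel:
  assumes [measurable]: "h \<in> borel_measurable borel"
  shows "(\<integral>a. h a \<partial>kernel b) = I h b / I (\<lambda>_. 1) b"
    and "integrable (kernel b) h \<longleftrightarrow> integrable lborel (\<lambda>a. h a * wt b a)"
proof -
  have pos: "AE a in lborel. 0 \<le> wt b a / I (\<lambda>_. 1) b"
    using wt_pos[of b] I_one_pos[of b] by (auto intro!: less_imp_le)
  show "(\<integral>a. h a \<partial>kernel b) = I h b / I (\<lambda>_. 1) b"
    unfolding kernel_eq by (subst integral_real_density[OF _ pos]) (auto simp: I_def mult.commute)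
  show "integrable (kernel b) h \<longleftrightarrow> integrable lborel (\<lambda>a. h a * wt b a)"
    unfolding kernel_eq using I_one_pos[of b]
  proof (subst integrable_real_density[OF _ pos])
    have "wt b a / I (\<lambda>_. 1) b * h a = h a * wt b a * inverse (I (\<lambda>_. 1) b)" for a
      by (simp add: divide_inverse)
    then show "integrable lborel (\<lambda>a. wt b a / I (\<lambda>_. 1) b * h a) \<longleftrightarrow> integrable lborel (\<lambda>a. h a * wt b a)"
      using I_one_pos[of b] by simp
  qed measurable
qed

lemma prob_space_kernel: "prob_space (kernel b)"
proof -
  have "(\<integral>\<^sup>+a. ennreal (wt b a / I (\<lambda>_. 1) b) \<partial>lborel) = ennreal (\<integral>a. wt b a / I (\<lambda>_. 1) b \<partial>lborel)"
    using wt_pos[of b] I_one_pos[of b] integrable_wt[of b] by (intro nn_integral_eq_integral) (auto intro!: less_imp_le)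
  also have "\<dots> = 1" using I_one_pos[of b] by (simp add: I_def)
  finally show ?thesis unfolding kernel_eq
    by (intro prob_spaceI) (simp add: emeasure_density cong: nn_integral_cong)
qed

lemma subgaussian_if_log_sobolev:
  assumes ls: "\<And>b. log_sobolev (kernel b) \<rho>" and \<rho>: "0 < \<rho>"
  shows "subgaussian (\<rho> * (spec_norm M)\<^sup>2)"
  unfolding subgaussian_def
proof (intro allI)
  fix b b' :: "real^'d"
  define d where "d = L b' - L b"
  let ?g = "\<lambda>a. (b - b') \<bullet> (M *v a) + d"
  have sets: "sets (kernel b') = sets borel" by (simp add: kernel_eq)
  have w: "exp (?g a) * wt b' a / I (\<lambda>_. 1) b' = wt b a / I (\<lambda>_. 1) b" for a
    using wt_add[of b' "b - b'" a] by (simp add: d_def exp_L[symmetric] exp_add exp_diff)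
  have I_eg: "I (\<lambda>a. exp (?g a) * h a) b' / I (\<lambda>_. 1) b' = I h b / I (\<lambda>_. 1) b" for h
  proof -
    have "I (\<lambda>a. exp (?g a) * h a) b' / I (\<lambda>_. 1) b' = (\<integral>a. h a * (exp (?g a) * wt b' a / I (\<lambda>_. 1) b') \<partial>lborel)"
      by (simp add: I_def mult_ac)
    also have "\<dots> = I h b / I (\<lambda>_. 1) b" unfolding w by (simp add: I_def)
    finally show ?thesis .
  qed
  have [measurable]: "?g \<in> borel_measurable borel" by measurable
  have eg_int: "integrable lborel (\<lambda>a. exp (?g a) * wt b' a)"
  proof -
    have "exp (?g a) * wt b' a = I (\<lambda>_. 1) b' / I (\<lambda>_. 1) b * wt b a" for a
      using w[of a] I_one_pos[of b'] by (simp add: field_simps)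
    then show ?thesis by (simp add: integrable_wt)
  qed
  let ?R = "(norm (transpose M *v (b - b')))\<^sup>2"
  have "(\<integral>a. exp (?g a) * ?g a \<partial>kernel b') \<le> \<rho> / 2 * (\<integral>a. exp (?g a) * ?R \<partial>kernel b')"
  proof (rule log_sobolev_density(2)[OF ls prob_space_kernel sets \<rho>])
    show "?g differentiable (at x)" for x
      unfolding differentiable_def
      by (rule exI) (auto intro!: derivative_eq_intros bounded_linear_imp_has_derivative matrix_vector_mul_bounded_linear)
    show "integrable (kernel b') (\<lambda>a. exp (?g a))"
      using eg_int by (subst integral_kernel(2)) auto
    show "(\<integral>a. exp (?g a) \<partial>kernel b') = 1"
      using I_eg[of "\<lambda>_. 1"] I_one_pos[of b] by (subst integral_kernel(1)) auto
    show "(norm (grad ?g x))\<^sup>2 \<le> ?R" for x by (simp add: grad_linear)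
    show "integrable (kernel b') (\<lambda>a. exp (?g a) * ?R)"
      using integrable_mult_right[OF eg_int, of ?R] by (subst integral_kernel(2)) (auto simp: mult_ac)
  qed
  also have "(\<integral>a. exp (?g a) * ?g a \<partial>kernel b') = (b - b') \<bullet> mean b + d"
  proof -
    have "(\<integral>a. exp (?g a) * ?g a \<partial>kernel b') = I ?g b / I (\<lambda>_. 1) b"
      by (subst integral_kernel(1)) (use I_eg[of ?g] in auto)
    also have "I ?g b = (b - b') \<bullet> J (\<lambda>_. 1) b + d * I (\<lambda>_. 1) b"
      using inner_J[of "\<lambda>_. 1" 1 "b - b'" b] integrable_inner_J[of "\<lambda>_. 1" 1 "b - b'" b] integrable_wt[of b]
      by (simp add: I_def distrib_right)
    finally show ?thesis using I_one_pos[of b] by (simp add: mean_def divide_inverse mult.commute distrib_left)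
  qed
  also have "(\<integral>a. exp (?g a) * ?R \<partial>kernel b') = ?R"
    using I_eg[of "\<lambda>_. ?R"] I_one_pos[of b] I_cmult[of ?R "\<lambda>_. 1" b] by (subst integral_kernel(1)) auto
  also have "\<rho> / 2 * ?R \<le> \<rho> / 2 * (spec_norm M * norm (b' - b))\<^sup>2"
    using norm_transpose_mult_le[of M "b - b'"] \<rho>
    by (intro mult_left_mono power_mono) (auto simp: norm_minus_commute)
  finally show "L b' - L b - (b' - b) \<bullet> mean b \<le> \<rho> * (spec_norm M)\<^sup>2 / 2 * (norm (b' - b))\<^sup>2"
    by (simp add: d_def inner_diff_left power_mult_distrib)
qed

lemma subgaussian_if_strongly_convex:
  assumes a: "0 < a" and cv: "\<And>x y t. 0 \<le> t \<Longrightarrow> t \<le> 1 \<Longrightarrow>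
      B ((1 - t) *\<^sub>R x + t *\<^sub>R y) \<le> (1 - t) * B x + t * B y - a / 2 * (t * (1 - t)) * (norm (x - y))\<^sup>2"
  shows "subgaussian ((spec_norm M)\<^sup>2 / a)"
  unfolding subgaussian_def
proof (intro allI)
  fix b b' :: "real^'d"
  define e where "e = b' - b"
  define C where "C = (spec_norm M * norm e)\<^sup>2 / (2 * a)"
  have step: "L b' - L b \<le> (L (b + t *\<^sub>R e) - L b) / t + (1 - t) * C" if t: "0 < t" "t < 1" for t
  proof -
    have i: "integrable lborel (\<lambda>x. exp (b \<bullet> (M *v x) - B x))" for b using integrable_wt[of b] by (simp add: wt_def[abs_def])
    have Lx: "L b = ln (\<integral>x. exp (b \<bullet> (M *v x) - B x) \<partial>lborel)" for b by (simp add: L_def I_def wt_def)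
    have p: "0 < (\<integral>x. exp (b \<bullet> (M *v x) - B x) \<partial>lborel)" for b using I_one_pos[of b] by (simp add: I_def wt_def)
    have "(1 - t) * L b + t * L b' \<le> ln (\<integral>x. exp ((b + t *\<^sub>R e) \<bullet> (M *v x) - B x + t * (1 - t) * C) \<partial>lborel)"
      unfolding Lx
    proof (rule prekopa_leindler_exp[OF _ _ _ t i i _ p p])
      show "integrable lborel (\<lambda>x. exp ((b + t *\<^sub>R e) \<bullet> (M *v x) - B x + t * (1 - t) * C))"
        using i[of "b + t *\<^sub>R e"] by (simp add: exp_add)
      fix x y :: "real^'d"
      define v where "v = y - x"
      have "e \<bullet> (M *v v) \<le> norm (transpose M *v e) * norm v"
        unfolding transpose_inner by (rule norm_cauchy_schwarz)
      also have "\<dots> \<le> spec_norm M * norm e * norm v" by (intro mult_right_mono norm_transpose_mult_le) simp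
      also have "\<dots> \<le> C + a / 2 * (norm v)\<^sup>2"
      proof -
        have "0 \<le> (spec_norm M * norm e - a * norm v)\<^sup>2 / (2 * a)" using a by simp
        also have "\<dots> = C + a / 2 * (norm v)\<^sup>2 - spec_norm M * norm e * norm v"
          using a by (simp add: C_def power2_diff field_simps power2_eq_square)
        finally show ?thesis by simp
      qed
      finally have "t * (1 - t) * (e \<bullet> (M *v v)) \<le> t * (1 - t) * (C + a / 2 * (norm v)\<^sup>2)"
        using t by (intro mult_left_mono) auto
      then have "t * (1 - t) * (e \<bullet> (M *v v)) \<le> t * (1 - t) * C + a / 2 * (t * (1 - t)) * (norm v)\<^sup>2"
        by (simp only: distrib_left mult_ac)
      moreover have "B ((1 - t) *\<^sub>R x + t *\<^sub>R y) \<le> (1 - t) * B x + t * B y - a / 2 * (t * (1 - t)) * (norm v)\<^sup>2"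
        using cv[of t x y] t by (simp add: v_def norm_minus_commute)
      moreover have distr: "(1 - t) * (p - q) + t * (r - s) = ((1 - t) * p + t * r) - ((1 - t) * q + t * s)" for p q r s
        by (simp add: algebra_simps)
      moreover have "(1 - t) * (b \<bullet> (M *v x)) + t * (b' \<bullet> (M *v y))
        = (b + t *\<^sub>R e) \<bullet> (M *v ((1 - t) *\<^sub>R x + t *\<^sub>R y)) + t * (1 - t) * (e \<bullet> (M *v v))"
      proof -
        have b': "b' = b + e" and y: "y = x + v" by (simp_all add: e_def v_def)
        have w: "(1 - t) *\<^sub>R x + t *\<^sub>R y = x + t *\<^sub>R v" by (simp add: y algebra_simps)
        show ?thesis unfolding w b' unfolding y
          by (simp add: matrix_vector_right_distrib matrix_vector_mult_scaleR inner_add_left inner_add_right algebra_simps)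
      qed
      ultimately show "(1 - t) * (b \<bullet> (M *v x) - B x) + t * (b' \<bullet> (M *v y) - B y)
        \<le> (b + t *\<^sub>R e) \<bullet> (M *v ((1 - t) *\<^sub>R x + t *\<^sub>R y)) - B ((1 - t) *\<^sub>R x + t *\<^sub>R y) + t * (1 - t) * C"
        unfolding distr by linarith
    qed measurable
    also have "(\<integral>x. exp ((b + t *\<^sub>R e) \<bullet> (M *v x) - B x + t * (1 - t) * C) \<partial>lborel)
      = (\<integral>x. exp ((b + t *\<^sub>R e) \<bullet> (M *v x) - B x) \<partial>lborel) * exp (t * (1 - t) * C)"
      by (simp add: exp_add)
    also have "ln \<dots> = L (b + t *\<^sub>R e) + t * (1 - t) * C"
      using p[of "b + t *\<^sub>R e"] by (simp add: ln_mult Lx)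
    finally have "t * (L b' - L b) \<le> (L (b + t *\<^sub>R e) - L b) + t * (1 - t) * C" by (simp add: algebra_simps)
    then show ?thesis using t by (simp add: field_simps)
  qed
  have "(L has_derivative (\<lambda>e. e \<bullet> mean b)) (at b)"
  proof -
    have "(I (\<lambda>a. 1) has_derivative (\<lambda>e. e \<bullet> J (\<lambda>a. 1) b)) (at b)"
      by (rule has_derivative_I[where N = 1]) auto
    then show ?thesis
      unfolding L_def[abs_def] mean_def using I_one_pos[of b]
      by (auto intro!: derivative_eq_intros simp: divide_inverse mult_ac)
  qed
  then have "((\<lambda>t. L (b + t *\<^sub>R e)) has_derivative (\<lambda>t. (t *\<^sub>R e) \<bullet> mean b)) (at 0)"
    by (intro has_derivative_compose[of "\<lambda>t. b + t *\<^sub>R e", where g = L]) (auto intro!: derivative_eq_intros)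
  then have "((\<lambda>t. L (b + t *\<^sub>R e)) has_real_derivative e \<bullet> mean b) (at 0)"
    by (simp add: has_field_derivative_def mult_commute_abs)
  then have lim: "((\<lambda>t. (L (b + t *\<^sub>R e) - L b) / t) \<longlongrightarrow> e \<bullet> mean b) (at 0)"
    by (simp add: has_field_derivative_iff)
  have "L b' - L b \<le> e \<bullet> mean b + C"
  proof (rule tendsto_lowerbound)
    show "((\<lambda>t. (L (b + t *\<^sub>R e) - L b) / t + (1 - t) * C) \<longlongrightarrow> e \<bullet> mean b + C) (at_right 0)"
      by (rule tendsto_eq_intros tendsto_within_subset[OF lim] | simp)+
    show "\<forall>\<^sub>F t in at_right 0. L b' - L b \<le> (L (b + t *\<^sub>R e) - L b) / t + (1 - t) * C"
      using step by (intro eventually_at_rightI[of 0 1]) auto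
  qed simp
  then show "L b' - L b - (b' - b) \<bullet> mean b \<le> (spec_norm M)\<^sup>2 / a / 2 * (norm (b' - b))\<^sup>2"
    by (simp add: C_def e_def power_mult_distrib)
qed

definition dual_transport :: "(real^'d) measure \<Rightarrow> real \<Rightarrow> bool" where
  "dual_transport \<eta> \<epsilon> \<longleftrightarrow> (\<forall>f N. f \<in> borel_measurable borel \<longrightarrow> (\<forall>a. \<bar>f a\<bar> \<le> N) \<longrightarrow>
     \<epsilon> * ln (\<integral>b. exp ((\<integral>a. f a \<partial>kernel b) / \<epsilon>) \<partial>\<eta>) \<le> (\<integral>b. ln (\<integral>a. exp (f a) \<partial>kernel b) \<partial>\<eta>))"

lemma c_one_eq:
  assumes [measurable]: "f \<in> borel_measurable borel" and f: "\<And>a. \<bar>f a\<bar> \<le> N"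
  shows "c f 1 b = ln (\<integral>a. exp (f a) \<partial>kernel b)"
proof -
  have "0 < I (\<lambda>a. exp (f a)) b"
    using exp_le_exp_if_abs_le[OF f] by (intro I_pos[where N = "exp N"]) auto
  then show ?thesis
    using I_one_pos[of b] by (simp add: c_def[OF assms] L_def integral_kernel(1) ln_div)
qed

lemma dual_transport_log_sobolev:
  assumes "subgaussian \<sigma>" "0 < \<sigma>" "prob_space \<eta>" "sets \<eta> = sets borel" "log_sobolev \<eta> \<rho>" "0 < \<rho>"
  shows "dual_transport \<eta> (\<sigma> * \<rho>)"
  unfolding dual_transport_def
proof (intro allI impI)
  fix f :: "real^'d \<Rightarrow> real" and N assume f: "f \<in> borel_measurable borel" "\<forall>a. \<bar>f a\<bar> \<le> N"
  show "\<sigma> * \<rho> * ln (\<integral>b. exp ((\<integral>a. f a \<partial>kernel b) / (\<sigma> * \<rho>)) \<partial>\<eta>) \<le> (\<integral>b. ln (\<integral>a. exp (f a) \<partial>kernel b) \<partial>\<eta>)"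
    using dual_transport_if_log_sobolev[OF f(1) _ assms, of N] f c_one_eq[OF f(1), of N]
    by (simp add: integral_kernel(1))
qed

lemma dual_transport_strongly_convex:
  assumes sg: "subgaussian \<sigma>" "0 < \<sigma>" and [measurable]: "V \<in> borel_measurable borel" and V: "prob_space (gibbs V)"
    and a: "0 < a" and cv: "\<And>x y t. 0 \<le> t \<Longrightarrow> t \<le> 1 \<Longrightarrow>
      V ((1 - t) *\<^sub>R x + t *\<^sub>R y) \<le> (1 - t) * V x + t * V y - a / 2 * (t * (1 - t)) * (norm (x - y))\<^sup>2"
  shows "dual_transport (gibbs V) (\<sigma> / a)"
  unfolding dual_transport_def
proof (intro allI impI)
  fix f :: "real^'d \<Rightarrow> real" and N assume f: "f \<in> borel_measurable borel" "\<forall>a. \<bar>f a\<bar> \<le> N"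
  note [measurable] = f(1)
  have fN: "\<And>a. \<bar>f a\<bar> \<le> N" using f by blast
  have m2: "(\<lambda>b. \<integral>a. f a \<partial>kernel b) \<in> borel_measurable borel"
    unfolding integral_kernel(1)[OF f(1)]
    by (intro borel_measurable_divide measurable_I[OF f(1) fN] measurable_I[where N = 1]) auto
  have m1: "(\<lambda>b. ln (\<integral>a. exp (f a) \<partial>kernel b)) \<in> borel_measurable borel"
    using measurable_c(1)[OF f(1) fN, of 1] unfolding c_one_eq[OF f(1) fN, abs_def] .
  have cost: "(\<integral>a. f a \<partial>kernel x) - ln (\<integral>a. exp (f a) \<partial>kernel y) \<le> \<sigma> / 2 * (norm (y - x))\<^sup>2" for x y
    using tilted_cost_le[OF sg(1) f(1) fN, of x y] c_one_eq[OF f(1) fN, of y]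
    by (simp add: integral_kernel(1) c_def[OF f(1) fN])
  have b1: "\<bar>ln (\<integral>a. exp (f a) \<partial>kernel x)\<bar> \<le> N" for x
    using abs_c_le[OF f(1) fN, of 1 x] unfolding c_one_eq[OF f(1) fN] by simp
  have b2: "\<bar>\<integral>a. f a \<partial>kernel x\<bar> \<le> N" for x
    using abs_c'_le[OF f(1) fN, of 0 x] by (simp add: c'_def[OF f(1) fN] integral_kernel(1))
  show "\<sigma> / a * ln (\<integral>b. exp ((\<integral>a. f a \<partial>kernel b) / (\<sigma> / a)) \<partial>gibbs V) \<le> (\<integral>b. ln (\<integral>a. exp (f a) \<partial>kernel b) \<partial>gibbs V)"
    using dual_transport_if_strongly_convex[OF _ m1 m2 V b1 b2 a sg(2) cv cost] by simp
qed

end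

section \<open>The competitor coupling\<close>

lemma measurable_fst_snd_borel[measurable]:
  "(fst :: 'a::second_countable_topology \<times> 'b::second_countable_topology \<Rightarrow> 'a) \<in> borel \<rightarrow>\<^sub>M borel"
  "(snd :: 'a::second_countable_topology \<times> 'b::second_countable_topology \<Rightarrow> 'b) \<in> borel \<rightarrow>\<^sub>M borel"
  "(prod.swap :: 'a::second_countable_topology \<times> 'b::second_countable_topology \<Rightarrow> 'b \<times> 'a) \<in> borel \<rightarrow>\<^sub>M borel"
  by (auto intro!: borel_measurable_continuous_onI continuous_on_fst continuous_on_snd continuous_on_swap)

lemma distr_density_fst:
  fixes q :: "'a::euclidean_space \<times> 'b::euclidean_space \<Rightarrow> ennreal"
  assumes [measurable]: "q \<in> borel_measurable borel"
  shows "distr (density lborel q) borel fst = density lborel (\<lambda>a. \<integral>\<^sup>+b. q (a, b) \<partial>lborel)"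
proof (rule measure_eqI)
  have q[measurable]: "q \<in> borel_measurable (lborel \<Otimes>\<^sub>M lborel)" by (simp add: lborel_prod)
  fix A assume "A \<in> sets (distr (density lborel q) borel fst)"
  then have [measurable]: "A \<in> sets borel" by simp
  have "emeasure (distr (density lborel q) borel fst) A = (\<integral>\<^sup>+z. q z * indicator (fst -` A) z \<partial>lborel)"
    using measurable_sets[of "fst :: 'a \<times> 'b \<Rightarrow> 'a" borel borel A] by (simp add: emeasure_distr emeasure_density)
  also have "\<dots> = (\<integral>\<^sup>+z. q z * indicator A (fst z) \<partial>lborel)"
    by (auto simp: indicator_def intro!: nn_integral_cong)
  also have "\<dots> = (\<integral>\<^sup>+z. q z * indicator A (fst z) \<partial>(lborel \<Otimes>\<^sub>M lborel))" by (simp add: lborel_prod)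
  also have "\<dots> = (\<integral>\<^sup>+a. \<integral>\<^sup>+b. q (a, b) * indicator A a \<partial>lborel \<partial>lborel)"
    by (subst lborel.nn_integral_fst[symmetric]) auto
  also have "\<dots> = (\<integral>\<^sup>+a. (\<integral>\<^sup>+b. q (a, b) \<partial>lborel) * indicator A a \<partial>lborel)"
    by (simp add: nn_integral_multc)
  also have "\<dots> = emeasure (density lborel (\<lambda>a. \<integral>\<^sup>+b. q (a, b) \<partial>lborel)) A"
    by (simp add: emeasure_density)
  finally show "emeasure (distr (density lborel q) borel fst) A = emeasure (density lborel (\<lambda>a. \<integral>\<^sup>+b. q (a, b) \<partial>lborel)) A" .
qed simp

lemma distr_density_swap:
  fixes q :: "'a::euclidean_space \<times> 'b::euclidean_space \<Rightarrow> ennreal"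
  assumes [measurable]: "q \<in> borel_measurable borel"
  shows "distr (density lborel q) borel prod.swap = density lborel (\<lambda>z. q (prod.swap z))"
proof (rule measure_eqI)
  have q[measurable]: "q \<in> borel_measurable (lborel \<Otimes>\<^sub>M lborel)" by (simp add: lborel_prod)
  fix A assume "A \<in> sets (distr (density lborel q) borel prod.swap)"
  then have A[measurable]: "A \<in> sets borel" by simp
  have A'[measurable]: "A \<in> sets (lborel \<Otimes>\<^sub>M lborel)" using A by (metis lborel_prod sets_lborel)
  have "emeasure (distr (density lborel q) borel prod.swap) A = (\<integral>\<^sup>+z. q z * indicator (prod.swap -` A) z \<partial>lborel)"
    using measurable_sets[OF measurable_fst_snd_borel(3) A] by (simp add: emeasure_distr emeasure_density)
  also have "\<dots> = (\<integral>\<^sup>+z. q z * indicator A (prod.swap z) \<partial>lborel)"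
    by (auto simp: indicator_def intro!: nn_integral_cong)
  also have "\<dots> = (\<integral>\<^sup>+z. q z * indicator A (snd z, fst z) \<partial>(lborel \<Otimes>\<^sub>M lborel))" by (simp add: lborel_prod prod.swap_def)
  also have "\<dots> = (\<integral>\<^sup>+b. \<integral>\<^sup>+a. q (a, b) * indicator A (b, a) \<partial>lborel \<partial>lborel)"
    by (subst lborel_pair.nn_integral_snd[symmetric]) auto
  also have "\<dots> = (\<integral>\<^sup>+z. q (snd z, fst z) * indicator A z \<partial>(lborel \<Otimes>\<^sub>M lborel))"
    by (subst lborel.nn_integral_fst[symmetric]) auto
  also have "\<dots> = emeasure (density lborel (\<lambda>z. q (prod.swap z))) A"
    by (simp add: emeasure_density lborel_prod prod.swap_def)
  finally show "emeasure (distr (density lborel q) borel prod.swap) A = emeasure (density lborel (\<lambda>z. q (prod.swap z))) A" .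
qed simp

lemma distr_density_snd:
  fixes q :: "'a::euclidean_space \<times> 'b::euclidean_space \<Rightarrow> ennreal"
  assumes [measurable]: "q \<in> borel_measurable borel"
  shows "distr (density lborel q) borel snd = density lborel (\<lambda>b. \<integral>\<^sup>+a. q (a, b) \<partial>lborel)"
proof -
  have "distr (density lborel q) borel snd = distr (distr (density lborel q) borel prod.swap) borel fst"
    by (subst distr_distr) (auto simp: o_def)
  also have "\<dots> = density lborel (\<lambda>b. \<integral>\<^sup>+a. q (a, b) \<partial>lborel)"
    unfolding distr_density_swap[OF assms] by (subst distr_density_fst) auto
  finally show ?thesis .
qed

text \<open>\<open>\<Psi>\<close> is the nonnegative version of \<open>z ln z\<close>: it has the same integral against a probability measure for
  densities.\<close>

definition \<Psi> :: "real \<Rightarrow> real" where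
  "\<Psi> z = z * ln z - z + 1"

lemma measurable_\<Psi>[measurable]: "\<Psi> \<in> borel_measurable borel"
  unfolding \<Psi>_def by measurable

lemma \<Psi>_tangent:
  assumes "0 < z" "0 < w"
  shows "\<Psi> w + ln w * (z - w) \<le> \<Psi> z"
proof -
  have "z * ln (w / z) \<le> z * (w / z - 1)" using assms by (intro mult_left_mono ln_le_minus_one) auto
  then show ?thesis using assms by (simp add: \<Psi>_def ln_div algebra_simps)
qed

lemma \<Psi>_nonneg: "0 < z \<Longrightarrow> 0 \<le> \<Psi> z"
  using \<Psi>_tangent[of z 1] by (simp add: \<Psi>_def)

context tilted_family
begin

definition k :: "real^'d \<Rightarrow> real^'d \<Rightarrow> real" where
  "k b a = wt b a / I (\<lambda>_. 1) b"

lemma k_pos: "0 < k b a"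
  by (simp add: k_def wt_pos I_one_pos)

lemma k_eq: "k b a = exp (b \<bullet> (M *v a) - B a - L b)"
  by (simp add: k_def wt_def exp_L[symmetric] exp_diff)

lemma measurable_k[measurable (raw)]:
  assumes [measurable]: "f \<in> borel_measurable N" "g \<in> borel_measurable N"
  shows "(\<lambda>x. k (f x) (g x)) \<in> borel_measurable N"
proof -
  have [measurable]: "I (\<lambda>_. 1) \<in> borel_measurable borel" by (rule measurable_I[where N = 1]) auto
  show ?thesis unfolding k_def wt_def by measurable
qed

lemma nn_integral_k: "(\<integral>\<^sup>+a. ennreal (k b a) \<partial>lborel) = 1"
proof -
  have "(\<integral>\<^sup>+a. ennreal (k b a) \<partial>lborel) = ennreal (\<integral>a. wt b a / I (\<lambda>_. 1) b \<partial>lborel)"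
    unfolding k_def using wt_pos[of b] I_one_pos[of b] integrable_wt[of b]
    by (intro nn_integral_eq_integral) (auto intro!: less_imp_le)
  also have "\<dots> = 1" using I_one_pos[of b] by (simp add: I_def)
  finally show ?thesis .
qed

lemma nn_integral_k_\<Psi>:
  assumes sg: "subgaussian \<sigma>"
  shows "(\<integral>\<^sup>+a. ennreal (k b a * \<Psi> (k b' a / k b a)) \<partial>lborel) \<le> ennreal (\<sigma> / 2 * (norm (b - b'))\<^sup>2)"
proof -
  define e where "e = b' - b"
  have eq: "k b a * \<Psi> (k b' a / k b a) = (1 * (e \<bullet> (M *v a)) * wt b' a - (L b' - L b + 1) * wt b' a) / I (\<lambda>_. 1) b' + wt b a / I (\<lambda>_. 1) b" for a
  proof -
    have "ln (k b' a / k b a) = e \<bullet> (M *v a) - (L b' - L b)"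
      by (simp add: k_eq e_def exp_diff[symmetric] inner_diff_left)
    then have "k b a * \<Psi> (k b' a / k b a) = k b a * (k b' a / k b a * (e \<bullet> (M *v a) - (L b' - L b)) - k b' a / k b a + 1)"
      by (simp add: \<Psi>_def)
    also have "\<dots> = k b' a * (e \<bullet> (M *v a) - (L b' - L b)) - k b' a + k b a"
      using k_pos[of b a] by (simp add: field_simps)
    also have "\<dots> = (1 * (e \<bullet> (M *v a)) * wt b' a - (L b' - L b + 1) * wt b' a) / I (\<lambda>_. 1) b' + wt b a / I (\<lambda>_. 1) b"
      using I_one_pos[of b'] by (simp add: k_def field_simps)
    finally show ?thesis .
  qed
  have i: "integrable lborel (\<lambda>a. 1 * (e \<bullet> (M *v a)) * wt b' a)" by (rule integrable_inner_J[where N = 1]) auto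
  have j: "e \<bullet> J (\<lambda>_. 1) b' = (\<integral>a. 1 * (e \<bullet> (M *v a)) * wt b' a \<partial>lborel)" by (rule inner_J[where N = 1]) auto
  have int: "integrable lborel (\<lambda>a. k b a * \<Psi> (k b' a / k b a))"
    unfolding eq using i integrable_wt by (intro Bochner_Integration.integrable_add Bochner_Integration.integrable_diff integrable_divide_zero integrable_mult_right) auto
  have "(\<integral>a. k b a * \<Psi> (k b' a / k b a) \<partial>lborel) = (e \<bullet> J (\<lambda>_. 1) b' - (L b' - L b + 1) * I (\<lambda>_. 1) b') / I (\<lambda>_. 1) b' + 1"
    unfolding eq j using i integrable_wt[of b] integrable_wt[of b'] I_one_pos[of b] by (simp add: I_def)
  also have "\<dots> = L b - L b' - (b - b') \<bullet> mean b'"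
    using I_one_pos[of b'] by (simp add: mean_def e_def diff_divide_distrib divide_inverse inner_diff_left algebra_simps)
  also have "\<dots> \<le> \<sigma> / 2 * (norm (b - b'))\<^sup>2" using sg unfolding subgaussian_def by blast
  finally have le: "(\<integral>a. k b a * \<Psi> (k b' a / k b a) \<partial>lborel) \<le> \<sigma> / 2 * (norm (b - b'))\<^sup>2" .
  have nn: "0 \<le> k b a * \<Psi> (k b' a / k b a)" for a
    using k_pos by (intro mult_nonneg_nonneg \<Psi>_nonneg) (auto intro: less_imp_le)
  have "(\<integral>\<^sup>+a. ennreal (k b a * \<Psi> (k b' a / k b a)) \<partial>lborel) = ennreal (\<integral>a. k b a * \<Psi> (k b' a / k b a) \<partial>lborel)"
    using int nn by (intro nn_integral_eq_integral) auto
  also have "\<dots> \<le> ennreal (\<sigma> / 2 * (norm (b - b'))\<^sup>2)" using le by (rule ennreal_leI)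
  finally show ?thesis .
qed

text \<open>The competitor is the law of \<open>(a, b)\<close> where \<open>(b, b')\<close> is the maximal coupling of \<open>gibbs V\<close> and the
  density \<open>p\<close>, and \<open>a\<close> is drawn from the kernel at \<open>b'\<close>.\<close>

lemma competitor_coupling:
  fixes U V p :: "real^'d \<Rightarrow> real"
  assumes sg: "subgaussian \<sigma>" and \<sigma>: "0 < \<sigma>"
    and [measurable]: "U \<in> borel_measurable borel" "V \<in> borel_measurable borel" "p \<in> borel_measurable borel"
    and p: "\<And>b. 0 < p b" and V: "prob_space (gibbs V)" and U: "prob_space (gibbs U)"
    and p1: "(\<integral>\<^sup>+b. ennreal (p b) \<partial>lborel) = 1"
    and mix: "\<And>a. (\<integral>\<^sup>+b. ennreal (p b * k b a) \<partial>lborel) = ennreal (exp (- U a))"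
    and int: "integrable lborel (\<lambda>b. \<bar>p b - exp (- V b)\<bar> * (norm b)\<^sup>2)"
  shows "\<exists>Q \<in> couplings (gibbs U) (gibbs V). rel_entropy Q (density lborel (\<lambda>(a, b). ennreal (exp (- V b) * k b a)))
    \<le> ereal (\<sigma> * (\<integral>b. \<bar>p b - exp (- V b)\<bar> * (norm b)\<^sup>2 \<partial>lborel))"
proof -
  define v where "v b = exp (- V b)" for b
  have [measurable]: "v \<in> borel_measurable borel" unfolding v_def by measurable
  have v: "0 < v b" for b by (simp add: v_def)
  define m where "m b = min (p b) (v b)" for b
  define \<theta> where "\<theta> b = max 0 (v b - p b)" for b
  define \<nu> where "\<nu> b = max 0 (p b - v b)" for b
  have [measurable]: "m \<in> borel_measurable borel" "\<theta> \<in> borel_measurable borel" "\<nu> \<in> borel_measurable borel"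
    unfolding m_def \<theta>_def \<nu>_def by measurable
  have nn: "0 < m b" "0 \<le> \<theta> b" "0 \<le> \<nu> b" for b using p v by (auto simp: m_def \<theta>_def \<nu>_def)
  have dec: "m b + \<theta> b = v b" "m b + \<nu> b = p b" for b by (auto simp: m_def \<theta>_def \<nu>_def min_def max_def)
  have v1: "(\<integral>\<^sup>+b. ennreal (v b) \<partial>lborel) = 1"
    using prob_space.emeasure_space_1[OF V] by (simp add: gibbs_def emeasure_density v_def cong: nn_integral_cong)
  have intv: "integrable lborel v" and intp: "integrable lborel p"
    using v1 p1 v p by (auto intro!: integrableI_nonneg less_imp_le)
  have int1: "(\<integral>b. v b \<partial>lborel) = 1" "(\<integral>b. p b \<partial>lborel) = 1"
    using v1 p1 v p by (auto simp: integral_eq_nn_integral less_imp_le)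
  have mv: "m b \<le> v b" "\<theta> b \<le> v b" "\<nu> b \<le> p b" for b
    using p[of b] v[of b] by (auto simp: m_def \<theta>_def \<nu>_def)
  have intm: "integrable lborel m" "integrable lborel \<theta>" "integrable lborel \<nu>"
  proof -
    have "\<bar>m b\<bar> \<le> \<bar>v b\<bar>" "\<bar>\<theta> b\<bar> \<le> \<bar>v b\<bar>" "\<bar>\<nu> b\<bar> \<le> \<bar>p b\<bar>" for b
      using nn[of b] mv[of b] v[of b] p[of b] by auto
    then show "integrable lborel m" "integrable lborel \<theta>" "integrable lborel \<nu>"
      by (auto intro: Bochner_Integration.integrable_bound[OF intv] Bochner_Integration.integrable_bound[OF intp])
  qed
  define T where "T = (\<integral>b. \<nu> b \<partial>lborel)"
  have T\<theta>: "(\<integral>b. \<theta> b \<partial>lborel) = T"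
  proof -
    have "(\<integral>b. m b \<partial>lborel) + (\<integral>b. \<theta> b \<partial>lborel) = 1" "(\<integral>b. m b \<partial>lborel) + (\<integral>b. \<nu> b \<partial>lborel) = 1"
      using intm int1 by (simp_all add: Bochner_Integration.integral_add[symmetric] dec)
    then show ?thesis by (simp add: T_def)
  qed
  define S where "S z = V (snd z) - ln (k (snd z) (fst z))" for z :: "(real^'d) \<times> (real^'d)"
  have [measurable]: "S \<in> borel_measurable borel" unfolding S_def by measurable
  have eS: "exp (- S z) = v (snd z) * k (snd z) (fst z)" for z
    using k_pos[of "snd z" "fst z"] by (simp add: S_def v_def exp_diff exp_minus field_simps)
  have PS: "density lborel (\<lambda>(a, b). ennreal (exp (- V b) * k b a)) = density lborel (\<lambda>z. ennreal (exp (- S z)))"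
    by (intro density_cong) (auto simp: eS v_def)
  have T0: "0 \<le> T" unfolding T_def using nn by (intro Bochner_Integration.integral_nonneg)
  show ?thesis
  proof (cases "T = 0")
    case True
    then have "AE b in lborel. \<nu> b = 0" "AE b in lborel. \<theta> b = 0"
      using integral_nonneg_eq_0_iff_AE[OF intm(3)] integral_nonneg_eq_0_iff_AE[OF intm(2)] nn T\<theta> by (auto simp: T_def)
    then have ae: "AE b in lborel. p b = v b"
      by eventually_elim (use dec in \<open>metis add.right_neutral\<close>)
    let ?Q = "density lborel (\<lambda>z. ennreal (exp (- S z)))"
    have 1: "distr ?Q borel fst = gibbs U"
    proof -
      have "(\<integral>\<^sup>+b. ennreal (exp (- S (a, b))) \<partial>lborel) = ennreal (exp (- U a))" for a
        unfolding mix[symmetric] using ae by (intro nn_integral_cong_AE) (auto simp: eS elim!: AE_mp)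
      then show ?thesis by (subst distr_density_fst) (auto simp: gibbs_def)
    qed
    have 2: "distr ?Q borel snd = gibbs V"
    proof -
      have "(\<integral>\<^sup>+a. ennreal (exp (- S (a, b))) \<partial>lborel) = ennreal (exp (- V b))" for b
        using v[of b] k_pos[of b] by (simp add: eS ennreal_mult less_imp_le nn_integral_cmult nn_integral_k v_def)
      then show ?thesis by (subst distr_density_snd) (auto simp: gibbs_def)
    qed
    have "prob_space ?Q"
      using U unfolding 1[symmetric] by (rule prob_space_distrD[rotated]) simp
    with 1 2 have "?Q \<in> couplings (gibbs U) (gibbs V)" by (simp add: couplings_def)
    moreover have "rel_entropy ?Q ?Q = 0"
      using rel_entropy_density_gibbs[of "\<lambda>z. exp (- S z)" S] by simp
    moreover have "0 \<le> \<sigma> * (\<integral>b. \<bar>p b - exp (- V b)\<bar> * (norm b)\<^sup>2 \<partial>lborel)"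
      using \<sigma> by (intro mult_nonneg_nonneg Bochner_Integration.integral_nonneg) auto
    ultimately show ?thesis unfolding PS by (intro bexI[of _ ?Q]) auto
  next
    case False
    with T0 have T: "0 < T" by simp
    define n where "n a = (\<integral>b. \<nu> b * k b a \<partial>lborel)" for a
    have [measurable]: "n \<in> borel_measurable borel"
      unfolding n_def by (rule lborel.borel_measurable_lebesgue_integral) measurable
    have \<nu>k: "0 \<le> \<nu> b * k b a" for a b using nn(3)[of b] k_pos[of b a] by simp
    have intn: "integrable lborel (\<lambda>b. \<nu> b * k b a)" for a
    proof (rule integrableI_nonneg)
      have "(\<integral>\<^sup>+b. ennreal (\<nu> b * k b a) \<partial>lborel) \<le> (\<integral>\<^sup>+b. ennreal (p b * k b a) \<partial>lborel)"
        using mv k_pos by (intro nn_integral_mono ennreal_leI mult_right_mono) (auto intro: less_imp_le)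
      then show "(\<integral>\<^sup>+b. ennreal (\<nu> b * k b a) \<partial>lborel) < \<infinity>" unfolding mix by (auto intro: le_less_trans)
      show "AE b in lborel. 0 \<le> \<nu> b * k b a" using \<nu>k by simp
    qed measurable
    have n: "0 \<le> n a" for a
      unfolding n_def using \<nu>k by (intro Bochner_Integration.integral_nonneg)
    have nnn: "(\<integral>\<^sup>+b. ennreal (\<nu> b * k b a) \<partial>lborel) = ennreal (n a)" for a
      unfolding n_def using intn \<nu>k by (intro nn_integral_eq_integral) auto
    have nnT: "(\<integral>\<^sup>+b. ennreal (\<nu> b) \<partial>lborel) = ennreal T" "(\<integral>\<^sup>+b. ennreal (\<theta> b) \<partial>lborel) = ennreal T"
      unfolding T_def[symmetric] using intm nn nn_integral_eq_integral[OF intm(3)] nn_integral_eq_integral[OF intm(2)] T\<theta>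
      by (auto simp: T_def)
    have n_int: "(\<integral>\<^sup>+a. ennreal (n a) \<partial>lborel) = ennreal T"
    proof -
      have "(\<integral>\<^sup>+a. ennreal (n a) \<partial>lborel) = (\<integral>\<^sup>+a. \<integral>\<^sup>+b. ennreal (\<nu> b * k b a) \<partial>lborel \<partial>lborel)"
        by (simp add: nnn)
      also have "\<dots> = (\<integral>\<^sup>+b. \<integral>\<^sup>+a. ennreal (\<nu> b * k b a) \<partial>lborel \<partial>lborel)"
        by (rule lborel_pair.Fubini'[symmetric]) measurable
      also have "\<dots> = (\<integral>\<^sup>+b. ennreal (\<nu> b) \<partial>lborel)"
        using nn k_pos by (simp add: ennreal_mult less_imp_le nn_integral_cmult nn_integral_k)
      finally show ?thesis by (simp add: nnT)
    qed
    define q where "q z = m (snd z) * k (snd z) (fst z) + \<theta> (snd z) * n (fst z) / T" for z :: "(real^'d) \<times> (real^'d)"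
    have [measurable]: "q \<in> borel_measurable borel" unfolding q_def by measurable
    have q: "0 < q z" for z
      unfolding q_def using nn n k_pos T by (intro add_pos_nonneg) auto
    let ?Q = "density lborel (\<lambda>z. ennreal (q z))"
    have q_snd: "(\<integral>\<^sup>+a. ennreal (q (a, b)) \<partial>lborel) = ennreal (v b)" for b
    proof -
      have "(\<integral>\<^sup>+a. ennreal (q (a, b)) \<partial>lborel) = (\<integral>\<^sup>+a. ennreal (m b) * ennreal (k b a) + ennreal (\<theta> b / T) * ennreal (n a) \<partial>lborel)"
        using nn n k_pos T by (intro nn_integral_cong) (auto simp: q_def ennreal_mult[symmetric] less_imp_le simp flip: ennreal_plus)
      also have "\<dots> = ennreal (m b) + ennreal (\<theta> b / T) * ennreal T"
        by (subst nn_integral_add) (auto simp: nn_integral_cmult nn_integral_k n_int)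
      also have "\<dots> = ennreal (v b)"
        using nn[of b] T dec(1)[of b] by (simp add: ennreal_mult[symmetric] less_imp_le flip: ennreal_plus)
      finally show ?thesis .
    qed
    have q_fst: "(\<integral>\<^sup>+b. ennreal (q (a, b)) \<partial>lborel) = ennreal (exp (- U a))" for a
    proof -
      have "(\<integral>\<^sup>+b. ennreal (q (a, b)) \<partial>lborel) = (\<integral>\<^sup>+b. ennreal (m b * k b a) + ennreal (n a / T) * ennreal (\<theta> b) \<partial>lborel)"
        using nn n k_pos T by (intro nn_integral_cong) (auto simp: q_def ennreal_mult[symmetric] less_imp_le mult.commute simp flip: ennreal_plus)
      also have "\<dots> = (\<integral>\<^sup>+b. ennreal (m b * k b a) \<partial>lborel) + ennreal (n a / T) * ennreal T"
        by (subst nn_integral_add) (auto simp: nn_integral_cmult nnT)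
      also have "ennreal (n a / T) * ennreal T = (\<integral>\<^sup>+b. ennreal (\<nu> b * k b a) \<partial>lborel)"
        using n[of a] T by (simp add: nnn ennreal_mult[symmetric])
      also have "(\<integral>\<^sup>+b. ennreal (m b * k b a) \<partial>lborel) + \<dots> = (\<integral>\<^sup>+b. ennreal (p b * k b a) \<partial>lborel)"
        using nn k_pos
        by (subst nn_integral_add[symmetric]) (auto intro!: nn_integral_cong simp: dec(2)[symmetric] distrib_right less_imp_le simp flip: ennreal_plus)
      finally show ?thesis by (simp add: mix)
    qed
    have 1: "distr ?Q borel fst = gibbs U" by (subst distr_density_fst) (auto simp: gibbs_def q_fst)
    have 2: "distr ?Q borel snd = gibbs V" by (subst distr_density_snd) (auto simp: gibbs_def q_snd v_def)
    have Q: "prob_space ?Q"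
      using U unfolding 1[symmetric] by (rule prob_space_distrD[rotated]) simp
    then have cpl: "?Q \<in> couplings (gibbs U) (gibbs V)" using 1 2 by (simp add: couplings_def)
    define D where "D z = q z / (v (snd z) * k (snd z) (fst z))" for z
    have [measurable]: "D \<in> borel_measurable borel" unfolding D_def by measurable
    have D: "0 < D z" for z unfolding D_def using q v k_pos by simp
    define X where "X = (\<integral>b. \<bar>p b - v b\<bar> * (norm b)\<^sup>2 \<partial>lborel)"
    \<comment> \<open>\<open>D\<close> is an average of \<open>1\<close> and of the ratios \<open>k b' a / k b a\<close>\<close>
    have jensen: "ennreal (v b * k b a * \<Psi> (D (a, b))) \<le>
        (\<integral>\<^sup>+b'. ennreal (\<theta> b * \<nu> b' / T * (k b a * \<Psi> (k b' a / k b a))) \<partial>lborel)" for a b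
    proof -
      let ?D = "D (a, b)"
      let ?f = "\<lambda>b'. \<theta> b * \<nu> b' / T * (k b a * \<Psi> (k b' a / k b a))"
      have fnn: "0 \<le> ?f b'" for b'
        using nn T k_pos by (intro mult_nonneg_nonneg divide_nonneg_nonneg \<Psi>_nonneg) (auto intro: less_imp_le)
      show ?thesis
      proof (cases "(\<integral>\<^sup>+b'. ennreal (?f b') \<partial>lborel) = \<infinity>")
        case False
        then have fint: "integrable lborel ?f" using fnn by (intro integrableI_nonneg) (auto simp: less_top)
        let ?g = "\<lambda>b'. (\<theta> b / T * k b a * (\<Psi> ?D - ln ?D * ?D)) * \<nu> b' + (\<theta> b / T * ln ?D) * (\<nu> b' * k b' a)"
        have gint: "integrable lborel ?g" using intm intn by simp
        have "(\<integral>b'. ?g b' \<partial>lborel) \<le> (\<integral>b'. ?f b' \<partial>lborel)"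
        proof (rule integral_mono[OF gint fint])
          fix b'
          have "\<theta> b * \<nu> b' / T * k b a * (\<Psi> ?D + ln ?D * (k b' a / k b a - ?D)) \<le> \<theta> b * \<nu> b' / T * k b a * \<Psi> (k b' a / k b a)"
            using nn T k_pos D by (intro mult_left_mono \<Psi>_tangent) (auto intro!: divide_nonneg_nonneg mult_nonneg_nonneg simp: less_imp_le)
          also have "\<theta> b * \<nu> b' / T * k b a * (\<Psi> ?D + ln ?D * (k b' a / k b a - ?D)) = ?g b'"
            using k_pos[of b a] T by (simp add: field_simps)
          finally show "?g b' \<le> ?f b'" by (simp add: mult.assoc)
        qed
        also have "(\<integral>b'. ?g b' \<partial>lborel) = (\<theta> b / T * k b a * (\<Psi> ?D - ln ?D * ?D)) * T + (\<theta> b / T * ln ?D) * n a"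
          using intm intn by (simp add: T_def n_def)
        also have "\<dots> = \<theta> b * k b a * (\<Psi> ?D - ln ?D * ?D) + ln ?D * (\<theta> b * n a / T)"
          using T by (simp add: field_simps)
        finally have A: "\<theta> b * k b a * (\<Psi> ?D - ln ?D * ?D) + ln ?D * (\<theta> b * n a / T) \<le> (\<integral>b'. ?f b' \<partial>lborel)" .
        have "m b * k b a * (\<Psi> ?D + ln ?D * (1 - ?D)) \<le> m b * k b a * \<Psi> 1"
          using nn k_pos D by (intro mult_left_mono \<Psi>_tangent) (auto intro!: mult_nonneg_nonneg simp: less_imp_le)
        then have B: "m b * k b a * (\<Psi> ?D + ln ?D * (1 - ?D)) \<le> 0" by (simp add: \<Psi>_def)
        have q': "\<theta> b * n a / T = v b * k b a * ?D - m b * k b a"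
          using v[of b] k_pos[of b a] by (simp add: D_def q_def)
        have "v b * k b a * \<Psi> ?D = \<theta> b * k b a * (\<Psi> ?D - ln ?D * ?D) + ln ?D * (v b * k b a * ?D - m b * k b a)
            + m b * k b a * (\<Psi> ?D + ln ?D * (1 - ?D))"
          unfolding dec(1)[of b, symmetric] by (simp add: algebra_simps)
        then have "v b * k b a * \<Psi> ?D \<le> (\<integral>b'. ?f b' \<partial>lborel)" using A B unfolding q' by linarith
        then have "ennreal (v b * k b a * \<Psi> ?D) \<le> ennreal (\<integral>b'. ?f b' \<partial>lborel)" by (rule ennreal_leI)
        also have "\<dots> = (\<integral>\<^sup>+b'. ennreal (?f b') \<partial>lborel)" using fint fnn by (intro nn_integral_eq_integral[symmetric]) auto
        finally show ?thesis .
      qed simp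
    qed
    have X_int: "integrable lborel (\<lambda>b. \<bar>p b - v b\<bar> * (norm b)\<^sup>2)" using int by (simp add: v_def)
    have bound: "(\<integral>\<^sup>+b. \<integral>\<^sup>+a. ennreal (v b * k b a * \<Psi> (D (a, b))) \<partial>lborel \<partial>lborel) \<le> ennreal (\<sigma> * X)"
    proof -
      have inner: "(\<integral>\<^sup>+a. ennreal (v b * k b a * \<Psi> (D (a, b))) \<partial>lborel) \<le> ennreal (\<sigma> * (norm b)\<^sup>2 * \<theta> b) + ennreal (\<sigma> * \<theta> b / T) * (\<integral>\<^sup>+b'. ennreal ((norm b')\<^sup>2 * \<nu> b') \<partial>lborel)" for b
      proof -
        have "(\<integral>\<^sup>+a. ennreal (v b * k b a * \<Psi> (D (a, b))) \<partial>lborel)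
          \<le> (\<integral>\<^sup>+a. \<integral>\<^sup>+b'. ennreal (\<theta> b * \<nu> b' / T * (k b a * \<Psi> (k b' a / k b a))) \<partial>lborel \<partial>lborel)"
          by (intro nn_integral_mono jensen)
        also have "\<dots> = (\<integral>\<^sup>+b'. \<integral>\<^sup>+a. ennreal (\<theta> b * \<nu> b' / T * (k b a * \<Psi> (k b' a / k b a))) \<partial>lborel \<partial>lborel)"
          by (rule lborel_pair.Fubini'[symmetric]) measurable
        also have "\<dots> \<le> (\<integral>\<^sup>+b'. ennreal (\<sigma> * (norm b)\<^sup>2 * \<theta> b / T) * ennreal (\<nu> b') + ennreal (\<sigma> * \<theta> b / T) * ennreal ((norm b')\<^sup>2 * \<nu> b') \<partial>lborel)"
        proof (rule nn_integral_mono)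
          fix b'
          have t0: "0 \<le> \<theta> b * \<nu> b' / T" using nn T by simp
          have "(\<integral>\<^sup>+a. ennreal (\<theta> b * \<nu> b' / T * (k b a * \<Psi> (k b' a / k b a))) \<partial>lborel)
            = ennreal (\<theta> b * \<nu> b' / T) * (\<integral>\<^sup>+a. ennreal (k b a * \<Psi> (k b' a / k b a)) \<partial>lborel)"
            unfolding ennreal_mult'[OF t0] by (rule nn_integral_cmult) measurable
          also have "\<dots> \<le> ennreal (\<theta> b * \<nu> b' / T) * ennreal (\<sigma> / 2 * (norm (b - b'))\<^sup>2)"
            by (intro mult_left_mono nn_integral_k_\<Psi>[OF sg]) simp
          also have "\<dots> \<le> ennreal (\<theta> b * \<nu> b' / T) * ennreal (\<sigma> * ((norm b)\<^sup>2 + (norm b')\<^sup>2))"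
          proof (intro mult_left_mono ennreal_leI)
            have "(norm (b - b'))\<^sup>2 \<le> (norm b + norm b')\<^sup>2" by (intro power_mono norm_triangle_ineq4) simp
            also have "\<dots> \<le> 2 * ((norm b)\<^sup>2 + (norm b')\<^sup>2)"
              using sum_squares_bound[of "norm b" "norm b'"] by (simp add: power2_sum)
            finally show "\<sigma> / 2 * (norm (b - b'))\<^sup>2 \<le> \<sigma> * ((norm b)\<^sup>2 + (norm b')\<^sup>2)" using \<sigma> by simp
          qed simp
          also have "\<dots> = ennreal (\<sigma> * (norm b)\<^sup>2 * \<theta> b / T) * ennreal (\<nu> b') + ennreal (\<sigma> * \<theta> b / T) * ennreal ((norm b')\<^sup>2 * \<nu> b')"
            using nn[of b] nn[of b'] T \<sigma> by (simp add: ennreal_mult[symmetric] ennreal_plus[symmetric] field_simps del: ennreal_plus)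
          finally show "(\<integral>\<^sup>+a. ennreal (\<theta> b * \<nu> b' / T * (k b a * \<Psi> (k b' a / k b a))) \<partial>lborel)
            \<le> ennreal (\<sigma> * (norm b)\<^sup>2 * \<theta> b / T) * ennreal (\<nu> b') + ennreal (\<sigma> * \<theta> b / T) * ennreal ((norm b')\<^sup>2 * \<nu> b')" .
        qed
        also have "\<dots> = ennreal (\<sigma> * (norm b)\<^sup>2 * \<theta> b / T) * ennreal T + ennreal (\<sigma> * \<theta> b / T) * (\<integral>\<^sup>+b'. ennreal ((norm b')\<^sup>2 * \<nu> b') \<partial>lborel)"
          by (subst nn_integral_add) (auto simp: nn_integral_cmult nnT)
        also have "ennreal (\<sigma> * (norm b)\<^sup>2 * \<theta> b / T) * ennreal T = ennreal (\<sigma> * (norm b)\<^sup>2 * \<theta> b)"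
          using nn[of b] T \<sigma> by (simp add: ennreal_mult[symmetric])
        finally show ?thesis .
      qed
      have "(\<integral>\<^sup>+b. \<integral>\<^sup>+a. ennreal (v b * k b a * \<Psi> (D (a, b))) \<partial>lborel \<partial>lborel)
        \<le> (\<integral>\<^sup>+b. ennreal (\<sigma> * (norm b)\<^sup>2 * \<theta> b) + ennreal (\<sigma> * \<theta> b / T) * (\<integral>\<^sup>+b'. ennreal ((norm b')\<^sup>2 * \<nu> b') \<partial>lborel) \<partial>lborel)"
        by (intro nn_integral_mono inner)
      also have "\<dots> = (\<integral>\<^sup>+b. ennreal (\<sigma> * (norm b)\<^sup>2 * \<theta> b) \<partial>lborel) + (\<integral>\<^sup>+b. ennreal (\<sigma> / T) * ennreal (\<theta> b) \<partial>lborel) * (\<integral>\<^sup>+b'. ennreal ((norm b')\<^sup>2 * \<nu> b') \<partial>lborel)"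
        using \<sigma> T nn by (subst nn_integral_add) (auto simp: nn_integral_multc ennreal_mult[symmetric])
      also have "(\<integral>\<^sup>+b. ennreal (\<sigma> / T) * ennreal (\<theta> b) \<partial>lborel) = ennreal \<sigma>"
        using \<sigma> T by (simp add: nn_integral_cmult nnT ennreal_mult[symmetric])
      also have "(\<integral>\<^sup>+b. ennreal (\<sigma> * (norm b)\<^sup>2 * \<theta> b) \<partial>lborel) + ennreal \<sigma> * (\<integral>\<^sup>+b'. ennreal ((norm b')\<^sup>2 * \<nu> b') \<partial>lborel)
        = (\<integral>\<^sup>+b. ennreal (\<sigma> * (\<bar>p b - v b\<bar> * (norm b)\<^sup>2)) \<partial>lborel)"
        using \<sigma> nn
        by (subst nn_integral_cmult[symmetric], simp, subst nn_integral_add[symmetric])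
          (auto intro!: nn_integral_cong simp: ennreal_mult[symmetric] \<theta>_def \<nu>_def max_def abs_if algebra_simps simp flip: ennreal_plus)
      also have "\<dots> = ennreal (\<sigma> * X)"
        unfolding X_def using X_int \<sigma> by (subst nn_integral_eq_integral) auto
      finally show ?thesis .
    qed
    have \<pi>int: "integrable lborel q" "(\<integral>z. q z \<partial>lborel) = 1"
    proof -
      have "(\<integral>\<^sup>+z. ennreal (q z) \<partial>lborel) = 1"
        using prob_space.emeasure_space_1[OF Q] by (simp add: emeasure_density cong: nn_integral_cong)
      then show "integrable lborel q" "(\<integral>z. q z \<partial>lborel) = 1"
        using q by (auto intro!: integrableI_nonneg simp: integral_eq_nn_integral less_imp_le)
    qed
    have Pint: "integrable lborel (\<lambda>z. exp (- S z))" "(\<integral>z. exp (- S z) \<partial>lborel) = 1"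
    proof -
      have "(\<integral>\<^sup>+z. ennreal (exp (- S z)) \<partial>lborel) = (\<integral>\<^sup>+z. ennreal (exp (- S z)) \<partial>(lborel \<Otimes>\<^sub>M lborel))" by (simp add: lborel_prod)
      also have "\<dots> = (\<integral>\<^sup>+b. \<integral>\<^sup>+a. ennreal (exp (- S (a, b))) \<partial>lborel \<partial>lborel)"
        by (subst lborel_pair.nn_integral_snd[symmetric]) (auto simp: lborel_prod)
      also have "\<dots> = 1"
        using v k_pos by (simp add: eS ennreal_mult less_imp_le nn_integral_cmult nn_integral_k v1)
      finally have "(\<integral>\<^sup>+z. ennreal (exp (- S z)) \<partial>lborel) = 1" .
      then show "integrable lborel (\<lambda>z. exp (- S z))" "(\<integral>z. exp (- S z) \<partial>lborel) = 1"
        by (auto intro!: integrableI_nonneg simp: integral_eq_nn_integral)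
    qed
    have \<Psi>nn: "0 \<le> exp (- S z) * \<Psi> (D z)" for z using D by (simp add: \<Psi>_nonneg)
    have "(\<integral>\<^sup>+z. ennreal (exp (- S z) * \<Psi> (D z)) \<partial>lborel) = (\<integral>\<^sup>+z. ennreal (exp (- S z) * \<Psi> (D z)) \<partial>(lborel \<Otimes>\<^sub>M lborel))" by (simp add: lborel_prod)
    also have "\<dots> = (\<integral>\<^sup>+b. \<integral>\<^sup>+a. ennreal (v b * k b a * \<Psi> (D (a, b))) \<partial>lborel \<partial>lborel)"
      by (subst lborel_pair.nn_integral_snd[symmetric]) (auto simp: lborel_prod eS)
    finally have \<Psi>le: "(\<integral>\<^sup>+z. ennreal (exp (- S z) * \<Psi> (D z)) \<partial>lborel) \<le> ennreal (\<sigma> * X)" using bound by simp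
    then have \<Psi>int: "integrable lborel (\<lambda>z. exp (- S z) * \<Psi> (D z))"
      using \<Psi>nn by (intro integrableI_nonneg) (auto intro: le_less_trans)
    have X0: "0 \<le> \<sigma> * X" unfolding X_def using \<sigma> by (intro mult_nonneg_nonneg Bochner_Integration.integral_nonneg) auto
    have \<Psi>le': "(\<integral>z. exp (- S z) * \<Psi> (D z) \<partial>lborel) \<le> \<sigma> * X"
      using \<Psi>le X0 \<Psi>nn nn_integral_eq_integral[OF \<Psi>int] by (simp add: AE_I2)
    have qe: "q z * (ln (q z) + S z) = exp (- S z) * \<Psi> (D z) + q z - exp (- S z)" for z
    proof -
      have "D z = q z * exp (S z)" unfolding D_def eS[symmetric] by (simp add: exp_minus divide_inverse)
      moreover then have "ln (D z) = ln (q z) + S z" using q[of z] by (simp add: ln_mult)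
      ultimately show ?thesis by (simp add: \<Psi>_def algebra_simps exp_minus)
    qed
    have "integrable lborel (\<lambda>z. q z * (ln (q z) + S z))"
      unfolding qe using \<Psi>int \<pi>int Pint by simp
    then have int': "integrable ?Q (\<lambda>z. ln (q z) + S z)"
      using AE_I2[of lborel "\<lambda>z. 0 \<le> q z", OF less_imp_le[OF q]] by (subst integrable_real_density) auto
    have "(\<integral>z. ln (q z) + S z \<partial>?Q) = (\<integral>z. q z * (ln (q z) + S z) \<partial>lborel)"
      using AE_I2[of lborel "\<lambda>z. 0 \<le> q z", OF less_imp_le[OF q]] by (subst integral_real_density) auto
    also have "\<dots> \<le> \<sigma> * X" unfolding qe using \<Psi>int \<pi>int Pint \<Psi>le' by simp
    finally have "rel_entropy ?Q (density lborel (\<lambda>z. ennreal (exp (- S z)))) \<le> ereal (\<sigma> * X)"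
      using rel_entropy_density_gibbs[of q S] int' q by (simp add: less_imp_le)
    then show ?thesis using cpl unfolding PS by (intro bexI[of _ ?Q]) (auto simp: X_def v_def)
  qed
qed

end

lemma integrable_exp_neg_norm_sq:
  fixes \<gamma> :: real
  assumes \<gamma>: "0 < \<gamma>"
  shows "integrable lborel (\<lambda>x::'a::euclidean_space. exp (- \<gamma> * (norm x)\<^sup>2))"
proof (rule integrableI_nonneg)
  have one: "(\<integral>\<^sup>+x. ennreal (exp (- \<gamma> * x\<^sup>2)) \<partial>lborel) < \<infinity>"
  proof -
    define \<sigma> where "\<sigma> = 1 / sqrt (2 * \<gamma>)"
    have \<sigma>: "0 < \<sigma>" "\<sigma>\<^sup>2 = 1 / (2 * \<gamma>)" using \<gamma> by (auto simp: \<sigma>_def power_divide)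
    have eq: "exp (- \<gamma> * x\<^sup>2) = sqrt (2 * pi * \<sigma>\<^sup>2) * normal_density 0 \<sigma> x" for x
      using \<sigma> \<gamma> by (simp add: normal_density_def)
    have "integrable lborel (\<lambda>x. exp (- \<gamma> * x\<^sup>2))" unfolding eq using \<sigma> by simp
    then show ?thesis by (simp add: integrable_iff_bounded)
  qed
  have "(\<integral>\<^sup>+x. ennreal (exp (- \<gamma> * (norm (x::'a))\<^sup>2)) \<partial>lborel) = (\<integral>\<^sup>+x. (\<Prod>b\<in>Basis. ennreal (exp (- \<gamma> * ((x::'a) \<bullet> b)\<^sup>2))) \<partial>lborel)"
  proof (rule nn_integral_cong)
    fix x :: 'a
    have "(norm x)\<^sup>2 = (\<Sum>b\<in>Basis. (x \<bullet> b)\<^sup>2)"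
      unfolding power2_norm_eq_inner euclidean_inner[of x x] by (simp add: power2_eq_square)
    then have "exp (- \<gamma> * (norm x)\<^sup>2) = (\<Prod>b\<in>Basis. exp (- \<gamma> * (x \<bullet> b)\<^sup>2))"
      by (simp add: sum_distrib_left exp_sum sum_negf[symmetric] del: sum_negf)
    then show "ennreal (exp (- \<gamma> * (norm x)\<^sup>2)) = (\<Prod>b\<in>Basis. ennreal (exp (- \<gamma> * (x \<bullet> b)\<^sup>2)))"
      by (simp add: prod_ennreal)
  qed
  also have "\<dots> = (\<Prod>b\<in>(Basis::'a set). \<integral>\<^sup>+x. ennreal (exp (- \<gamma> * x\<^sup>2)) \<partial>lborel)"
    by (rule nn_integral_lborel_prod) auto
  also have "\<dots> < \<infinity>" using one by (simp add: power_less_top_ennreal)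
  finally show "(\<integral>\<^sup>+x. ennreal (exp (- \<gamma> * (norm x)\<^sup>2)) \<partial>(lborel::'a measure)) < \<infinity>" .
qed auto

lemma young_\<Psi>:
  assumes r: "0 < r" and y: "0 \<le> y"
  shows "\<bar>r - 1\<bar> * y \<le> \<Psi> r + y\<^sup>2 * exp y"
proof -
  have "1 - exp z + z * r \<le> \<Psi> r" for z
    using \<Psi>_tangent[OF r, of "exp z"] by (simp add: \<Psi>_def algebra_simps)
  from this[of y] this[of "- y"] show ?thesis
    using exp_quadratic_remainder[of y] exp_quadratic_remainder[of "- y"] y
    by (cases "1 \<le> r") (auto simp: abs_le_iff algebra_simps)
qed

lemma weighted_variation_le:
  fixes V :: "real^'d \<Rightarrow> real"
  assumes [measurable]: "V \<in> borel_measurable borel" and prob: "prob_space (gibbs V)"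
    and c: "0 < c" and V: "\<And>b. c * (norm b)\<^sup>2 - C \<le> V b"
  obtains K l\<^sub>0 where "0 < l\<^sub>0" "\<And>p l. 0 < l \<Longrightarrow> l \<le> l\<^sub>0 \<Longrightarrow> p \<in> borel_measurable borel \<Longrightarrow> (\<And>b. 0 < p b) \<Longrightarrow>
      (\<integral>\<^sup>+b. ennreal (p b) \<partial>lborel) = 1 \<Longrightarrow> integrable lborel (\<lambda>b. p b * (ln (p b) + V b)) \<Longrightarrow>
      integrable lborel (\<lambda>b. \<bar>p b - exp (- V b)\<bar> * (norm b)\<^sup>2) \<and>
      (\<integral>b. \<bar>p b - exp (- V b)\<bar> * (norm b)\<^sup>2 \<partial>lborel) \<le> (\<integral>b. p b * (ln (p b) + V b) \<partial>lborel) / l + l * K"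
proof -
  define l\<^sub>0 where "l\<^sub>0 = c / 4"
  have l0: "0 < l\<^sub>0" using c by (simp add: l\<^sub>0_def)
  define v where "v b = exp (- V b)" for b
  have [measurable]: "v \<in> borel_measurable borel" unfolding v_def by measurable
  have v0: "0 < v b" for b by (simp add: v_def)
  have v1: "(\<integral>\<^sup>+b. ennreal (v b) \<partial>lborel) = 1"
    using prob_space.emeasure_space_1[OF prob] by (simp add: gibbs_def emeasure_density v_def cong: nn_integral_cong)
  have vint: "integrable lborel v" "(\<integral>b. v b \<partial>lborel) = 1"
    using v1 v0 by (auto intro!: integrableI_nonneg simp: integral_eq_nn_integral less_imp_le)
  let ?k = "\<lambda>b. v b * ((norm b)\<^sup>2)\<^sup>2 * exp (l\<^sub>0 * (norm b)\<^sup>2)"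
  have kint: "integrable lborel ?k"
  proof (rule Bochner_Integration.integrable_bound)
    show "integrable lborel (\<lambda>b::real^'d. exp C * (2 / l\<^sub>0\<^sup>2) * exp (- (c / 2) * (norm b)\<^sup>2))"
      using c by (intro integrable_mult_right integrable_exp_neg_norm_sq) auto
    show "AE b in lborel. norm (?k b) \<le> norm (exp C * (2 / l\<^sub>0\<^sup>2) * exp (- (c / 2) * (norm b)\<^sup>2))"
    proof (rule AE_I2)
      fix b :: "real^'d"
      let ?n = "(norm b)\<^sup>2"
      have "0 \<le> l\<^sub>0 * ?n" using l0 by simp
      then have "(l\<^sub>0 * ?n)\<^sup>2 \<le> 2 * exp (l\<^sub>0 * ?n)"
        using exp_lower_Taylor_quadratic[of "l\<^sub>0 * ?n"] by linarith
      then have n2: "?n\<^sup>2 \<le> 2 / l\<^sub>0\<^sup>2 * exp (l\<^sub>0 * ?n)" using l0 by (simp add: power_mult_distrib field_simps)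
      have "?k b \<le> exp (C - c * ?n) * (2 / l\<^sub>0\<^sup>2 * exp (l\<^sub>0 * ?n)) * exp (l\<^sub>0 * ?n)"
        using V[of b] n2 unfolding v_def by (intro mult_mono) auto
      also have "\<dots> = 2 / l\<^sub>0\<^sup>2 * (exp (C - c * ?n) * exp (l\<^sub>0 * ?n) * exp (l\<^sub>0 * ?n))" by simp
      also have "exp (C - c * ?n) * exp (l\<^sub>0 * ?n) * exp (l\<^sub>0 * ?n) = exp C * exp (- (c / 2) * ?n)"
        by (simp add: exp_add[symmetric] l\<^sub>0_def)
      finally have "?k b \<le> exp C * (2 / l\<^sub>0\<^sup>2) * exp (- (c / 2) * ?n)" by (simp add: mult_ac)
      then show "norm (?k b) \<le> norm (exp C * (2 / l\<^sub>0\<^sup>2) * exp (- (c / 2) * ?n))"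
        using v0[of b] by (simp add: less_imp_le)
    qed
  qed measurable
  define K where "K = (\<integral>b. ?k b \<partial>lborel)"
  show ?thesis
  proof (rule that[of l\<^sub>0 K])
    fix p l assume l: "0 < l" "l \<le> l\<^sub>0" and [measurable]: "p \<in> borel_measurable borel" and p0: "\<And>b. 0 < p b"
      and p1: "(\<integral>\<^sup>+b. ennreal (p b) \<partial>lborel) = 1" and hint: "integrable lborel (\<lambda>b. p b * (ln (p b) + V b))"
    have pint: "integrable lborel p" "(\<integral>b. p b \<partial>lborel) = 1"
      using p1 p0 by (auto intro!: integrableI_nonneg simp: integral_eq_nn_integral less_imp_le)
    let ?f = "\<lambda>b. \<bar>p b - v b\<bar> * (norm b)\<^sup>2"
    let ?h = "\<lambda>b. p b * (ln (p b) + V b) - p b + v b"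
    have le: "?f b \<le> ?h b / l + l * ?k b" for b
    proof -
      have "\<bar>p b / v b - 1\<bar> * (l * (norm b)\<^sup>2) \<le> \<Psi> (p b / v b) + (l * (norm b)\<^sup>2)\<^sup>2 * exp (l * (norm b)\<^sup>2)"
        using p0[of b] v0[of b] l by (intro young_\<Psi>) auto
      then have "v b * (\<bar>p b / v b - 1\<bar> * (l * (norm b)\<^sup>2)) \<le> v b * (\<Psi> (p b / v b) + (l * (norm b)\<^sup>2)\<^sup>2 * exp (l * (norm b)\<^sup>2))"
        using v0[of b] by (intro mult_left_mono) auto
      also have "v b * (\<bar>p b / v b - 1\<bar> * (l * (norm b)\<^sup>2)) = l * ?f b"
      proof -
        have "v b * \<bar>p b / v b - 1\<bar> = \<bar>v b * (p b / v b - 1)\<bar>" using v0[of b] by (simp add: abs_mult)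
        also have "v b * (p b / v b - 1) = p b - v b" using v0[of b] by (simp add: field_simps)
        finally show ?thesis by (simp add: mult_ac)
      qed
      also have "v b * (\<Psi> (p b / v b) + (l * (norm b)\<^sup>2)\<^sup>2 * exp (l * (norm b)\<^sup>2)) = ?h b + l\<^sup>2 * (v b * ((norm b)\<^sup>2)\<^sup>2 * exp (l * (norm b)\<^sup>2))"
      proof -
        have "ln (p b / v b) = ln (p b) + V b" using p0[of b] by (simp add: v_def ln_div)
        then have "v b * \<Psi> (p b / v b) = ?h b" using v0[of b] by (simp add: \<Psi>_def field_simps)
        then show ?thesis by (simp add: distrib_left power_mult_distrib mult_ac)
      qed
      also have "\<dots> \<le> ?h b + l\<^sup>2 * ?k b"
      proof -
        have "exp (l * (norm b)\<^sup>2) \<le> exp (l\<^sub>0 * (norm b)\<^sup>2)" using l by (simp add: mult_right_mono)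
        then show ?thesis using v0[of b] by (intro add_left_mono mult_left_mono) auto
      qed
      also have "?h b + l\<^sup>2 * ?k b = l * (?h b / l + l * ?k b)"
      proof -
        have "l * (h / l + l * x) = h + l\<^sup>2 * x" for h x using l by (simp add: distrib_left power2_eq_square)
        then show ?thesis by simp
      qed
      finally show ?thesis by (simp only: mult_le_cancel_left_pos[OF l(1)])
    qed
    have rint: "integrable lborel (\<lambda>b. ?h b / l + l * ?k b)" using hint pint vint kint by simp
    have fint: "integrable lborel ?f"
      using le by (intro Bochner_Integration.integrable_bound[OF rint] AE_I2) (auto intro: order_trans[OF _ abs_ge_self])
    have "(\<integral>b. ?f b \<partial>lborel) \<le> (\<integral>b. ?h b / l + l * ?k b \<partial>lborel)"
      using le by (intro integral_mono fint rint)
    also have "\<dots> = (\<integral>b. p b * (ln (p b) + V b) \<partial>lborel) / l + l * K"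
      using hint pint vint kint by (simp add: K_def)
    finally show "integrable lborel (\<lambda>b. \<bar>p b - exp (- V b)\<bar> * (norm b)\<^sup>2) \<and>
      (\<integral>b. \<bar>p b - exp (- V b)\<bar> * (norm b)\<^sup>2 \<partial>lborel) \<le> (\<integral>b. p b * (ln (p b) + V b) \<partial>lborel) / l + l * K"
      using fint by (simp add: v_def)
  qed (rule l0)
qed

section \<open>Entropy along the Sinkhorn iteration\<close>

context tilted_family
begin

lemma measurable_kernel_integral:
  fixes f :: "real^'d \<Rightarrow> real"
  assumes "f \<in> borel_measurable borel" "\<And>a. \<bar>f a\<bar> \<le> N"
  shows "(\<lambda>b. \<integral>a. f a \<partial>kernel b) \<in> borel_measurable borel"
  unfolding integral_kernel(1)[OF assms(1)]
  by (intro borel_measurable_divide measurable_I[OF assms] measurable_I[where N = 1]) auto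

lemma kernel_integral_bound:
  fixes f :: "real^'d \<Rightarrow> real"
  assumes "f \<in> borel_measurable borel" "\<And>a. \<bar>f a\<bar> \<le> N"
  shows "\<bar>\<integral>a. f a \<partial>kernel b\<bar> \<le> N"
  using abs_c'_le[OF assms, of 0 b] by (simp add: c'_def[OF assms] integral_kernel(1)[OF assms(1)])

lemma measurable_ln_kernel_exp:
  fixes f :: "real^'d \<Rightarrow> real"
  assumes "f \<in> borel_measurable borel" "\<And>a. \<bar>f a\<bar> \<le> N"
  shows "(\<lambda>b. ln (\<integral>a. exp (f a) \<partial>kernel b)) \<in> borel_measurable borel"
  using measurable_c(1)[OF assms, of 1] unfolding c_one_eq[OF assms, abs_def] .

lemma ln_kernel_exp_bound:
  fixes f :: "real^'d \<Rightarrow> real"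
  assumes "f \<in> borel_measurable borel" "\<And>a. \<bar>f a\<bar> \<le> N"
  shows "\<bar>ln (\<integral>a. exp (f a) \<partial>kernel b)\<bar> \<le> N"
  using abs_c_le[OF assms, of 1 b] unfolding c_one_eq[OF assms] by simp

end

lemma prob_space_bounded_exp_integral_pos:
  fixes h :: "'a \<Rightarrow> real"
  assumes "prob_space M" and [measurable]: "h \<in> borel_measurable M" and h: "\<And>x. \<bar>h x\<bar> \<le> C"
  shows "integrable M (\<lambda>x. exp (h x))" "0 < (\<integral>x. exp (h x) \<partial>M)"
proof -
  interpret prob_space M by fact
  show i: "integrable M (\<lambda>x. exp (h x))"
    using abs_le_D1[OF h] by (intro integrable_const_bound[of _ "exp C"]) auto
  have "expectation (\<lambda>x. exp (- C)) \<le> expectation (\<lambda>x. exp (h x))"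
  proof (rule integral_mono[OF _ i])
    show "exp (- C) \<le> exp (h x)" for x using abs_le_D2[OF h[of x]] by simp
  qed simp
  then have "exp (- C) \<le> expectation (\<lambda>x. exp (h x))" using prob_space by simp
  then show "0 < (\<integral>x. exp (h x) \<partial>M)" by (rule less_le_trans[OF exp_gt_zero])
qed

locale sinkhorn_potentials =
  fixes E :: "nat \<Rightarrow> real^'d \<Rightarrow> real" and w :: "nat \<Rightarrow> real^'d \<Rightarrow> real^'d \<Rightarrow> real"
    and p :: "nat \<Rightarrow> real^'d \<Rightarrow> real" and M :: "nat \<Rightarrow> real^'d^'d"
  assumes E_period: "E (Suc (Suc k)) = E k"
    and E_measurable[measurable]: "E k \<in> borel_measurable borel"
    and E_prob: "prob_space (gibbs (E k))"
    and w_measurable: "(\<lambda>z. w k (fst z) (snd z)) \<in> borel_measurable borel"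
    and w_prob: "(\<integral>\<^sup>+b. ennreal (exp (- w k a b)) \<partial>lborel) = 1"
    and p_measurable[measurable]: "p k \<in> borel_measurable borel"
    and p_pos: "0 < p k b"
    and p_mix: "(\<integral>\<^sup>+a. ennreal (exp (- E k a - w k a b)) \<partial>lborel) = ennreal (p k b)"
    and w_Suc: "w (Suc k) b a = E k a + w k a b + ln (p k b)"
    and w_shape: "w k a b = w k a 0 + w k 0 b - w k 0 0 - a \<bullet> (M k *v b)"
    and M_invertible: "invertible (M k)"
begin

lemma w_measurable'[measurable (raw)]:
  assumes [measurable]: "f \<in> borel_measurable N" "g \<in> borel_measurable N"
  shows "(\<lambda>x. w k (f x) (g x)) \<in> borel_measurable N"
  using measurable_compose[OF borel_measurable_Pair[OF assms] w_measurable[of k]] by simp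

lemma weight_eq: "exp (a \<bullet> (M k *v b) - w k 0 b) = exp (w k a 0 - w k 0 0) * exp (- w k a b)"
  unfolding exp_add[symmetric] using w_shape[of k a b] by (simp add: algebra_simps)

lemma w_integrable: "integrable lborel (\<lambda>b. exp (- w k a b))" "(\<integral>b. exp (- w k a b) \<partial>lborel) = 1"
  using w_prob[of k a] by (auto intro!: integrableI_nonneg simp: integral_eq_nn_integral)

sublocale tf: tilted_family "M k" "w k 0" for k
  by unfold_locales (use M_invertible w_integrable in \<open>auto simp: weight_eq\<close>)

lemma tf_L: "tf.L k a = w k a 0 - w k 0 0"
  unfolding tf.L_def tf.I_def tf.wt_def weight_eq using w_integrable[of k a] by simp

lemma tf_kernel: "tf.kernel k a = gibbs (w k a)"
proof -
  have "(\<lambda>b. w k 0 b + tf.L k a - a \<bullet> (M k *v b)) = w k a"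
  proof
    show "w k 0 b + tf.L k a - a \<bullet> (M k *v b) = w k a b" for b
      unfolding tf_L using w_shape[of k a b] by linarith
  qed
  then show ?thesis by (simp add: tf.kernel_def)
qed

lemma tf_k: "tf.k k a b = exp (- w k a b)"
  unfolding tf.k_eq tf_L using w_shape[of k a b] by (simp add: algebra_simps)

definition G :: "nat \<Rightarrow> real^'d \<Rightarrow> real" where
  "G k b = - E (Suc k) b - ln (p k b)"

lemma measurable_G[measurable]: "G k \<in> borel_measurable borel"
  unfolding G_def by measurable

lemma half_step: "E (Suc k) b + w (Suc k) b a = E k a + w k a b - G k b"
  by (simp add: w_Suc G_def)

lemma p_exp_G: "p k b * exp (G k b) = exp (- E (Suc k) b)"
  using p_pos[of k b] by (simp add: G_def exp_diff exp_minus field_simps)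

abbreviation \<pi> :: "nat \<Rightarrow> (real^'d) measure" where
  "\<pi> k \<equiv> density lborel (\<lambda>b. ennreal (p k b))"

abbreviation T :: "nat \<Rightarrow> (real^'d) measure" where
  "T k \<equiv> gibbs (E (Suc k))"

definition J :: "nat \<Rightarrow> ((real^'d) \<times> (real^'d)) measure" where
  "J k = density lborel (\<lambda>z. ennreal (exp (- E k (fst z) - w k (fst z) (snd z))))"

lemma J_fst: "distr (J k) borel fst = gibbs (E k)"
proof -
  have "(\<integral>\<^sup>+b. ennreal (exp (- E k a - w k a b)) \<partial>lborel) = ennreal (exp (- E k a))" for a
  proof -
    have "(\<integral>\<^sup>+b. ennreal (exp (- E k a - w k a b)) \<partial>lborel) = (\<integral>\<^sup>+b. ennreal (exp (- E k a)) * ennreal (exp (- w k a b)) \<partial>lborel)"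
      by (intro nn_integral_cong) (simp add: ennreal_mult[symmetric] exp_add[symmetric])
    then show ?thesis by (simp add: nn_integral_cmult w_prob)
  qed
  then show ?thesis unfolding J_def by (subst distr_density_fst) (auto simp: gibbs_def)
qed

lemma J_snd: "distr (J k) borel snd = \<pi> k"
  unfolding J_def by (subst distr_density_snd) (auto simp: p_mix)

lemma J_prob: "prob_space (J k)"
  using E_prob[of k] unfolding J_fst[symmetric] by (rule prob_space_distrD[rotated]) (simp add: J_def)

lemma \<pi>_prob: "prob_space (\<pi> k)"
  unfolding J_snd[symmetric] by (rule prob_space.prob_space_distr[OF J_prob]) (simp add: J_def)

lemma nn_integral_p: "(\<integral>\<^sup>+b. ennreal (p k b) \<partial>lborel) = 1"
  using prob_space.emeasure_space_1[OF \<pi>_prob] by (simp add: emeasure_density cong: nn_integral_cong)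

lemma nn_integral_E: "(\<integral>\<^sup>+b. ennreal (exp (- E k b)) \<partial>lborel) = 1"
  using prob_space.emeasure_space_1[OF E_prob[of k]] by (simp add: gibbs_def emeasure_density cong: nn_integral_cong)

lemma J_eq: "exp (- E k a - w k a b) = p k b * exp (- w (Suc k) b a)"
  using p_pos[of k b] by (simp add: w_Suc exp_diff exp_minus exp_add field_simps)

lemma entropy_decrease:
  assumes G: "integrable (T k) (G k)"
  shows "integrable (\<pi> (Suc k)) (G (Suc k))" "(\<integral>b. - G (Suc k) b \<partial>\<pi> (Suc k)) \<le> (\<integral>b. G k b \<partial>T k)"
proof -
  interpret J: prob_space "J (Suc k)" by (rule J_prob)
  interpret \<pi>: prob_space "\<pi> (Suc k)" by (rule \<pi>_prob)
  have sets[measurable_cong]: "sets (J (Suc k)) = sets borel" by (simp add: J_def)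
  have G1: "integrable (J (Suc k)) (\<lambda>z. G k (fst z))" "(\<integral>z. G k (fst z) \<partial>J (Suc k)) = (\<integral>b. G k b \<partial>T k)"
    using G unfolding J_fst[symmetric] by (auto simp: integrable_distr_eq integral_distr)
  have "integrable (\<pi> (Suc k)) (\<lambda>a. max 0 (- (- G (Suc k) a)))"
  proof (rule \<pi>.gibbs_inequality(1))
    have "(\<integral>\<^sup>+a. ennreal (exp (- (- G (Suc k) a))) \<partial>\<pi> (Suc k)) = (\<integral>\<^sup>+a. ennreal (exp (- E (Suc (Suc k)) a)) \<partial>lborel)"
      using p_pos by (subst nn_integral_density) (auto intro!: nn_integral_cong simp: ennreal_mult[symmetric] less_imp_le p_exp_G)
    then show "(\<integral>\<^sup>+a. ennreal (exp (- (- G (Suc k) a))) \<partial>\<pi> (Suc k)) \<le> 1" by (simp add: nn_integral_E)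
  qed measurable
  then have up: "integrable (J (Suc k)) (\<lambda>z. max 0 (G (Suc k) (snd z)))"
    unfolding J_snd[symmetric] by (subst (asm) integrable_distr_eq) auto
  let ?u = "\<lambda>z. G k (fst z) + G (Suc k) (snd z)"
  have eu: "(\<integral>\<^sup>+z. ennreal (exp (- ?u z)) \<partial>J (Suc k)) \<le> 1"
  proof -
    have eq: "exp (- E (Suc k) b - w (Suc k) b a) * exp (- (G k b + G (Suc k) a)) = p (Suc k) a * exp (- w k a b)" for a b
    proof -
      have "exp (- E (Suc k) b - w (Suc k) b a) * exp (- (G k b + G (Suc k) a)) = exp (- E k a - G (Suc k) a) * exp (- w k a b)"
        using half_step[of k b a] by (simp add: exp_add[symmetric] algebra_simps)
      also have "exp (- E k a - G (Suc k) a) = p (Suc k) a"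
        using p_pos[of "Suc k" a] by (simp add: G_def E_period)
      finally show ?thesis .
    qed
    have "(\<integral>\<^sup>+z. ennreal (exp (- ?u z)) \<partial>J (Suc k)) = (\<integral>\<^sup>+z. ennreal (p (Suc k) (snd z) * exp (- w k (snd z) (fst z))) \<partial>(lborel \<Otimes>\<^sub>M lborel))"
    proof -
      have "ennreal (exp (- E (Suc k) (fst z) - w (Suc k) (fst z) (snd z))) * ennreal (exp (- ?u z))
          = ennreal (p (Suc k) (snd z) * exp (- w k (snd z) (fst z)))" for z
        by (simp only: ennreal_mult[symmetric] exp_ge_zero eq)
      then show ?thesis unfolding J_def lborel_prod by (subst nn_integral_density) auto
    qed
    also have "\<dots> = (\<integral>\<^sup>+a. \<integral>\<^sup>+b. ennreal (p (Suc k) a * exp (- w k a b)) \<partial>lborel \<partial>lborel)"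
      by (subst lborel_pair.nn_integral_snd[symmetric]) auto
    also have "\<dots> = 1"
      using p_pos by (simp add: ennreal_mult less_imp_le nn_integral_cmult w_prob nn_integral_p)
    finally show ?thesis by simp
  qed
  have dn: "integrable (J (Suc k)) (\<lambda>z. max 0 (- ?u z))"
    using eu by (intro J.gibbs_inequality(1)) auto
  have G2: "integrable (J (Suc k)) (\<lambda>z. G (Suc k) (snd z))"
  proof (rule Bochner_Integration.integrable_bound)
    show "integrable (J (Suc k)) (\<lambda>z. \<bar>G k (fst z)\<bar> + max 0 (- ?u z) + max 0 (G (Suc k) (snd z)))"
      using G1(1) dn up by simp
  qed auto
  then show *: "integrable (\<pi> (Suc k)) (G (Suc k))"
    unfolding J_snd[symmetric] by (subst integrable_distr_eq) auto
  have "0 \<le> J.expectation ?u"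
    using eu G1 G2 by (intro J.gibbs_inequality(2)) auto
  also have "J.expectation ?u = (\<integral>b. G k b \<partial>T k) + (\<integral>a. G (Suc k) a \<partial>\<pi> (Suc k))"
    unfolding J_snd[symmetric] using G1 G2 by (simp add: integral_distr)
  finally show "(\<integral>b. - G (Suc k) b \<partial>\<pi> (Suc k)) \<le> (\<integral>b. G k b \<partial>T k)" by simp
qed

lemma truncated_duality:
  assumes G: "integrable (\<pi> k) (G k)" and dt: "tf.dual_transport (Suc k) (T k) \<epsilon>" and \<epsilon>: "0 < \<epsilon>"
    and f[measurable]: "f \<in> borel_measurable borel" and fN: "\<And>a. \<bar>f a\<bar> \<le> N"
  shows "(\<integral>a. f a \<partial>gibbs (E k)) - (\<integral>b. ln (\<integral>a. exp (f a) \<partial>gibbs (w (Suc k) b)) \<partial>T k)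
    \<le> \<epsilon> * (\<integral>b. - G k b \<partial>\<pi> k)"
proof -
  interpret \<pi>: prob_space "\<pi> k" by (rule \<pi>_prob)
  interpret T: prob_space "T k" by (rule E_prob)
  have setsT[measurable_cong]: "sets (T k) = sets borel" by (simp add: gibbs_def)
  define Kf where "Kf b = (\<integral>a. f a \<partial>gibbs (w (Suc k) b))" for b
  have [measurable]: "Kf \<in> borel_measurable borel"
    unfolding Kf_def tf_kernel[symmetric] by (rule tf.measurable_kernel_integral[OF f fN])
  have KfN: "\<bar>Kf b\<bar> \<le> N" for b
    unfolding Kf_def tf_kernel[symmetric] by (rule tf.kernel_integral_bound[OF f fN])
  have KfN': "\<bar>Kf b / \<epsilon>\<bar> \<le> N / \<epsilon>" for b using KfN[of b] \<epsilon> by (simp add: divide_right_mono)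
  define A where "A = (\<integral>b. exp (Kf b / \<epsilon>) \<partial>T k)"
  have A: "0 < A" "integrable (T k) (\<lambda>b. exp (Kf b / \<epsilon>))"
    unfolding A_def using prob_space_bounded_exp_integral_pos[OF E_prob[of "Suc k"] _ KfN'] by auto
  let ?u = "\<lambda>b. - G k b - Kf b / \<epsilon> + ln A"
  have Kint: "integrable (\<pi> k) Kf" using KfN by (intro \<pi>.integrable_const_bound[of _ N]) auto
  have "0 \<le> \<pi>.expectation ?u"
  proof (rule \<pi>.gibbs_inequality(2))
    have "p k b * exp (- ?u b) = exp (- E (Suc k) b) * exp (Kf b / \<epsilon>) / A" for b
      using p_exp_G[of k b] A(1) by (simp add: exp_add exp_diff exp_minus field_simps)
    then have "(\<integral>\<^sup>+b. ennreal (exp (- ?u b)) \<partial>\<pi> k) = (\<integral>\<^sup>+b. ennreal (exp (- E (Suc k) b)) * ennreal (exp (Kf b / \<epsilon>) / A) \<partial>lborel)"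
      using p_pos A(1) by (subst nn_integral_density) (auto intro!: nn_integral_cong simp: ennreal_mult[symmetric] less_imp_le)
    also have "\<dots> = (\<integral>\<^sup>+b. ennreal (exp (Kf b / \<epsilon>) / A) \<partial>T k)"
      unfolding gibbs_def by (subst nn_integral_density) auto
    also have "\<dots> = ennreal (\<integral>b. exp (Kf b / \<epsilon>) / A \<partial>T k)"
      using A by (intro nn_integral_eq_integral) auto
    also have "\<dots> = 1" using A by (simp add: A_def[symmetric])
    finally show "(\<integral>\<^sup>+b. ennreal (exp (- ?u b)) \<partial>\<pi> k) \<le> 1" by simp
    show "integrable (\<pi> k) ?u" using G Kint by simp
  qed measurable
  also have "\<pi>.expectation ?u = (\<integral>b. - G k b \<partial>\<pi> k) - (\<integral>b. Kf b \<partial>\<pi> k) / \<epsilon> + ln A"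
    using G Kint \<pi>.prob_space by simp
  finally have 1: "(\<integral>b. Kf b \<partial>\<pi> k) \<le> \<epsilon> * (\<integral>b. - G k b \<partial>\<pi> k) + \<epsilon> * ln A"
    using \<epsilon> by (simp add: field_simps)
  have 2: "\<epsilon> * ln A \<le> (\<integral>b. ln (\<integral>a. exp (f a) \<partial>gibbs (w (Suc k) b)) \<partial>T k)"
    using dt[unfolded tf.dual_transport_def tf_kernel, rule_format, OF f fN] by (simp add: A_def Kf_def)
  have 3: "(\<integral>b. Kf b \<partial>\<pi> k) = (\<integral>a. f a \<partial>gibbs (E k))"
  proof -
    have J_int: "integrable (lborel \<Otimes>\<^sub>M lborel) (\<lambda>(a, b). exp (- E k a - w k a b) * f a)"
    proof -
      interpret J: prob_space "J k" by (rule J_prob)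
      have "integrable (J k) (\<lambda>z. f (fst z))" using fN by (intro J.integrable_const_bound[of _ N]) (auto simp: J_def)
      then show ?thesis unfolding J_def lborel_prod by (subst (asm) integrable_real_density) (auto simp: case_prod_unfold)
    qed
    have "(\<integral>b. Kf b \<partial>\<pi> k) = (\<integral>b. p k b * Kf b \<partial>lborel)"
      using p_pos by (subst integral_real_density) (auto simp: less_imp_le)
    also have "\<dots> = (\<integral>b. (\<integral>a. exp (- E k a - w k a b) * f a \<partial>lborel) \<partial>lborel)"
    proof (rule Bochner_Integration.integral_cong[OF refl])
      fix b
      have "Kf b = (\<integral>a. exp (- w (Suc k) b a) * f a \<partial>lborel)"
        unfolding Kf_def gibbs_def by (subst integral_real_density) auto
      then show "p k b * Kf b = (\<integral>a. exp (- E k a - w k a b) * f a \<partial>lborel)"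
        by (simp add: J_eq mult.assoc)
    qed
    also have "\<dots> = (\<integral>a. (\<integral>b. exp (- E k a - w k a b) * f a \<partial>lborel) \<partial>lborel)"
      using lborel_pair.Fubini_integral[OF J_int] by simp
    also have "\<dots> = (\<integral>a. exp (- E k a) * f a \<partial>lborel)"
    proof (rule Bochner_Integration.integral_cong[OF refl])
      fix a
      have "exp (- E k a - w k a b) * f a = exp (- E k a) * f a * exp (- w k a b)" for b
        by (simp add: exp_diff exp_minus field_simps)
      then show "(\<integral>b. exp (- E k a - w k a b) * f a \<partial>lborel) = exp (- E k a) * f a"
        by (simp only: integral_mult_right_zero w_integrable(2) mult_1_right)
    qed
    also have "\<dots> = (\<integral>a. f a \<partial>gibbs (E k))"
      unfolding gibbs_def by (subst integral_real_density) auto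
    finally show ?thesis .
  qed
  show ?thesis using 1 2 unfolding 3 by linarith
qed

lemma duality:
  assumes G: "integrable (\<pi> k) (G k)" and dt: "tf.dual_transport (Suc k) (T k) \<epsilon>" and \<epsilon>: "0 < \<epsilon>"
    and F: "integrable (gibbs (E k)) F" and g: "integrable (T k) g"
    and Fg: "\<And>b. (\<integral>\<^sup>+a. ennreal (exp (F a)) \<partial>gibbs (w (Suc k) b)) = ennreal (exp (- g b))"
  shows "(\<integral>a. F a \<partial>gibbs (E k)) + (\<integral>b. g b \<partial>T k) \<le> \<epsilon> * (\<integral>b. - G k b \<partial>\<pi> k)"
proof -
  interpret T: prob_space "T k" by (rule E_prob)
  have setsT[measurable_cong]: "sets (gibbs h) = sets borel" for h :: "real^'d \<Rightarrow> real" by (simp add: gibbs_def)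
  have mT: "borel_measurable (gibbs h) = borel_measurable borel" for h :: "real^'d \<Rightarrow> real"
    by (rule measurable_cong_sets) (simp_all add: gibbs_def)
  have [measurable]: "F \<in> borel_measurable borel" "g \<in> borel_measurable borel"
    using F g unfolding mT[symmetric] by auto
  define f where "f N a = max (- real N) (min (real N) (F a))" for N a
  define y where "y N b = ln (exp (- g b) + exp (- real N))" for N b
  have f[measurable]: "f N \<in> borel_measurable borel" and [measurable]: "y N \<in> borel_measurable borel" for N
    unfolding f_def y_def by measurable
  have fN: "\<bar>f N a\<bar> \<le> real N" for N a by (auto simp: f_def)
  have y_ge: "- g b \<le> y N b" for N b
  proof -
    have "ln (exp (- g b)) \<le> y N b" unfolding y_def by (intro ln_mono) (auto simp: add_pos_pos)
    then show ?thesis by simp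
  qed
  have y_le: "y N b \<le> ln 2 + \<bar>g b\<bar>" for N b
  proof -
    have "exp (- g b) + exp (- real N) \<le> 2 * exp \<bar>g b\<bar>"
    proof -
      have "exp (- g b) \<le> exp \<bar>g b\<bar>" "exp (- real N) \<le> exp \<bar>g b\<bar>" by auto
      then show ?thesis by linarith
    qed
    then have "y N b \<le> ln (2 * exp \<bar>g b\<bar>)" unfolding y_def by (intro ln_mono) (auto simp: add_pos_pos)
    then show ?thesis by (simp add: ln_mult)
  qed
  have y_bd: "\<bar>y N b\<bar> \<le> ln 2 + \<bar>g b\<bar>" for N b
    using y_ge[of b N] y_le[of N b] by (simp add: abs_le_iff) (smt (verit) ln_gt_zero)
  have yint: "integrable (T k) (y N)" for N
  proof (rule Bochner_Integration.integrable_bound)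
    show "integrable (T k) (\<lambda>b. ln 2 + \<bar>g b\<bar>)" using g by simp
    show "AE b in T k. norm (y N b) \<le> norm (ln 2 + \<bar>g b\<bar>)"
      using y_bd by (auto intro!: AE_I2 order_trans[OF _ abs_ge_self])
  qed measurable
  have step: "(\<integral>a. f N a \<partial>gibbs (E k)) - (\<integral>b. y N b \<partial>T k) \<le> \<epsilon> * (\<integral>b. - G k b \<partial>\<pi> k)" for N
  proof -
    let ?l = "\<lambda>b. ln (\<integral>a. exp (f N a) \<partial>gibbs (w (Suc k) b))"
    have lm[measurable]: "?l \<in> borel_measurable borel"
      using tf.measurable_ln_kernel_exp[OF f fN, of "Suc k" N] by (simp add: tf_kernel)
    have lb: "\<bar>?l b\<bar> \<le> real N" for b
      using tf.ln_kernel_exp_bound[OF f fN, of "Suc k" b N] by (simp add: tf_kernel)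
    have lint: "integrable (T k) ?l" using lb by (intro T.integrable_const_bound[of _ "real N"]) auto
    have ly: "?l b \<le> y N b" for b
    proof -
      interpret K: prob_space "gibbs (w (Suc k) b)"
        using tf.prob_space_kernel[of "Suc k" b] by (simp add: tf_kernel)
      have pos: "0 < (\<integral>a. exp (f N a) \<partial>gibbs (w (Suc k) b))" and i: "integrable (gibbs (w (Suc k) b)) (\<lambda>a. exp (f N a))"
        using prob_space_bounded_exp_integral_pos[OF K.prob_space_axioms _ fN, of N] by auto
      have "ennreal (\<integral>a. exp (f N a) \<partial>gibbs (w (Suc k) b)) = (\<integral>\<^sup>+a. ennreal (exp (f N a)) \<partial>gibbs (w (Suc k) b))"
        using i by (intro nn_integral_eq_integral[symmetric]) auto
      also have "\<dots> \<le> (\<integral>\<^sup>+a. ennreal (exp (F a)) + ennreal (exp (- real N)) \<partial>gibbs (w (Suc k) b))"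
      proof (rule nn_integral_mono)
        fix a
        have "exp (f N a) \<le> exp (F a) + exp (- real N)"
          using exp_gt_zero[of "F a"] exp_gt_zero[of "- real N"] by (cases "- real N \<le> F a") (auto simp: f_def max_def min_def intro: order_trans[of _ "exp (F a)"])
        then show "ennreal (exp (f N a)) \<le> ennreal (exp (F a)) + ennreal (exp (- real N))"
          by (simp add: ennreal_leI flip: ennreal_plus)
      qed
      also have "\<dots> = ennreal (exp (- g b) + exp (- real N))"
        using K.emeasure_space_1 by (subst nn_integral_add) (auto simp: Fg ennreal_plus)
      finally have "(\<integral>a. exp (f N a) \<partial>gibbs (w (Suc k) b)) \<le> exp (- g b) + exp (- real N)"
        by (subst (asm) ennreal_le_iff) (auto simp: add_nonneg_nonneg)
      then show ?thesis unfolding y_def using pos by (intro ln_mono) auto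
    qed
    have "(\<integral>b. ?l b \<partial>T k) \<le> (\<integral>b. y N b \<partial>T k)"
      by (rule integral_mono[OF lint yint ly])
    then show ?thesis using truncated_duality[OF G dt \<epsilon> f fN, of N] by linarith
  qed
  have lim1: "(\<lambda>N. \<integral>a. f N a \<partial>gibbs (E k)) \<longlonglongrightarrow> (\<integral>a. F a \<partial>gibbs (E k))"
  proof (rule integral_dominated_convergence[where w = "\<lambda>a. \<bar>F a\<bar>"])
    show "AE a in gibbs (E k). (\<lambda>N. f N a) \<longlonglongrightarrow> F a"
    proof (rule AE_I2)
      fix a
      obtain N0 :: nat where "\<bar>F a\<bar> \<le> real N0" using real_arch_simple by blast
      then have "\<forall>\<^sub>F N in sequentially. f N a = F a"
        by (intro eventually_sequentiallyI[of N0]) (auto simp: f_def max_def min_def abs_le_iff)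
      then show "(\<lambda>N. f N a) \<longlonglongrightarrow> F a" by (rule tendsto_eventually)
    qed
    show "AE a in gibbs (E k). norm (f N a) \<le> \<bar>F a\<bar>" for N
      by (auto simp: f_def max_def min_def)
  qed (use F in auto)
  have lim2: "(\<lambda>N. \<integral>b. y N b \<partial>T k) \<longlonglongrightarrow> (\<integral>b. - g b \<partial>T k)"
  proof (rule integral_dominated_convergence[where w = "\<lambda>b. ln 2 + \<bar>g b\<bar>"])
    show "AE b in T k. (\<lambda>N. y N b) \<longlonglongrightarrow> - g b"
    proof (rule AE_I2)
      fix b
      have "(\<lambda>N. exp (- real N)) \<longlonglongrightarrow> 0"
        by (intro filterlim_compose[OF exp_at_bot] filterlim_compose[OF filterlim_uminus_at_bot_at_top] filterlim_real_sequentially)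
      then have "(\<lambda>N. ln (exp (- g b) + exp (- real N))) \<longlonglongrightarrow> ln (exp (- g b) + 0)"
        by (intro tendsto_ln tendsto_add tendsto_const) auto
      then show "(\<lambda>N. y N b) \<longlonglongrightarrow> - g b" by (simp add: y_def)
    qed
  qed (use g y_bd in auto)
  have "(\<integral>a. F a \<partial>gibbs (E k)) - (\<integral>b. - g b \<partial>T k) \<le> \<epsilon> * (\<integral>b. - G k b \<partial>\<pi> k)"
    by (rule tendsto_upperbound[OF tendsto_diff[OF lim1 lim2]]) (use step in auto)
  then show ?thesis by simp
qed

lemma E_period': "E (k + 2 * i) = E k"
  by (induction i) (auto simp: E_period)

lemma iterated_half_steps:
  "E (Suc k) b + w (Suc k + 2 * j) b a
    = E (Suc k) b + w (Suc k) b a - (\<Sum>i<j. G (Suc k + 2 * i) a) - (\<Sum>i<j. G (k + 2 + 2 * i) b)"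
proof (induction j)
  case (Suc j)
  let ?m = "Suc k + 2 * j"
  have steps: "E (Suc ?m) a + w (Suc ?m) a b = E ?m b + w ?m b a - G ?m a"
    "E (Suc (Suc ?m)) b + w (Suc (Suc ?m)) b a = E (Suc ?m) a + w (Suc ?m) a b - G (Suc ?m) b"
    by (rule half_step)+
  have period: "E ?m = E (Suc k)" "E (Suc (Suc ?m)) = E (Suc k)"
    using E_period'[of "Suc k" j] by (simp_all add: E_period)
  have index: "Suc k + 2 * Suc j = Suc (Suc ?m)" "k + 2 + 2 * j = Suc ?m" by simp_all
  show ?case
    using steps Suc.IH unfolding index(1) sum.lessThan_Suc period index(2) by linarith
qed simp

lemma sum_entropy_le:
  assumes G: "\<And>i. integrable (T i) (G i)" and \<pi>: "integrable (\<pi> k) (G k)"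
    and dt: "tf.dual_transport (Suc k) (T k) \<epsilon>" and \<epsilon>: "0 < \<epsilon>"
  shows "(\<Sum>i<2 * j. \<integral>b. G (Suc k + i) b \<partial>T (Suc k + i)) \<le> \<epsilon> * (\<integral>b. - G k b \<partial>\<pi> k)"
proof -
  let ?F = "\<lambda>a. \<Sum>i<j. G (Suc k + 2 * i) a" and ?g = "\<lambda>b. \<Sum>i<j. G (k + 2 + 2 * i) b"
  have T1: "T (Suc k + 2 * i) = gibbs (E k)" and T2: "T (k + 2 + 2 * i) = T k" for i
    using E_period'[of "Suc (Suc k)" i] E_period'[of "Suc (Suc (Suc k))" i] by (simp_all add: E_period)
  have GF: "integrable (gibbs (E k)) (G (Suc k + 2 * i))" and Gg: "integrable (T k) (G (k + 2 + 2 * i))" for i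
    using G[of "Suc k + 2 * i"] G[of "k + 2 + 2 * i"] unfolding T1 T2 by auto
  have "(\<integral>a. ?F a \<partial>gibbs (E k)) + (\<integral>b. ?g b \<partial>T k) \<le> \<epsilon> * (\<integral>b. - G k b \<partial>\<pi> k)"
  proof (rule duality[OF \<pi> dt \<epsilon>])
    show "integrable (gibbs (E k)) ?F" "integrable (T k) ?g" using GF Gg by (auto intro!: Bochner_Integration.integrable_sum)
    fix b
    have "exp (- w (Suc k) b a) * exp (?F a) = exp (- ?g b) * exp (- w (Suc k + 2 * j) b a)" for a
      using iterated_half_steps[of k b j a] by (simp add: exp_add[symmetric] algebra_simps)
    then have "(\<integral>\<^sup>+a. ennreal (exp (?F a)) \<partial>gibbs (w (Suc k) b)) = (\<integral>\<^sup>+a. ennreal (exp (- ?g b)) * ennreal (exp (- w (Suc k + 2 * j) b a)) \<partial>lborel)"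
      unfolding gibbs_def by (subst nn_integral_density) (auto intro!: nn_integral_cong simp: ennreal_mult[symmetric])
    then show "(\<integral>\<^sup>+a. ennreal (exp (?F a)) \<partial>gibbs (w (Suc k) b)) = ennreal (exp (- ?g b))"
      by (simp add: nn_integral_cmult w_prob)
  qed
  moreover have "(\<integral>a. ?F a \<partial>gibbs (E k)) = (\<Sum>i<j. \<integral>b. G (Suc k + 2 * i) b \<partial>T (Suc k + 2 * i))"
    unfolding T1 using GF by (rule Bochner_Integration.integral_sum)
  moreover have "(\<integral>b. ?g b \<partial>T k) = (\<Sum>i<j. \<integral>b. G (k + 2 + 2 * i) b \<partial>T (k + 2 + 2 * i))"
    unfolding T2 using Gg by (rule Bochner_Integration.integral_sum)
  moreover have "(\<Sum>i<2 * j. x i) = (\<Sum>i<j. x (2 * i)) + (\<Sum>i<j. x (Suc (2 * i)))" for x :: "nat \<Rightarrow> real"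
    by (induction j) auto
  ultimately show ?thesis by simp
qed

end

lemma \<phi>_properties:
  assumes "0 < \<epsilon>"
  shows "0 < \<phi> \<epsilon>" "\<phi> \<epsilon> * (1 + \<phi> \<epsilon>) = inverse \<epsilon>"
proof -
  define s where "s = sqrt (1 / 4 + inverse \<epsilon>)"
  have s: "s\<^sup>2 = 1 / 4 + inverse \<epsilon>" "0 \<le> s" using assms by (auto simp: s_def)
  have eq: "\<phi> \<epsilon> = s - 1 / 2"
  proof -
    have eq: "inverse \<epsilon> = (s - 1 / 2) * (s + 1 / 2)" using s by (simp add: algebra_simps power2_eq_square)
    have "\<phi> \<epsilon> = inverse \<epsilon> / (s + 1 / 2)" by (simp add: \<phi>_def s_def)
    also have "\<dots> = s - 1 / 2" unfolding eq using s(2) by simp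
    finally show ?thesis .
  qed
  show "\<phi> \<epsilon> * (1 + \<phi> \<epsilon>) = inverse \<epsilon>" using s unfolding eq by (simp add: algebra_simps power2_eq_square)
  show "0 < \<phi> \<epsilon>" using assms s(2) by (simp add: \<phi>_def s_def[symmetric] add_nonneg_pos)
qed

text \<open>The rate solves \<open>\<phi> (1 + \<phi>) = 1 / \<epsilon>\<close>, so that \<open>a k + \<phi> a (k + 1)\<close> contracts by the factor \<open>1 + \<phi>\<close>.\<close>

lemma two_step_recursion_decay:
  fixes a :: "nat \<Rightarrow> real"
  assumes \<epsilon>: "0 < \<epsilon>" and a: "\<And>k. 0 \<le> a k" "\<And>k. a (Suc k) \<le> a k"
    and rec: "\<And>k. a (k + 2) \<le> \<epsilon> * (a k - a (Suc k))" and n: "2 \<le> n"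
  shows "a (n + m) \<le> inverse ((1 + \<phi> \<epsilon>) ^ (n - 2)) * a m"
proof -
  define f where "f = \<phi> \<epsilon>"
  have f: "0 < f" "f * (1 + f) = inverse \<epsilon>" unfolding f_def using \<phi>_properties[OF \<epsilon>] by auto
  define Z where "Z k = a k + f * a (Suc k)" for k
  have step: "(1 + f) * Z (Suc k) \<le> Z k" for k
  proof -
    have "inverse \<epsilon> * a (k + 2) \<le> inverse \<epsilon> * (\<epsilon> * (a k - a (Suc k)))"
      using \<epsilon> by (intro mult_left_mono rec) auto
    also have "inverse \<epsilon> * (\<epsilon> * (a k - a (Suc k))) = a k - a (Suc k)" using \<epsilon> by simp
    finally have "f * (1 + f) * a (k + 2) \<le> a k - a (Suc k)" by (simp only: f)
    then show ?thesis by (simp add: Z_def algebra_simps)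
  qed
  have "(1 + f) ^ j * Z (m + j) \<le> Z m" for j
  proof (induction j)
    case (Suc j)
    have "(1 + f) ^ Suc j * Z (m + Suc j) = (1 + f) ^ j * ((1 + f) * Z (Suc (m + j)))" by simp
    also have "\<dots> \<le> (1 + f) ^ j * Z (m + j)" using f step by (intro mult_left_mono) auto
    also note Suc
    finally show ?case .
  qed simp
  from this[of n] have "(1 + f) ^ n * Z (m + n) \<le> Z m" .
  moreover have "a (n + m) \<le> Z (m + n)" using f a(1)[of "Suc (m + n)"] by (simp add: Z_def add.commute)
  moreover have "Z m \<le> (1 + f) * a m" using f a(2)[of m] by (simp add: Z_def algebra_simps)
  moreover from calculation(2) have "(1 + f) ^ n * a (n + m) \<le> (1 + f) ^ n * Z (m + n)"
    using f by (intro mult_left_mono) auto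
  ultimately have "(1 + f) ^ n * a (n + m) \<le> (1 + f) * a m" by linarith
  also have "\<dots> \<le> (1 + f)\<^sup>2 * a m" using f a(1)[of m] by (intro mult_right_mono) (auto simp: power2_eq_square)
  finally have "(1 + f) ^ n * a (n + m) \<le> (1 + f)\<^sup>2 * a m" .
  moreover have "(1 + f) ^ n = (1 + f)\<^sup>2 * (1 + f) ^ (n - 2)"
    using n by (metis le_add_diff_inverse power_add)
  ultimately have "(1 + f)\<^sup>2 * ((1 + f) ^ (n - 2) * a (n + m)) \<le> (1 + f)\<^sup>2 * a m" by simp
  then have "(1 + f) ^ (n - 2) * a (n + m) \<le> a m" using f by (simp add: mult_le_cancel_left_pos)
  then show ?thesis using f by (simp add: f_def[symmetric] field_simps)
qed

context sinkhorn_potentials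
begin

definition S :: "nat \<Rightarrow> (real^'d) \<times> (real^'d) \<Rightarrow> real" where
  "S k z = (if even k then E k (fst z) + w k (fst z) (snd z) else E k (snd z) + w k (snd z) (fst z))"

definition bridge :: "nat \<Rightarrow> ((real^'d) \<times> (real^'d)) measure" where
  "bridge k = density lborel (\<lambda>z. ennreal (exp (- S k z)))"

definition proj :: "nat \<Rightarrow> (real^'d) \<times> (real^'d) \<Rightarrow> real^'d" where
  "proj k = (if even k then snd else fst)"

abbreviation marginal_couplings :: "((real^'d) \<times> (real^'d)) measure set" where
  "marginal_couplings \<equiv> couplings (gibbs (E 0)) (gibbs (E (Suc 0)))"

lemma measurable_S[measurable]: "S k \<in> borel_measurable borel"
  unfolding S_def by (cases "even k") auto

lemma measurable_proj[measurable]: "proj k \<in> borel \<rightarrow>\<^sub>M borel"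
  unfolding proj_def by auto

lemma S_Suc: "S (Suc k) z = S k z - G k (proj k z)"
  using half_step[of k "snd z" "fst z"] half_step[of k "fst z" "snd z"] by (simp add: S_def proj_def)

lemma E_parity: "E k = (if even k then E 0 else E (Suc 0))"
proof -
  have "E (k mod 2 + 2 * (k div 2)) = E (k mod 2)" by (rule E_period')
  then show ?thesis by (auto simp: even_iff_mod_2_eq_zero odd_iff_mod_2_eq_one)
qed

lemma bridge_eq: "bridge k = (if even k then J k else distr (J k) borel prod.swap)"
proof (cases "even k")
  case True
  then show ?thesis by (auto simp: bridge_def J_def S_def intro!: density_cong)
next
  case False
  then show ?thesis unfolding J_def by (simp add: bridge_def, subst distr_density_swap) (auto simp: S_def intro!: density_cong)
qed

lemma bridge_prob: "prob_space (bridge k)"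
  unfolding bridge_eq using J_prob[of k] by (auto intro!: prob_space.prob_space_distr simp: J_def)

lemma nn_integral_S: "(\<integral>\<^sup>+z. ennreal (exp (- S k z)) \<partial>lborel) = 1"
  using prob_space.emeasure_space_1[OF bridge_prob[of k]] by (simp add: bridge_def emeasure_density cong: nn_integral_cong)

lemma coupling_proj:
  assumes "Q \<in> marginal_couplings"
  shows "distr Q borel (proj k) = T k"
  using assms E_parity[of "Suc k"] by (auto simp: couplings_def proj_def)

lemma G_T_nonneg:
  assumes "integrable (T k) (G k)"
  shows "0 \<le> (\<integral>b. G k b \<partial>T k)"
proof -
  interpret T: prob_space "T k" by (rule E_prob)
  have [measurable_cong]: "sets (T k) = sets borel" by (simp add: gibbs_def)
  show ?thesis
  proof (rule T.gibbs_inequality(2)[OF _ _ assms])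
    have "exp (- E (Suc k) b) * exp (- G k b) = p k b" for b
      using p_exp_G[of k b] by (simp add: exp_minus field_simps)
    then have "(\<integral>\<^sup>+b. ennreal (exp (- G k b)) \<partial>T k) = (\<integral>\<^sup>+b. ennreal (p k b) \<partial>lborel)"
      unfolding gibbs_def by (subst nn_integral_density) (auto intro!: nn_integral_cong simp: ennreal_mult[symmetric])
    then show "(\<integral>\<^sup>+b. ennreal (exp (- G k b)) \<partial>T k) \<le> 1" by (simp add: nn_integral_p)
  qed measurable
qed

context
  fixes Q q
  assumes Q: "Q \<in> marginal_couplings" and q[measurable]: "q \<in> borel_measurable borel" and q0: "\<And>z. 0 \<le> q z"
    and Qq: "Q = density lborel (\<lambda>z. ennreal (q z))"
begin

lemma Q_prob: "prob_space Q"
  using Q by (simp add: couplings_def)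

lemma gibbs_Q:
  shows "integrable Q (\<lambda>z. max 0 (- (ln (q z) + S k z)))"
    and "integrable Q (\<lambda>z. ln (q z) + S k z) \<Longrightarrow> 0 \<le> (\<integral>z. ln (q z) + S k z \<partial>Q)"
proof -
  interpret Q: prob_space Q by (rule Q_prob)
  have [measurable]: "(\<lambda>z. ln (q z) + S k z) \<in> borel_measurable Q"
    unfolding Qq by measurable
  have "(\<integral>\<^sup>+z. ennreal (exp (- (ln (q z) + S k z))) \<partial>Q) = (\<integral>\<^sup>+z. ennreal (q z) * ennreal (exp (- (ln (q z) + S k z))) \<partial>lborel)"
    unfolding Qq by (subst nn_integral_density) auto
  also have "\<dots> \<le> (\<integral>\<^sup>+z. ennreal (exp (- S k z)) \<partial>lborel)"
  proof (rule nn_integral_mono)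
    fix z
    have "q z * exp (- (ln (q z) + S k z)) \<le> exp (- S k z)"
    proof (cases "q z = 0")
      case False
      then have "0 < q z" using q0[of z] by simp
      then have "q z * exp (- ln (q z) + - S k z) = exp (- S k z)"
        unfolding exp_add exp_minus[of "ln (q z)"] by simp
      then show ?thesis by simp
    qed simp
    then show "ennreal (q z) * ennreal (exp (- (ln (q z) + S k z))) \<le> ennreal (exp (- S k z))"
      using q0[of z] by (simp add: ennreal_mult[symmetric] ennreal_leI)
  qed
  finally have le: "(\<integral>\<^sup>+z. ennreal (exp (- (ln (q z) + S k z))) \<partial>Q) \<le> 1" by (simp add: nn_integral_S)
  show "integrable Q (\<lambda>z. max 0 (- (ln (q z) + S k z)))"
    by (rule Q.gibbs_inequality(1)[OF _ le]) measurable
  show "integrable Q (\<lambda>z. ln (q z) + S k z) \<Longrightarrow> 0 \<le> (\<integral>z. ln (q z) + S k z \<partial>Q)"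
    by (rule Q.gibbs_inequality(2)[OF _ le]) measurable
qed

lemma G_proj:
  assumes "integrable (T k) (G k)"
  shows "integrable Q (\<lambda>z. G k (proj k z))" "(\<integral>z. G k (proj k z) \<partial>Q) = (\<integral>b. G k b \<partial>T k)"
proof -
  have [measurable]: "proj k \<in> Q \<rightarrow>\<^sub>M borel" unfolding Qq by measurable
  show "integrable Q (\<lambda>z. G k (proj k z))" "(\<integral>z. G k (proj k z) \<partial>Q) = (\<integral>b. G k b \<partial>T k)"
    using assms unfolding coupling_proj[OF Q, symmetric] by (auto simp: integrable_distr_eq integral_distr)
qed

lemma coupling_step:
  assumes int: "integrable Q (\<lambda>z. ln (q z) + S k z)"
  shows "integrable (T k) (G k)" "integrable Q (\<lambda>z. ln (q z) + S (Suc k) z)"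
    "(\<integral>z. ln (q z) + S (Suc k) z \<partial>Q) = (\<integral>z. ln (q z) + S k z \<partial>Q) - (\<integral>b. G k b \<partial>T k)"
proof -
  interpret T: prob_space "T k" by (rule E_prob)
  have [measurable_cong]: "sets (T k) = sets borel" by (simp add: gibbs_def)
  have [measurable]: "proj k \<in> Q \<rightarrow>\<^sub>M borel" unfolding Qq by measurable
  have "integrable (T k) (\<lambda>b. max 0 (- G k b))"
  proof (rule T.gibbs_inequality(1))
    have "exp (- E (Suc k) b) * exp (- G k b) = p k b" for b
      using p_exp_G[of k b] by (simp add: exp_minus field_simps)
    then have "(\<integral>\<^sup>+b. ennreal (exp (- G k b)) \<partial>T k) = (\<integral>\<^sup>+b. ennreal (p k b) \<partial>lborel)"
      unfolding gibbs_def by (subst nn_integral_density) (auto intro!: nn_integral_cong simp: ennreal_mult[symmetric])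
    then show "(\<integral>\<^sup>+b. ennreal (exp (- G k b)) \<partial>T k) \<le> 1" by (simp add: nn_integral_p)
  qed measurable
  then have dn: "integrable Q (\<lambda>z. max 0 (- G k (proj k z)))"
    unfolding coupling_proj[OF Q, symmetric] by (subst (asm) integrable_distr_eq) auto
  have "integrable Q (\<lambda>z. G k (proj k z))"
  proof (rule Bochner_Integration.integrable_bound)
    show "integrable Q (\<lambda>z. \<bar>ln (q z) + S k z\<bar> + max 0 (- (ln (q z) + S (Suc k) z)) + max 0 (- G k (proj k z)))"
      using int gibbs_Q(1)[of "Suc k"] dn by simp
    show "AE z in Q. norm (G k (proj k z)) \<le> norm (\<bar>ln (q z) + S k z\<bar> + max 0 (- (ln (q z) + S (Suc k) z)) + max 0 (- G k (proj k z)))"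
      unfolding S_Suc by (rule AE_I2) auto
  qed measurable
  then show G: "integrable (T k) (G k)"
    unfolding coupling_proj[OF Q, symmetric] by (subst integrable_distr_eq) auto
  have eq: "ln (q z) + S (Suc k) z = (ln (q z) + S k z) - G k (proj k z)" for z by (simp add: S_Suc)
  show "integrable Q (\<lambda>z. ln (q z) + S (Suc k) z)"
    "(\<integral>z. ln (q z) + S (Suc k) z \<partial>Q) = (\<integral>z. ln (q z) + S k z \<partial>Q) - (\<integral>b. G k b \<partial>T k)"
    unfolding eq using int G_proj[OF G] by auto
qed

lemma coupling_back:
  assumes G: "\<And>j. integrable (T j) (G j)" and int: "integrable Q (\<lambda>z. ln (q z) + S k z)"
  shows "integrable Q (\<lambda>z. ln (q z) + S 0 z) \<and>
    (\<integral>z. ln (q z) + S 0 z \<partial>Q) = (\<integral>z. ln (q z) + S k z \<partial>Q) + (\<Sum>j<k. \<integral>b. G j b \<partial>T j)"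
  using int
proof (induction k)
  case (Suc k)
  have eq: "ln (q z) + S k z = (ln (q z) + S (Suc k) z) + G k (proj k z)" for z by (simp add: S_Suc)
  have "integrable Q (\<lambda>z. ln (q z) + S k z)" unfolding eq using Suc.prems G_proj(1)[OF G, of k] by simp
  moreover have "(\<integral>z. ln (q z) + S k z \<partial>Q) = (\<integral>z. ln (q z) + S (Suc k) z \<partial>Q) + (\<integral>b. G k b \<partial>T k)"
    unfolding eq using Suc.prems G_proj[OF G, of k] by simp
  ultimately show ?case using Suc.IH by simp
qed simp

lemma rel_entropy_bridge:
  "rel_entropy Q (bridge k) = (if integrable Q (\<lambda>z. ln (q z) + S k z) then ereal (\<integral>z. ln (q z) + S k z \<partial>Q) else \<infinity>)"
  unfolding Qq bridge_def by (rule rel_entropy_density_gibbs) (use q0 in auto)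

end

theorem sinkhorn_contraction:
  assumes P: "P \<in> marginal_couplings" and fin: "rel_entropy P (bridge 0) < \<infinity>"
    and minimal: "\<And>Q. Q \<in> marginal_couplings \<Longrightarrow> rel_entropy P (bridge 0) \<le> rel_entropy Q (bridge 0)"
    and sg: "\<And>k. tf.subgaussian (Suc k) \<sigma>" and \<sigma>: "0 < \<sigma>"
    and dt: "\<And>k. tf.dual_transport (Suc k) (T k) \<epsilon>" and \<epsilon>: "0 < \<epsilon>"
    and growth: "\<And>b. c * (norm b)\<^sup>2 - C \<le> E (Suc 0) b" and c: "0 < c" and n: "2 \<le> n"
  shows "rel_entropy P (bridge (n + m)) \<le> ereal (inverse ((1 + \<phi> \<epsilon>) ^ (n - 2))) * rel_entropy P (bridge m)"
proof -
  obtain q where q[measurable]: "q \<in> borel_measurable borel" and q0: "\<And>z. 0 \<le> q z" and Pq: "P = density lborel (\<lambda>z. ennreal (q z))"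
  proof -
    have "prob_space P" "sets P = sets borel" using P by (auto simp: couplings_def)
    then show ?thesis
      using that rel_entropy_finite_imp_density[OF measurable_S[of 0], of P] fin unfolding bridge_def by blast
  qed
  note facts = P q q0 Pq
  have int: "integrable P (\<lambda>z. ln (q z) + S k z)" for k
  proof (induction k)
    case 0
    then show ?case using fin unfolding rel_entropy_bridge[OF facts] by (auto split: if_splits)
  next
    case (Suc k)
    then show ?case by (rule coupling_step(2)[OF facts])
  qed
  have G: "integrable (T k) (G k)" for k by (rule coupling_step(1)[OF facts int])
  define a where "a k = (\<integral>z. ln (q z) + S k z \<partial>P)" for k
  define h where "h k = (\<integral>b. G k b \<partial>T k)" for k
  have ent: "rel_entropy P (bridge k) = ereal (a k)" for k
    using int[of k] unfolding rel_entropy_bridge[OF facts] by (simp add: a_def)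
  have a0: "0 \<le> a k" for k unfolding a_def by (rule gibbs_Q(2)[OF facts int])
  have aS: "a (Suc k) = a k - h k" for k unfolding a_def h_def by (rule coupling_step(3)[OF facts int])
  have h0: "0 \<le> h k" for k unfolding h_def by (rule G_T_nonneg[OF G])
  have a_min: "a k \<le> x" if "Q \<in> marginal_couplings" "rel_entropy Q (bridge k) \<le> ereal x" for Q k x
  proof -
    have "rel_entropy Q (bridge k) < \<infinity>" using that(2) by (auto intro: le_less_trans)
    moreover have "prob_space Q" "sets Q = sets borel" using that(1) by (auto simp: couplings_def)
    ultimately obtain r where r: "r \<in> borel_measurable borel" "\<And>z. 0 \<le> r z" "Q = density lborel (\<lambda>z. ennreal (r z))"
      using rel_entropy_finite_imp_density[OF measurable_S[of k], of Q] unfolding bridge_def by blast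
    note factsQ = that(1) r
    have intQ: "integrable Q (\<lambda>z. ln (r z) + S k z)" and le: "(\<integral>z. ln (r z) + S k z \<partial>Q) \<le> x"
      using that(2) unfolding rel_entropy_bridge[OF factsQ] by (auto split: if_splits)
    have "ereal (a 0) \<le> rel_entropy Q (bridge 0)" using minimal[OF that(1)] by (simp add: ent)
    then have "a 0 \<le> (\<integral>z. ln (r z) + S k z \<partial>Q) + (\<Sum>j<k. h j)"
      using coupling_back[OF factsQ G intQ] unfolding rel_entropy_bridge[OF factsQ] by (simp add: h_def)
    moreover have "a 0 = a k + (\<Sum>j<k. h j)" by (induction k) (auto simp: aS)
    ultimately show ?thesis using le by linarith
  qed
  have "decseq a" by (rule decseq_SucI) (use aS h0 in simp)
  then obtain A where A: "a \<longlonglongrightarrow> A" using decseq_convergent[of a 0] a0 by blast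
  have A0: "0 \<le> A" by (rule LIMSEQ_le_const[OF A]) (use a0 in auto)
  have h_lim: "h \<longlonglongrightarrow> 0"
  proof -
    have "h = (\<lambda>k. a k - a (Suc k))" using aS by (auto simp: fun_eq_iff)
    then show ?thesis using tendsto_diff[OF A LIMSEQ_Suc[OF A]] by simp
  qed
  have \<pi>G: "integrable (\<pi> (Suc k)) (G (Suc k))" and h': "(\<integral>b. - G (Suc k) b \<partial>\<pi> (Suc k)) \<le> h k" for k
    using entropy_decrease[OF G, of k] by (auto simp: h_def)
  obtain K l0 where l0: "0 < l0" and K: "\<And>p l. 0 < l \<Longrightarrow> l \<le> l0 \<Longrightarrow> p \<in> borel_measurable borel \<Longrightarrow> (\<And>b. 0 < p b) \<Longrightarrow>
      (\<integral>\<^sup>+b. ennreal (p b) \<partial>lborel) = 1 \<Longrightarrow> integrable lborel (\<lambda>b. p b * (ln (p b) + E (Suc 0) b)) \<Longrightarrow>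
      integrable lborel (\<lambda>b. \<bar>p b - exp (- E (Suc 0) b)\<bar> * (norm b)\<^sup>2) \<and>
      (\<integral>b. \<bar>p b - exp (- E (Suc 0) b)\<bar> * (norm b)\<^sup>2 \<partial>lborel) \<le> (\<integral>b. p b * (ln (p b) + E (Suc 0) b) \<partial>lborel) / l + l * K"
    by (rule weighted_variation_le[OF E_measurable E_prob c growth]) blast
  have comp: "a (2 * i + 3) \<le> \<sigma> * (h (2 * i + 1) / l + l * K)" if l: "0 < l" "l \<le> l0" for i l
  proof -
    define j where "j = 2 * i + 2"
    have j: "even j" "j = Suc (2 * i + 1)" by (simp_all add: j_def)
    have Ek: "E j = E 0" "E (Suc j) = E (Suc 0)" using E_parity[of j] E_parity[of "Suc j"] j(1) by auto
    have pG: "p j b * (ln (p j b) + E (Suc 0) b) = p j b * - G j b" for b by (simp add: G_def Ek)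
    have "integrable (\<pi> j) (G j)" using \<pi>G[of "2 * i + 1"] unfolding j(2) .
    then have pint: "integrable lborel (\<lambda>b. p j b * (ln (p j b) + E (Suc 0) b))"
      unfolding pG using p_pos by (subst (asm) integrable_real_density) (auto simp: less_imp_le)
    have pval: "(\<integral>b. p j b * (ln (p j b) + E (Suc 0) b) \<partial>lborel) \<le> h (2 * i + 1)"
      using h'[of "2 * i + 1"] unfolding pG j(2)[symmetric]
      by (subst (asm) integral_real_density) (auto simp: less_imp_le p_pos)
    let ?X = "\<integral>b. \<bar>p j b - exp (- E (Suc 0) b)\<bar> * (norm b)\<^sup>2 \<partial>lborel"
    have X: "integrable lborel (\<lambda>b. \<bar>p j b - exp (- E (Suc 0) b)\<bar> * (norm b)\<^sup>2)"
      "?X \<le> (\<integral>b. p j b * (ln (p j b) + E (Suc 0) b) \<partial>lborel) / l + l * K"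
      using K[OF l p_measurable p_pos nn_integral_p pint] by auto
    have mix: "(\<integral>\<^sup>+b. ennreal (p j b * tf.k (Suc j) b a) \<partial>lborel) = ennreal (exp (- E 0 a))" for a
    proof -
      have "p j b * tf.k (Suc j) b a = exp (- E 0 a) * exp (- w j a b)" for b
        using J_eq[of j a b] by (simp add: tf_k Ek exp_add[symmetric])
      then show ?thesis by (simp add: ennreal_mult nn_integral_cmult w_prob)
    qed
    have br: "density lborel (\<lambda>(a, b). ennreal (exp (- E (Suc 0) b) * tf.k (Suc j) b a)) = bridge (Suc j)"
      unfolding bridge_def by (intro density_cong) (auto simp: S_def tf_k Ek j(1) exp_add[symmetric])
    have "\<exists>Q\<in>marginal_couplings. rel_entropy Q (density lborel (\<lambda>(a, b). ennreal (exp (- E (Suc 0) b) * tf.k (Suc j) b a))) \<le> ereal (\<sigma> * ?X)"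
      by (rule tf.competitor_coupling[OF sg \<sigma> E_measurable E_measurable p_measurable p_pos E_prob E_prob nn_integral_p mix X(1)])
    then obtain Q where "Q \<in> marginal_couplings" "rel_entropy Q (bridge (Suc j)) \<le> ereal (\<sigma> * ?X)"
      unfolding br by blast
    then have "a (Suc j) \<le> \<sigma> * ?X" by (rule a_min)
    also have "\<dots> \<le> \<sigma> * (h (2 * i + 1) / l + l * K)"
    proof (rule mult_left_mono)
      have "(\<integral>b. p j b * (ln (p j b) + E (Suc 0) b) \<partial>lborel) / l \<le> h (2 * i + 1) / l"
        using pval l by (intro divide_right_mono) auto
      then show "?X \<le> h (2 * i + 1) / l + l * K" using X(2) by linarith
    qed (use \<sigma> in simp)
    finally show ?thesis by (simp add: j_def numeral_3_eq_3)
  qed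
  have A_le: "A \<le> \<sigma> * (l * K)" if l: "0 < l" "l \<le> l0" for l
  proof (rule LIMSEQ_le)
    show "(\<lambda>i. a (2 * i + 3)) \<longlonglongrightarrow> A"
      by (rule LIMSEQ_subseq_LIMSEQ[OF A, of "\<lambda>i. 2 * i + 3", unfolded o_def]) (auto simp: strict_mono_def)
    have "(\<lambda>i. h (2 * i + 1)) \<longlonglongrightarrow> 0"
      by (rule LIMSEQ_subseq_LIMSEQ[OF h_lim, of "\<lambda>i. 2 * i + 1", unfolded o_def]) (auto simp: strict_mono_def)
    then have "(\<lambda>i. \<sigma> * (h (2 * i + 1) / l + l * K)) \<longlonglongrightarrow> \<sigma> * (0 / l + l * K)"
      using l by (intro tendsto_intros) auto
    then show "(\<lambda>i. \<sigma> * (h (2 * i + 1) / l + l * K)) \<longlonglongrightarrow> \<sigma> * (l * K)" by simp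
  qed (use comp[OF l] in auto)
  have "A \<le> 0"
  proof (rule tendsto_lowerbound)
    show "((\<lambda>l. \<sigma> * (l * K)) \<longlongrightarrow> 0) (at_right 0)" by (auto intro!: tendsto_eq_intros)
    show "\<forall>\<^sub>F l in at_right 0. A \<le> \<sigma> * (l * K)"
      using A_le l0 by (intro eventually_at_rightI[of 0 l0]) auto
  qed simp
  with A0 have "A = 0" by simp
  have rec: "a (k + 2) \<le> \<epsilon> * (a k - a (Suc k))" for k
  proof -
    have le: "a (k + 2) - a (k + 2 + 2 * j) \<le> \<epsilon> * h k" for j
    proof -
      have "a (k + 2) - a (k + 2 + i) = (\<Sum>i<i. h (k + 2 + i))" for i
        by (induction i) (auto simp: aS)
      then have "a (k + 2) - a (k + 2 + 2 * j) = (\<Sum>i<2 * j. h (Suc (Suc k) + i))" by simp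
      also have "\<dots> \<le> \<epsilon> * (\<integral>b. - G (Suc k) b \<partial>\<pi> (Suc k))"
        unfolding h_def by (rule sum_entropy_le[OF G \<pi>G dt \<epsilon>])
      also have "\<dots> \<le> \<epsilon> * h k" using h' \<epsilon> by (intro mult_left_mono) auto
      finally show ?thesis .
    qed
    have "(\<lambda>j. a (k + 2 + 2 * j)) \<longlonglongrightarrow> A"
      by (rule LIMSEQ_subseq_LIMSEQ[OF A, of "\<lambda>j. k + 2 + 2 * j", unfolded o_def]) (auto simp: strict_mono_def)
    then have "(\<lambda>j. a (k + 2) - a (k + 2 + 2 * j)) \<longlonglongrightarrow> a (k + 2) - A" by (intro tendsto_intros)
    then have "a (k + 2) - A \<le> \<epsilon> * h k" by (rule LIMSEQ_le_const2) (use le in auto)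
    then show ?thesis using \<open>A = 0\<close> aS[of k] by simp
  qed
  have "a (n + m) \<le> inverse ((1 + \<phi> \<epsilon>) ^ (n - 2)) * a m"
    by (rule two_step_recursion_decay[OF \<epsilon> a0 _ rec n]) (use aS h0 in simp)
  then show ?thesis by (simp add: ent)
qed

end

section \<open>Sinkhorn transitions with a Gaussian reference\<close>

lemma continuous_AE_lborel_eq:
  fixes f g :: "'a::euclidean_space \<Rightarrow> real"
  assumes "continuous_on UNIV f" "continuous_on UNIV g" "AE x in lborel. f x = g x"
  shows "f = g"
proof -
  let ?D = "{x. f x \<noteq> g x}"
  have op: "open ?D" using assms by (intro open_Collect_neq)
  have "?D \<in> null_sets lborel"
    using assms(3) AE_iff_null[of lborel "\<lambda>x. f x = g x"] borel_open[OF op] by simp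
  then have "negligible ?D" by (simp add: negligible_iff_null_sets null_sets_completionI)
  then have "?D = {}" using open_not_negligible[OF op] by blast
  then show ?thesis by (auto simp: fun_eq_iff)
qed

lemma density_lborel_exp_eq:
  fixes f g :: "'a::euclidean_space \<Rightarrow> real"
  assumes "continuous_on UNIV f" "continuous_on UNIV g"
    and eq: "density lborel (\<lambda>x. ennreal (exp (f x))) = density lborel (\<lambda>x. ennreal (exp (g x)))"
  shows "f = g"
proof (rule continuous_AE_lborel_eq[OF assms(1,2)])
  have [measurable]: "f \<in> borel_measurable borel" "g \<in> borel_measurable borel"
    using assms by (auto intro: borel_measurable_continuous_onI)
  have "AE x in lborel. ennreal (exp (f x)) = ennreal (exp (g x))"
    using eq by (intro sigma_finite_measure.density_unique[OF sigma_finite_lborel]) auto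
  then show "AE x in lborel. f x = g x" by (auto elim!: AE_mp)
qed

lemma emeasure_kernel_prod:
  fixes K :: "real^'d \<Rightarrow> (real^'d) measure"
  assumes \<mu>: "prob_space \<mu>" "sets \<mu> = sets borel" and K[measurable]: "K \<in> borel \<rightarrow>\<^sub>M prob_algebra borel"
    and A[measurable]: "A \<in> sets borel"
  shows "emeasure (kernel_prod \<mu> K) A = (\<integral>\<^sup>+x. emeasure (K x) (Pair x -` A) \<partial>\<mu>)"
proof -
  have sK: "sets (K x) = sets borel" for x
    using measurable_space[OF K, of x] by (simp add: space_prob_algebra)
  have [measurable]: "(\<lambda>x. distr (K x) borel (Pair x)) \<in> borel \<rightarrow>\<^sub>M prob_algebra (borel :: ((real^'d) \<times> (real^'d)) measure)"
    by (rule measurable_distr_prob_space2[OF K]) (simp add: borel_prod case_prod_unfold)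
  have "emeasure (kernel_prod \<mu> K) A = (\<integral>\<^sup>+x. emeasure (distr (K x) borel (Pair x)) A \<partial>\<mu>)"
    unfolding kernel_prod_def
    by (rule emeasure_bind_prob_algebra[where N = borel and L = borel]) (use \<mu> in \<open>auto simp: space_prob_algebra\<close>)
  also have "\<dots> = (\<integral>\<^sup>+x. emeasure (K x) (Pair x -` A) \<partial>\<mu>)"
  proof (rule nn_integral_cong)
    fix x
    have "Pair x \<in> K x \<rightarrow>\<^sub>M borel" by (subst measurable_cong_sets[OF sK refl]) simp
    then show "emeasure (distr (K x) borel (Pair x)) A = emeasure (K x) (Pair x -` A)"
      using sets_eq_imp_space_eq[OF sK[of x]] by (simp add: emeasure_distr)
  qed
  finally show ?thesis .
qed

lemma sets_kernel_prod:
  fixes K :: "real^'d \<Rightarrow> (real^'d) measure"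
  assumes \<mu>: "prob_space \<mu>" "sets \<mu> = sets borel" and K: "K \<in> borel \<rightarrow>\<^sub>M prob_algebra borel"
  shows "sets (kernel_prod \<mu> K) = sets borel"
  unfolding kernel_prod_def
  by (rule sets_bind) (use prob_space.not_empty[OF \<mu>(1)] in auto)

lemma kernel_prod_density:
  fixes w :: "real^'d \<Rightarrow> real^'d \<Rightarrow> real" and f :: "real^'d \<Rightarrow> real"
  assumes f[measurable]: "f \<in> borel_measurable borel" and f0: "\<And>a. 0 \<le> f a"
    and \<mu>: "prob_space (density lborel (\<lambda>a. ennreal (f a)))"
    and w: "(\<lambda>z. w (fst z) (snd z)) \<in> borel_measurable borel"
    and K: "gibbs_kernel w \<in> borel \<rightarrow>\<^sub>M prob_algebra borel"
  shows "kernel_prod (density lborel (\<lambda>a. ennreal (f a))) (gibbs_kernel w)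
    = density lborel (\<lambda>z. ennreal (f (fst z) * exp (- w (fst z) (snd z))))"
proof (rule measure_eqI)
  have sets: "sets (kernel_prod (density lborel (\<lambda>a. ennreal (f a))) (gibbs_kernel w)) = sets borel"
    by (rule sets_kernel_prod[OF \<mu> _ K]) simp
  then show "sets (kernel_prod (density lborel (\<lambda>a. ennreal (f a))) (gibbs_kernel w))
    = sets (density lborel (\<lambda>z. ennreal (f (fst z) * exp (- w (fst z) (snd z)))))" by simp
  fix A assume "A \<in> sets (kernel_prod (density lborel (\<lambda>a. ennreal (f a))) (gibbs_kernel w))"
  then have A[measurable]: "A \<in> sets borel" using sets by simp
  then have A': "A \<in> sets (lborel \<Otimes>\<^sub>M lborel)" by (metis lborel_prod sets_lborel)
  have [measurable]: "(\<lambda>b. w a b) \<in> borel_measurable borel" for a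
    using measurable_compose[OF _ w, of "Pair a" borel] by simp
  have [measurable]: "Pair a -` A \<in> sets borel" for a :: "real^'d"
    using measurable_sets[of "Pair a" borel borel A] by simp
  have "emeasure (kernel_prod (density lborel (\<lambda>a. ennreal (f a))) (gibbs_kernel w)) A
      = (\<integral>\<^sup>+a. emeasure (gibbs_kernel w a) (Pair a -` A) \<partial>density lborel (\<lambda>a. ennreal (f a)))"
    by (rule emeasure_kernel_prod[OF \<mu> _ K A]) simp
  also have "\<dots> = (\<integral>\<^sup>+a. ennreal (f a) * emeasure (gibbs_kernel w a) (Pair a -` A) \<partial>lborel)"
  proof (rule nn_integral_density)
    have "(\<lambda>a. emeasure (gibbs_kernel w a) (Pair a -` A)) \<in> borel_measurable borel"
    proof -
      have Sigma: "(SIGMA a:space borel. {b \<in> space borel. (a, b) \<in> A}) \<in> sets (borel \<Otimes>\<^sub>M borel)"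
        unfolding borel_prod by (rule back_subst[of "\<lambda>B. B \<in> sets borel", OF A]) auto
      have "(\<lambda>a. emeasure (gibbs_kernel w a) {b \<in> space (borel :: (real^'d) measure). (a, b) \<in> A}) \<in> borel_measurable borel"
        by (rule emeasure_measurable_subprob_algebra2[OF Sigma measurable_prob_algebraD[OF K]])
      then show ?thesis by (simp add: vimage_def)
    qed
    then show "(\<lambda>a. emeasure (gibbs_kernel w a) (Pair a -` A)) \<in> borel_measurable lborel" by simp
  qed simp
  also have "\<dots> = (\<integral>\<^sup>+a. \<integral>\<^sup>+b. ennreal (f a * exp (- w a b)) * indicator A (a, b) \<partial>lborel \<partial>lborel)"
  proof (rule nn_integral_cong)
    fix a
    have "ennreal (f a) * emeasure (gibbs_kernel w a) (Pair a -` A) = ennreal (f a) * (\<integral>\<^sup>+b. ennreal (exp (- w a b)) * indicator (Pair a -` A) b \<partial>lborel)"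
      by (simp add: gibbs_kernel_def gibbs_def emeasure_density)
    also have "\<dots> = (\<integral>\<^sup>+b. ennreal (f a) * (ennreal (exp (- w a b)) * indicator (Pair a -` A) b) \<partial>lborel)"
      by (rule nn_integral_cmult[symmetric]) measurable
    also have "\<dots> = (\<integral>\<^sup>+b. ennreal (f a * exp (- w a b)) * indicator A (a, b) \<partial>lborel)"
      using f0[of a] by (intro nn_integral_cong) (auto simp: ennreal_mult indicator_def)
    finally show "ennreal (f a) * emeasure (gibbs_kernel w a) (Pair a -` A) = (\<integral>\<^sup>+b. ennreal (f a * exp (- w a b)) * indicator A (a, b) \<partial>lborel)" .
  qed
  also have "\<dots> = (\<integral>\<^sup>+z. ennreal (f (fst z) * exp (- w (fst z) (snd z))) * indicator A z \<partial>(lborel \<Otimes>\<^sub>M lborel))"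
    using w A' by (subst lborel.nn_integral_fst[symmetric]) (auto simp: lborel_prod)
  also have "\<dots> = emeasure (density lborel (\<lambda>z. ennreal (f (fst z) * exp (- w (fst z) (snd z))))) A"
    using w by (simp add: lborel_prod emeasure_density)
  finally show "emeasure (kernel_prod (density lborel (\<lambda>a. ennreal (f a))) (gibbs_kernel w)) A
    = emeasure (density lborel (\<lambda>z. ennreal (f (fst z) * exp (- w (fst z) (snd z))))) A" .
qed

lemma bind_eq_distr_kernel_prod:
  fixes K :: "real^'d \<Rightarrow> (real^'d) measure"
  assumes \<mu>: "prob_space \<mu>" "sets \<mu> = sets borel" and K: "K \<in> borel \<rightarrow>\<^sub>M prob_algebra borel"
  shows "\<mu> \<bind> K = distr (kernel_prod \<mu> K) borel snd"
proof (rule measure_eqI)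
  have sets: "sets (\<mu> \<bind> K) = sets borel"
    by (rule sets_bind) (use prob_space.not_empty[OF \<mu>(1)] measurable_space[OF K] in \<open>auto simp: space_prob_algebra\<close>)
  then show "sets (\<mu> \<bind> K) = sets (distr (kernel_prod \<mu> K) borel snd)" by simp
  fix A assume "A \<in> sets (\<mu> \<bind> K)"
  then have A[measurable]: "A \<in> sets borel" using sets by simp
  have snd: "snd -` A \<in> sets (borel :: ((real^'d) \<times> (real^'d)) measure)"
    using measurable_sets[of "snd :: (real^'d) \<times> (real^'d) \<Rightarrow> _" borel borel A] by simp
  have m: "snd \<in> kernel_prod \<mu> K \<rightarrow>\<^sub>M borel"
    by (subst measurable_cong_sets[OF sets_kernel_prod[OF assms] refl]) simp
  have "emeasure (\<mu> \<bind> K) A = (\<integral>\<^sup>+x. emeasure (K x) A \<partial>\<mu>)"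
    by (rule emeasure_bind_prob_algebra[OF _ K A]) (use \<mu> in \<open>simp add: space_prob_algebra\<close>)
  also have "\<dots> = emeasure (kernel_prod \<mu> K) (snd -` A)"
    unfolding emeasure_kernel_prod[OF assms snd] by (simp add: vimage_def)
  also have "\<dots> = emeasure (distr (kernel_prod \<mu> K) borel snd) A"
    using sets_eq_imp_space_eq[OF sets_kernel_prod[OF assms]] by (subst emeasure_distr[OF m]) auto
  finally show "emeasure (\<mu> \<bind> K) A = emeasure (distr (kernel_prod \<mu> K) borel snd) A" .
qed

lemma transpose_matrix_inv:
  fixes \<tau> :: "real^'d^'d"
  assumes "pos_def \<tau>"
  shows "transpose (matrix_inv \<tau>) = matrix_inv \<tau>"
proof -
  have r: "\<tau> ** matrix_inv \<tau> = mat 1" by (rule matrix_inv_right[OF pos_def_imp_invertible[OF assms]])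
  have "transpose (matrix_inv \<tau>) ** \<tau> = transpose (\<tau> ** matrix_inv \<tau>)"
    using assms by (simp add: matrix_transpose_mul pos_def_def)
  also have "\<dots> = mat 1" unfolding r by (simp add: transpose_mat)
  finally have l: "transpose (matrix_inv \<tau>) ** \<tau> = mat 1" .
  have "transpose (matrix_inv \<tau>) = transpose (matrix_inv \<tau>) ** (\<tau> ** matrix_inv \<tau>)" by (simp add: r)
  also have "\<dots> = matrix_inv \<tau>" by (simp add: matrix_mul_assoc l)
  finally show ?thesis .
qed

lemma spec_norm_transpose: "spec_norm (transpose A) = spec_norm A" for A :: "real^'d^'d"
proof (rule antisym)
  have le: "spec_norm (transpose A) \<le> spec_norm A" for A :: "real^'d^'d"
    unfolding spec_norm_def[of "transpose A"]
    by (rule onorm_bound) (use norm_transpose_mult_le[of A] spec_norm_nonneg[of A] in auto)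
  from le[of A] le[of "transpose A"] show "spec_norm (transpose A) \<le> spec_norm A" "spec_norm A \<le> spec_norm (transpose A)"
    by simp_all
qed

lemma gauss_potential_eq:
  fixes \<tau> \<beta> :: "real^'d^'d"
  assumes \<tau>: "pos_def \<tau>"
  obtains c where "\<And>x y. gauss_potential \<tau> \<alpha> \<beta> x y
    = (y - (\<alpha> + \<beta> *v x)) \<bullet> (matrix_inv \<tau> *v (y - (\<alpha> + \<beta> *v x))) / 2 + c"
proof -
  define s where "s = sqrt (det ((2 * pi) *\<^sub>R \<tau>))"
  have "pos_def ((2 * pi) *\<^sub>R \<tau>)"
    using \<tau> by (auto simp: pos_def_def scaleR_matrix_vector_assoc[symmetric] transpose_def vec_eq_iff)
  then have "det ((2 * pi) *\<^sub>R \<tau>) \<noteq> 0" using pos_def_imp_invertible invertible_det_nz by blast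
  then have s: "s \<noteq> 0" by (simp add: s_def)
  have ln: "ln (exp r / s) = r - ln s" for r
  proof (cases "0 < s")
    case False
    then have "0 < - s" using s by simp
    then have "ln (exp r / - s) = r - ln (- s)" by (subst ln_div) auto
    then show ?thesis using ln_minus[of s] ln_minus[of "exp r / s"] by simp
  qed (simp add: ln_div)
  have "gauss_potential \<tau> \<alpha> \<beta> x y
    = (y - (\<alpha> + \<beta> *v x)) \<bullet> (matrix_inv \<tau> *v (y - (\<alpha> + \<beta> *v x))) / 2 + ln s" for x y
    unfolding gauss_potential_def gauss_density_def s_def[symmetric] ln by simp
  then show ?thesis by (rule that)
qed

lemma gauss_potential_shape:
  fixes \<tau> \<beta> :: "real^'d^'d"
  assumes \<tau>: "pos_def \<tau>"
  shows "gauss_potential \<tau> \<alpha> \<beta> x y = gauss_potential \<tau> \<alpha> \<beta> x 0 + gauss_potential \<tau> \<alpha> \<beta> 0 y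
    - gauss_potential \<tau> \<alpha> \<beta> 0 0 - x \<bullet> (transpose (matrix_inv \<tau> ** \<beta>) *v y)"
proof -
  let ?P = "matrix_inv \<tau>"
  obtain c where c: "\<And>x y. gauss_potential \<tau> \<alpha> \<beta> x y = (y - (\<alpha> + \<beta> *v x)) \<bullet> (?P *v (y - (\<alpha> + \<beta> *v x))) / 2 + c"
    using gauss_potential_eq[OF \<tau>] by blast
  have sym: "u \<bullet> (?P *v v) = v \<bullet> (?P *v u)" for u v
    using transpose_inner[of u ?P v] by (simp add: transpose_matrix_inv[OF \<tau>] inner_commute)
  have q: "(u + v) \<bullet> (?P *v (u + v)) = u \<bullet> (?P *v u) + v \<bullet> (?P *v v) + 2 * (u \<bullet> (?P *v v))" for u v
    using sym[of v u] by (simp add: matrix_vector_right_distrib inner_add_left inner_add_right)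
  have "y \<bullet> (?P *v (\<beta> *v x)) = x \<bullet> (transpose (?P ** \<beta>) *v y)"
  proof -
    have "y \<bullet> (?P *v (\<beta> *v x)) = y \<bullet> ((?P ** \<beta>) *v x)" by (simp add: matrix_vector_mul_assoc)
    also have "\<dots> = (transpose (?P ** \<beta>) *v y) \<bullet> x" by (rule transpose_inner)
    finally show ?thesis by (simp add: inner_commute)
  qed
  moreover define b where "b = - (\<beta> *v x)"
  ultimately have xy: "x \<bullet> (transpose (?P ** \<beta>) *v y) = - (y \<bullet> (?P *v b))"
    by (simp add: linear_neg[OF matrix_vector_mul_linear])
  define a where "a = - \<alpha>"
  have e: "y - (\<alpha> + \<beta> *v x) = (y + a) + b" "0 - (\<alpha> + \<beta> *v x) = a + b" "y - (\<alpha> + \<beta> *v 0) = y + a" "0 - (\<alpha> + \<beta> *v 0) = a"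
    by (simp_all add: a_def b_def)
  show ?thesis
    unfolding c xy e q
    by (simp add: matrix_vector_right_distrib inner_add_left inner_add_right add_divide_distrib)
qed

lemma (in tilted_family) convex_L: "convex_on UNIV L"
proof (rule convex_onI)
  have tan: "L b + (b' - b) \<bullet> mean b \<le> L b'" for b b'
  proof -
    have "(I (\<lambda>a. (0 - 0) * exp 0) b + (b' - b) \<bullet> J (\<lambda>a. exp 0) b) / I (\<lambda>a. exp 0) b
      \<le> ln (I (\<lambda>a. exp 0) b') - ln (I (\<lambda>a. exp 0) b)"
      by (rule gibbs_tilt[where N = 0]) auto
    moreover have "I (\<lambda>a. (0 - 0) * exp 0) b = 0" by (simp add: I_def)
    ultimately show ?thesis by (simp add: L_def mean_def divide_inverse mult.commute)
  qed
  fix t :: real and x y :: "real^'d" assume t: "0 < t" "t < 1"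
  let ?z = "(1 - t) *\<^sub>R x + t *\<^sub>R y"
  have "(1 - t) * (L ?z + (x - ?z) \<bullet> mean ?z) + t * (L ?z + (y - ?z) \<bullet> mean ?z) \<le> (1 - t) * L x + t * L y"
    using t tan by (intro add_mono mult_left_mono) auto
  moreover have "(1 - t) * ((x - ?z) \<bullet> mean ?z) + t * ((y - ?z) \<bullet> mean ?z) = 0"
  proof -
    have "(1 - t) *\<^sub>R (x - ?z) + t *\<^sub>R (y - ?z) = 0" by (simp add: algebra_simps)
    then show ?thesis by (metis inner_add_left inner_scaleR_left inner_zero_left)
  qed
  ultimately show "L ?z \<le> (1 - t) * L x + t * L y" by (simp add: algebra_simps)
qed simp

lemma (in tilted_family) subgaussian_mono: "subgaussian \<sigma> \<Longrightarrow> \<sigma> \<le> \<sigma>' \<Longrightarrow> subgaussian \<sigma>'"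
  unfolding subgaussian_def
  by (meson divide_right_mono mult_right_mono order_trans zero_le_numeral zero_le_power2)

lemma nn_integral_gibbs_kernel:
  assumes "gibbs_kernel w \<in> borel \<rightarrow>\<^sub>M prob_algebra borel" and [measurable]: "(\<lambda>b. w a b) \<in> borel_measurable borel"
  shows "(\<integral>\<^sup>+b. ennreal (exp (- w a b)) \<partial>lborel) = 1"
proof -
  have "prob_space (gibbs_kernel w a)" using measurable_space[OF assms(1), of a] by (simp add: space_prob_algebra)
  from prob_space.emeasure_space_1[OF this] show ?thesis
    by (simp add: gibbs_kernel_def gibbs_def emeasure_density cong: nn_integral_cong)
qed

context
  fixes E :: "real^'d \<Rightarrow> real" and w w' :: "real^'d \<Rightarrow> real^'d \<Rightarrow> real" and p :: "real^'d \<Rightarrow> real"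
  assumes E: "continuous_on UNIV E" "prob_space (gibbs E)"
    and w: "continuous_on UNIV (\<lambda>z. w (fst z) (snd z))" "gibbs_kernel w \<in> borel \<rightarrow>\<^sub>M prob_algebra borel"
    and w': "continuous_on UNIV (\<lambda>z. w' (fst z) (snd z))" "gibbs_kernel w' \<in> borel \<rightarrow>\<^sub>M prob_algebra borel"
    and p: "\<And>b. p b = (\<integral>a. exp (- w a b) \<partial>gibbs E)" "\<And>b. integrable (gibbs E) (\<lambda>a. exp (- w a b))"
      "continuous_on UNIV p"
begin

private lemma E_meas[measurable]: "E \<in> borel_measurable borel"
  using E by (auto intro: borel_measurable_continuous_onI)

private lemma p_meas[measurable]: "p \<in> borel_measurable borel"
  using p by (auto intro: borel_measurable_continuous_onI)

private lemma w_meas[measurable]: "(\<lambda>z. w (fst z) (snd z)) \<in> borel_measurable borel"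
  using w by (auto intro: borel_measurable_continuous_onI)

private lemma w'_meas[measurable]: "(\<lambda>z. w' (fst z) (snd z)) \<in> borel_measurable borel"
  using w' by (auto intro: borel_measurable_continuous_onI)

lemma normalising_constant_pos: "0 < p b"
proof -
  interpret prob_space "gibbs E" by (rule E)
  have "p b \<noteq> 0"
    unfolding p(1) using integral_nonneg_eq_0_iff_AE[OF p(2)[of b]] by simp
  moreover have "0 \<le> p b" unfolding p(1) by simp
  ultimately show ?thesis by simp
qed

lemma nn_integral_normalising_constant: "(\<integral>\<^sup>+a. ennreal (exp (- E a - w a b)) \<partial>lborel) = ennreal (p b)"
proof -
  have [measurable]: "(\<lambda>a. w a b) \<in> borel_measurable borel"
    using measurable_compose[OF _ w_meas, of "\<lambda>a. (a, b)" borel] by simp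
  have "ennreal (p b) = (\<integral>\<^sup>+a. ennreal (exp (- w a b)) \<partial>gibbs E)"
    unfolding p(1) by (rule nn_integral_eq_integral[symmetric, OF p(2)]) simp
  also have "\<dots> = (\<integral>\<^sup>+a. ennreal (exp (- E a)) * ennreal (exp (- w a b)) \<partial>lborel)"
    unfolding gibbs_def by (rule nn_integral_density) measurable
  finally show ?thesis by (simp add: ennreal_mult[symmetric] exp_add[symmetric])
qed

lemma kernel_prod_gibbs:
  "kernel_prod (gibbs E) (gibbs_kernel w) = density lborel (\<lambda>z. ennreal (exp (- E (fst z) - w (fst z) (snd z))))"
proof -
  have "kernel_prod (gibbs E) (gibbs_kernel w) = density lborel (\<lambda>z. ennreal (exp (- E (fst z)) * exp (- w (fst z) (snd z))))"
    unfolding gibbs_def by (rule kernel_prod_density[OF _ _ E(2)[unfolded gibbs_def] w_meas w(2)]) auto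
  then show ?thesis by (simp add: exp_add[symmetric])
qed

lemma bind_gibbs: "gibbs E \<bind> gibbs_kernel w = density lborel (\<lambda>b. ennreal (p b))"
proof -
  have "gibbs E \<bind> gibbs_kernel w = distr (kernel_prod (gibbs E) (gibbs_kernel w)) borel snd"
    by (rule bind_eq_distr_kernel_prod[OF E(2) _ w(2)]) (simp add: gibbs_def)
  then show ?thesis
    unfolding kernel_prod_gibbs by (subst (asm) distr_density_snd) (auto simp: nn_integral_normalising_constant)
qed

lemma sinkhorn_step_potential:
  assumes "kernel_prod (gibbs E) (gibbs_kernel w) = swap_measure (kernel_prod (gibbs E \<bind> gibbs_kernel w) (gibbs_kernel w'))"
  shows "w' b a = E a + w a b + ln (p b)"
proof -
  have prob: "prob_space (density lborel (\<lambda>b. ennreal (p b)))"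
    unfolding bind_gibbs[symmetric]
    by (rule prob_space_bind'[OF _ w(2)]) (use E in \<open>simp add: space_prob_algebra gibbs_def\<close>)
  have "kernel_prod (gibbs E \<bind> gibbs_kernel w) (gibbs_kernel w')
    = density lborel (\<lambda>z. ennreal (p (fst z) * exp (- w' (fst z) (snd z))))"
    unfolding bind_gibbs
    by (rule kernel_prod_density[OF _ _ prob w'_meas w'(2)]) (auto intro: less_imp_le normalising_constant_pos)
  then have "swap_measure (kernel_prod (gibbs E \<bind> gibbs_kernel w) (gibbs_kernel w'))
    = density lborel (\<lambda>z. ennreal (p (snd z) * exp (- w' (snd z) (fst z))))"
    unfolding swap_measure_def by (simp only:) (subst distr_density_swap; simp)
  also have "\<dots> = density lborel (\<lambda>z. ennreal (exp (ln (p (snd z)) - w' (snd z) (fst z))))"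
    using normalising_constant_pos by (simp add: exp_diff exp_minus divide_inverse)
  finally have "density lborel (\<lambda>z. ennreal (exp (- E (fst z) - w (fst z) (snd z))))
    = density lborel (\<lambda>z. ennreal (exp (ln (p (snd z)) - w' (snd z) (fst z))))"
    using assms kernel_prod_gibbs by simp
  then have "(\<lambda>z. - E (fst z) - w (fst z) (snd z)) = (\<lambda>z. ln (p (snd z)) - w' (snd z) (fst z))"
  proof (rule density_lborel_exp_eq[rotated 2])
    have "continuous_on UNIV (\<lambda>z :: (real^'d) \<times> (real^'d). E (fst z))"
      by (rule continuous_on_compose2[OF E(1)]) (auto intro: continuous_intros)
    then show "continuous_on UNIV (\<lambda>z. - E (fst z) - w (fst z) (snd z))"
      using w(1) by (intro continuous_intros)
    have "continuous_on UNIV (\<lambda>z :: (real^'d) \<times> (real^'d). p (snd z))"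
      by (rule continuous_on_compose2[OF p(3)]) (auto intro: continuous_intros)
    moreover have "continuous_on UNIV (\<lambda>z. w' (snd z) (fst z))"
      using continuous_on_compose2[OF w'(1) continuous_on_swap[of UNIV]] by simp
    ultimately show "continuous_on UNIV (\<lambda>z. ln (p (snd z)) - w' (snd z) (fst z))"
      using normalising_constant_pos by (intro continuous_intros) (auto simp: less_imp_neq[symmetric])
  qed
  from fun_cong[OF this, of "(a, b)"] show ?thesis by simp
qed

end

lemma (in sinkhorn_potentials) convex_w: "convex_on UNIV (\<lambda>a. w k a b)"
proof -
  have "convex_on UNIV (\<lambda>a. tf.L k a + (w k 0 b - a \<bullet> (M k *v b)))"
    by (intro convex_on_add[OF tf.convex_L] convex_onI) (auto simp: algebra_simps inner_add_left)
  moreover have "tf.L k a + (w k 0 b - a \<bullet> (M k *v b)) = w k a b" for a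
    using w_shape[of k a b] by (simp add: tf_L)
  ultimately show ?thesis by simp
qed

locale gaussian_sinkhorn =
  fixes U V :: "real^'d \<Rightarrow> real" and \<tau> \<beta> :: "real^'d^'d" and \<alpha> :: "real^'d"
    and K :: "nat \<Rightarrow> real^'d \<Rightarrow> (real^'d) measure" and \<omega> :: "nat \<Rightarrow> (real^'d) \<times> (real^'d) \<Rightarrow> real"
  assumes smooth: "smooth U" "smooth V" and prob: "prob_space (gibbs U)" "prob_space (gibbs V)"
    and reference: "pos_def \<tau>" "invertible \<beta>"
    and sinkhorn: "sinkhorn_kernels (gibbs U) (gibbs V) (gibbs_kernel (gauss_potential \<tau> \<alpha> \<beta>)) K"
    and smooth_\<omega>: "smooth (\<omega> n)" and K_eq: "K n = gibbs_kernel (\<lambda>x y. \<omega> n (x, y))"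
    and diff: "diff_under_integral (if even n then gibbs U else gibbs V) (\<lambda>x y. exp (- \<omega> n (x, y)))"
begin

definition E :: "nat \<Rightarrow> real^'d \<Rightarrow> real" where
  "E k = (if even k then U else V)"

definition p :: "nat \<Rightarrow> real^'d \<Rightarrow> real" where
  "p k b = (\<integral>a. exp (- \<omega> k (a, b)) \<partial>gibbs (E k))"

definition M :: "nat \<Rightarrow> real^'d^'d" where
  "M k = (if even k then transpose (matrix_inv \<tau> ** \<beta>) else matrix_inv \<tau> ** \<beta>)"

lemma smooth_E: "smooth (E k)"
  using smooth by (simp add: E_def)

lemma E_prob: "prob_space (gibbs (E k))"
  using prob by (simp add: E_def)

lemma K_measurable: "gibbs_kernel (\<lambda>x y. \<omega> k (x, y)) \<in> borel \<rightarrow>\<^sub>M prob_algebra borel"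
  using sinkhorn unfolding K_eq[symmetric] by (simp add: sinkhorn_kernels_def)

lemma smooth_p: "smooth (p k)"
proof -
  have "smooth (\<lambda>y. \<integral>x. exp (- \<omega> k (x, y)) \<partial>(if even k then gibbs U else gibbs V))"
    using diff[of k] unfolding diff_under_integral_def by (rule conjunct1)
  then show ?thesis unfolding p_def[abs_def] by (simp add: E_def if_distrib)
qed

lemma integrable_p: "integrable (gibbs (E k)) (\<lambda>a. exp (- \<omega> k (a, b)))"
proof -
  have "integrable (if even k then gibbs U else gibbs V) (\<lambda>a. dderivs [] (\<lambda>y. exp (- \<omega> k (a, y))) b)"
    using diff[of k] unfolding diff_under_integral_def by blast
  then show ?thesis by (simp add: E_def split: if_splits)
qed

lemma sinkhorn_step:
  "kernel_prod (gibbs (E k)) (K k) = swap_measure (kernel_prod (gibbs (E k) \<bind> K k) (K (Suc k)))"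
proof (cases "even k")
  case True
  then obtain n where "k = 2 * n" by blast
  then show ?thesis using sinkhorn by (simp add: sinkhorn_kernels_def E_def)
next
  case False
  then obtain n where "k = 2 * n + 1" by (blast elim: oddE)
  then show ?thesis using sinkhorn by (simp add: sinkhorn_kernels_def E_def)
qed

lemma step_facts:
  shows "0 < p k b" "(\<integral>\<^sup>+a. ennreal (exp (- E k a - \<omega> k (a, b))) \<partial>lborel) = ennreal (p k b)"
    "\<omega> (Suc k) (b, a) = E k a + \<omega> k (a, b) + ln (p k b)"
    "kernel_prod (gibbs (E k)) (K k) = density lborel (\<lambda>z. ennreal (exp (- E k (fst z) - \<omega> k (fst z, snd z))))"
proof -
  have w: "continuous_on UNIV (\<lambda>z. \<omega> k (fst z, snd z))" for k
    using smooth_continuous_on[OF smooth_\<omega>, of UNIV k] by simp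
  note facts = smooth_continuous_on[OF smooth_E, of UNIV k] E_prob[of k] w[of k] K_measurable[of k]
  note facts' = p_def integrable_p smooth_continuous_on[OF smooth_p]
  show "0 < p k b" by (rule normalising_constant_pos[OF facts w K_measurable facts'])
  show "(\<integral>\<^sup>+a. ennreal (exp (- E k a - \<omega> k (a, b))) \<partial>lborel) = ennreal (p k b)"
    by (rule nn_integral_normalising_constant[OF facts w K_measurable facts'])
  show "\<omega> (Suc k) (b, a) = E k a + \<omega> k (a, b) + ln (p k b)"
    by (rule sinkhorn_step_potential[OF facts w K_measurable facts']) (use sinkhorn_step[of k] in \<open>simp add: K_eq\<close>)
  show "kernel_prod (gibbs (E k)) (K k) = density lborel (\<lambda>z. ennreal (exp (- E k (fst z) - \<omega> k (fst z, snd z))))"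
    unfolding K_eq by (rule kernel_prod_gibbs[OF facts w K_measurable facts'])
qed

lemma gibbs_kernel_zero: "gibbs_kernel (gauss_potential \<tau> \<alpha> \<beta>) = K 0"
  using sinkhorn by (simp add: sinkhorn_kernels_def)

lemma potential_zero: "\<omega> 0 (a, b) = gauss_potential \<tau> \<alpha> \<beta> a b"
proof -
  obtain c where c: "\<And>x y. gauss_potential \<tau> \<alpha> \<beta> x y
    = (y - (\<alpha> + \<beta> *v x)) \<bullet> (matrix_inv \<tau> *v (y - (\<alpha> + \<beta> *v x))) / 2 + c"
    using gauss_potential_eq[OF reference(1)] by blast
  have "(\<lambda>b. - \<omega> 0 (a, b)) = (\<lambda>b. - gauss_potential \<tau> \<alpha> \<beta> a b)"
  proof (rule density_lborel_exp_eq)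
    show "continuous_on UNIV (\<lambda>b. - \<omega> 0 (a, b))"
      by (intro continuous_intros smooth_continuous_on smooth_section(1) smooth_\<omega>)
    show "continuous_on UNIV (\<lambda>b. - gauss_potential \<tau> \<alpha> \<beta> a b)"
      unfolding c by (intro continuous_intros linear_continuous_on[OF matrix_vector_mul_bounded_linear, THEN continuous_on_compose2]) auto
    show "density lborel (\<lambda>b. ennreal (exp (- \<omega> 0 (a, b)))) = density lborel (\<lambda>b. ennreal (exp (- gauss_potential \<tau> \<alpha> \<beta> a b)))"
      using fun_cong[OF gibbs_kernel_zero, of a] K_eq[of 0] by (simp add: gibbs_kernel_def gibbs_def)
  qed
  from fun_cong[OF this, of b] show ?thesis by simp
qed

lemma potential_shape: "\<omega> k (a, b) = \<omega> k (a, 0) + \<omega> k (0, b) - \<omega> k (0, 0) - a \<bullet> (M k *v b)"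
proof (induction k arbitrary: a b)
  case 0
  show ?case using gauss_potential_shape[OF reference(1), of \<alpha> \<beta> a b] by (simp add: potential_zero M_def)
next
  case (Suc k)
  have "M (Suc k) = transpose (M k)" by (simp add: M_def)
  then have "b \<bullet> (M k *v a) = a \<bullet> (M (Suc k) *v b)"
    using transpose_inner[of b "M k" a] by (simp add: inner_commute)
  then show ?case using Suc.IH[of b a] by (simp add: step_facts(3))
qed

lemma invertible_M: "invertible (M k)"
proof -
  have "invertible (matrix_inv \<tau>)"
    using matrix_inv_right[OF pos_def_imp_invertible[OF reference(1)]] invertible_right_inverse invertible_left_inverse
    by (metis matrix_left_right_inverse)
  then have "invertible (matrix_inv \<tau> ** \<beta>)" using reference(2) by (rule invertible_mult)
  then show ?thesis by (simp add: M_def transpose_invertible)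
qed

sublocale sinkhorn_potentials E "\<lambda>k a b. \<omega> k (a, b)" p M
proof (rule sinkhorn_potentials.intro)
  fix k a b
  show "E (Suc (Suc k)) = E k" by (simp add: E_def)
  show "E k \<in> borel_measurable borel" by (rule smooth_borel_measurable[OF smooth_E])
  show "(\<lambda>z. \<omega> k (fst z, snd z)) \<in> borel_measurable borel" using smooth_borel_measurable[OF smooth_\<omega>] by simp
  show "(\<integral>\<^sup>+b. ennreal (exp (- \<omega> k (a, b))) \<partial>lborel) = 1"
    by (rule nn_integral_gibbs_kernel[OF K_measurable]) (intro smooth_borel_measurable smooth_section(1) smooth_\<omega>)
  show "p k \<in> borel_measurable borel" by (rule smooth_borel_measurable[OF smooth_p])
qed (rule E_prob step_facts potential_shape invertible_M)+

lemma spec_norm_M: "spec_norm (M k) = spec_norm (matrix_inv \<tau> ** \<beta>)"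
  by (simp add: M_def spec_norm_transpose)

lemma sinkhorn_bridge_eq: "sinkhorn_bridge (gibbs U) (gibbs V) K k = bridge k"
proof (cases "even k")
  case True
  then have "E k = U" by (simp add: E_def)
  then show ?thesis
    unfolding sinkhorn_bridge_def bridge_eq J_def step_facts(4)[of k, symmetric] using True by simp
next
  case False
  then have "E k = V" by (simp add: E_def)
  then show ?thesis
    unfolding sinkhorn_bridge_def bridge_eq J_def step_facts(4)[of k, symmetric] swap_measure_def using False by simp
qed

lemma reference_eq: "kernel_prod (gibbs U) (gibbs_kernel (gauss_potential \<tau> \<alpha> \<beta>)) = bridge 0"
  unfolding gibbs_kernel_zero sinkhorn_bridge_eq[symmetric] by (simp add: sinkhorn_bridge_def)

end

lemma smooth_zero: "smooth (\<lambda>_. 0)"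
proof -
  have "dderivs vs (\<lambda>_::'a. 0) = (\<lambda>_. 0)" for vs :: "'a list"
    by (induction vs) (auto simp: frechet_derivative_const)
  then show ?thesis by (simp add: smooth_def)
qed

context gaussian_sinkhorn
begin

lemma potential_Suc: "(\<lambda>a. \<omega> (Suc k) (b, a)) = (\<lambda>a. E k a + \<omega> k (a, b) + ln (p k b))"
  by (rule ext) (rule step_facts)

lemma hess_bound_potential:
  assumes "pos_def u" "hess_bound (matrix_inv u) u' \<delta> (E k)"
  shows "hess_bound (inverse (spec_norm u) *\<^sub>R mat 1) (spec_norm u' *\<^sub>R mat 1) \<delta> (\<lambda>a. \<omega> (Suc k) (b, a))"
  unfolding potential_Suc
  by (rule hess_bound_add_convex[OF smooth_E smooth_section(2)[OF smooth_\<omega>] convex_w assms])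

lemma hess_bound_E:
  assumes "pos_def u" "hess_bound (matrix_inv u) u' \<delta> (E k)"
  shows "hess_bound (inverse (spec_norm u) *\<^sub>R mat 1) (spec_norm u' *\<^sub>R mat 1) \<delta> (E k)"
  using hess_bound_add_convex[OF smooth_E smooth_zero _ assms, of 0] by (simp add: convex_on_def)

lemma log_sobolev_potential:
  assumes u: "pos_def u" and H: "hess_bound (matrix_inv u) u' \<delta> (E k)" and \<delta>: "0 \<le> \<delta>"
    and \<rho>: "perturbation_constant TYPE('d) \<rho>"
  defines "r \<equiv> \<rho> (inverse (spec_norm u)) (spec_norm u') \<delta>"
  shows "0 < r" "log_sobolev (tf.kernel (Suc k) b) r" "log_sobolev (gibbs (E k)) r"
proof -
  have *: "0 < inverse (spec_norm u)" "0 \<le> spec_norm u'" "0 \<le> \<delta>"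
    using spec_norm_pos[OF pos_def_imp_invertible[OF u]] spec_norm_nonneg[of u'] \<delta> by auto
  then show "0 < r" using \<rho> unfolding perturbation_constant_def r_def by blast
  have ls: "log_sobolev (gibbs F) r" if "smooth F" "prob_space (gibbs F)"
    "hess_bound (inverse (spec_norm u) *\<^sub>R mat 1) (spec_norm u' *\<^sub>R mat 1) \<delta> F" for F :: "real^'d \<Rightarrow> real"
    using \<rho> * that unfolding perturbation_constant_def r_def by blast
  show "log_sobolev (tf.kernel (Suc k) b) r"
    unfolding tf_kernel using tf.prob_space_kernel[of "Suc k" b, unfolded tf_kernel]
    by (intro ls smooth_section(1) smooth_\<omega> hess_bound_potential[OF u H])
  show "log_sobolev (gibbs (E k)) r"
    by (intro ls smooth_E E_prob hess_bound_E[OF u H])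
qed

lemma strongly_convex_potential:
  assumes u: "pos_def u" and H: "\<And>x. matrix_inv u \<le>\<^sub>L hess (E k) x" and t: "0 \<le> t" "t \<le> 1"
  shows "\<omega> (Suc k) (b, (1 - t) *\<^sub>R x + t *\<^sub>R y) \<le> (1 - t) * \<omega> (Suc k) (b, x) + t * \<omega> (Suc k) (b, y)
    - inverse (spec_norm u) / 2 * (t * (1 - t)) * (norm (x - y))\<^sup>2"
proof -
  have "\<omega> k ((1 - t) *\<^sub>R x + t *\<^sub>R y, b) \<le> (1 - t) * \<omega> k (x, b) + t * \<omega> k (y, b)"
    using convex_onD[OF convex_w[of k b] t] by simp
  moreover have "ln (p k b) = (1 - t) * ln (p k b) + t * ln (p k b)" by (simp add: algebra_simps)
  ultimately show ?thesis
    using strongly_convex_if_hess_ge[OF smooth_E H u t, of x y] unfolding potential_Suc[THEN fun_cong]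
    by (simp only: distrib_left)
qed

lemma entropic_contraction:
  assumes bridge: "is_arg_min (\<lambda>Q. rel_entropy Q (bridge 0)) (\<lambda>Q. Q \<in> couplings (gibbs U) (gibbs V)) P"
    and fin: "\<exists>Q\<in>couplings (gibbs U) (gibbs V). rel_entropy Q (bridge 0) < \<infinity>"
    and v: "pos_def v" "hess_bound (matrix_inv v) v' \<delta> V" "0 \<le> \<delta>"
    and r: "0 < r 0" "0 < r (Suc 0)" "\<And>k. r (Suc (Suc k)) = r k"
    and sg: "\<And>k. tf.subgaussian (Suc k) ((spec_norm (M (Suc k)))\<^sup>2 * r k)"
    and dt: "\<And>k. tf.dual_transport (Suc k) (T k) ((spec_norm (M (Suc k)))\<^sup>2 * r k * r (Suc k))"
    and n: "2 \<le> n"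
  shows "rel_entropy P (sinkhorn_bridge (gibbs U) (gibbs V) K (n + m))
    \<le> ereal (inverse ((1 + \<phi> ((spec_norm (matrix_inv \<tau> ** \<beta>))\<^sup>2 * r 0 * r (Suc 0))) ^ (n - 2)))
      * rel_entropy P (sinkhorn_bridge (gibbs U) (gibbs V) K m)"
proof -
  let ?\<kappa> = "spec_norm (matrix_inv \<tau> ** \<beta>)"
  have \<kappa>: "0 < ?\<kappa>" using spec_norm_pos[OF invertible_M[of 0]] by (simp add: spec_norm_M)
  have UV: "gibbs (E 0) = gibbs U" "gibbs (E (Suc 0)) = gibbs V" "E (Suc 0) = V" by (simp_all add: E_def)
  have r_cases: "r k = r 0 \<and> r (Suc k) = r (Suc 0) \<or> r k = r (Suc 0) \<and> r (Suc k) = r 0" for k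
    by (induction k) (use r(3) in auto)
  have P: "P \<in> marginal_couplings" using bridge by (simp add: is_arg_min_def UV)
  have minimal: "rel_entropy P (bridge 0) \<le> rel_entropy Q (bridge 0)" if "Q \<in> marginal_couplings" for Q
    using bridge that by (auto simp: is_arg_min_def not_less UV)
  obtain C where C: "\<And>x. inverse (spec_norm v) / 4 * (norm x)\<^sup>2 - C \<le> E (Suc 0) x"
    using hess_bound_imp_quadratic_growth[of V "inverse (spec_norm v)" "spec_norm v'" \<delta>] smooth(2)
      spec_norm_pos[OF pos_def_imp_invertible[OF v(1)]] spec_norm_nonneg[of v'] v(3)
      hess_bound_E[of v v' \<delta> "Suc 0"] v UV(3) by auto
  have sg': "tf.subgaussian (Suc k) (?\<kappa>\<^sup>2 * max (r 0) (r (Suc 0)))" for k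
    by (rule tf.subgaussian_mono[OF sg]) (use r_cases[of k] in \<open>auto simp: spec_norm_M intro!: mult_left_mono\<close>)
  have dt': "tf.dual_transport (Suc k) (T k) (?\<kappa>\<^sup>2 * r 0 * r (Suc 0))" for k
    using dt[of k] r_cases[of k] by (auto simp: spec_norm_M mult_ac)
  have fin': "rel_entropy P (bridge 0) < \<infinity>" using fin minimal by (auto simp: UV intro: le_less_trans)
  have pos: "0 < ?\<kappa>\<^sup>2 * max (r 0) (r (Suc 0))" "0 < ?\<kappa>\<^sup>2 * r 0 * r (Suc 0)" "0 < inverse (spec_norm v) / 4"
    using \<kappa> r spec_norm_pos[OF pos_def_imp_invertible[OF v(1)]] by (auto simp: less_max_iff_disj)
  show ?thesis
    unfolding sinkhorn_bridge_eq
    by (rule sinkhorn_contraction[OF P fin' minimal sg' pos(1) dt' pos(2) C pos(3) n])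
qed

end

theorem theorem8p2:
  fixes U V :: "real^'d \<Rightarrow> real"
    and \<tau> \<beta> u v u' v' :: "real^'d^'d"
    and \<alpha> :: "real^'d"
    and \<delta>u \<delta>v :: real
    and \<rho> :: "real \<Rightarrow> real \<Rightarrow> real \<Rightarrow> real"
    and \<mu> \<eta> :: "(real^'d) measure"
    and W :: "real^'d \<Rightarrow> real^'d \<Rightarrow> real"
    and K :: "nat \<Rightarrow> real^'d \<Rightarrow> (real^'d) measure"
    and P :: "((real^'d) \<times> (real^'d)) measure"
  assumes smooth: "smooth U" "smooth V"
    and marginals: "\<mu> = gibbs U" "\<eta> = gibbs V"
    and prob: "prob_space \<mu>" "prob_space \<eta>"
    and reference: "pos_def \<tau>" "invertible \<beta>" "W = gauss_potential \<tau> \<alpha> \<beta>"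
    and finite_entropy:
      "\<exists>Q \<in> couplings \<mu> \<eta>. rel_entropy Q (kernel_prod \<mu> (gibbs_kernel W)) < \<infinity>"
    and bridge:
      "is_arg_min (\<lambda>Q. rel_entropy Q (kernel_prod \<mu> (gibbs_kernel W))) (\<lambda>Q. Q \<in> couplings \<mu> \<eta>) P"
    and sinkhorn: "sinkhorn_kernels \<mu> \<eta> (gibbs_kernel W) K"
    and transitions: "smooth_transitions \<mu> \<eta> K"
    and constants: "perturbation_constant TYPE('d) \<rho>"
    and matrices: "pos_def u" "pos_def v" "pos_semidef u'" "pos_semidef v'"
    and radii: "0 \<le> \<delta>u" "0 \<le> \<delta>v"
    and hessians: "hess_bound (matrix_inv u) u' \<delta>u U" "hess_bound (matrix_inv v) v' \<delta>v V"
  shows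
    "(let \<rho>u = \<rho> (inverse (spec_norm u)) (spec_norm u') \<delta>u;
          \<rho>v = \<rho> (inverse (spec_norm v)) (spec_norm v') \<delta>v;
          \<epsilon> = (spec_norm (matrix_inv \<tau> ** \<beta>))\<^sup>2 * \<rho>u * \<rho>v
      in \<forall>n\<ge>2. \<forall>p. rel_entropy P (sinkhorn_bridge \<mu> \<eta> K (n + p))
           \<le> ereal (inverse ((1 + \<phi> \<epsilon>) ^ (n - 2))) * rel_entropy P (sinkhorn_bridge \<mu> \<eta> K p))
     \<and>
     ((\<forall>x. matrix_inv u \<le>\<^sub>L hess U x) \<and> (\<forall>y. matrix_inv v \<le>\<^sub>L hess V y) \<longrightarrow>
      (let \<epsilon> = (spec_norm (matrix_inv \<tau> ** \<beta>))\<^sup>2 * spec_norm u * spec_norm v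
       in \<forall>n\<ge>2. \<forall>p. rel_entropy P (sinkhorn_bridge \<mu> \<eta> K (n + p))
           \<le> ereal (inverse ((1 + \<phi> \<epsilon>) ^ (n - 2))) * rel_entropy P (sinkhorn_bridge \<mu> \<eta> K p)))"
proof -
  obtain \<omega> :: "nat \<Rightarrow> (real^'d) \<times> (real^'d) \<Rightarrow> real" where \<omega>: "\<And>n. smooth (\<omega> n)" "\<And>n. K n = gibbs_kernel (\<lambda>x y. \<omega> n (x, y))"
    "\<And>n. diff_under_integral (if even n then \<mu> else \<eta>) (\<lambda>x y. exp (- \<omega> n (x, y)))"
    using transitions unfolding smooth_transitions_def by blast
  note bridge' = bridge[unfolded marginals reference(3)] and fin = finite_entropy[unfolded marginals reference(3)]
  interpret gaussian_sinkhorn U V \<tau> \<beta> \<alpha> K \<omega>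
    by (rule gaussian_sinkhorn.intro)
      (use smooth prob reference sinkhorn \<omega>(1,2) \<omega>(3)[unfolded marginals] marginals in \<open>simp_all only:\<close>)
  note bridge' = bridge'[unfolded reference_eq] and fin = fin[unfolded reference_eq]
  note contraction = entropic_contraction[OF bridge' fin matrices(2) hessians(2) radii(2)]
  define u\<^sub>k u\<^sub>k' \<delta>\<^sub>k where "u\<^sub>k k = (if even k then u else v)" and "u\<^sub>k' k = (if even k then u' else v')"
    and "\<delta>\<^sub>k k = (if even k then \<delta>u else \<delta>v)" for k :: nat
  have uk: "pos_def (u\<^sub>k k)" "hess_bound (matrix_inv (u\<^sub>k k)) (u\<^sub>k' k) (\<delta>\<^sub>k k) (E k)" "0 \<le> \<delta>\<^sub>k k" for k
    using matrices hessians radii by (auto simp: u\<^sub>k_def u\<^sub>k'_def \<delta>\<^sub>k_def E_def)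
  have \<kappa>: "0 < (spec_norm (M k))\<^sup>2" for k using spec_norm_pos[OF invertible_M[of k]] by simp
  have sets: "sets (T k) = sets borel" for k by (simp add: gibbs_def)
  show ?thesis
  proof (intro conjI impI)
    define r where "r k = \<rho> (inverse (spec_norm (u\<^sub>k k))) (spec_norm (u\<^sub>k' k)) (\<delta>\<^sub>k k)" for k
    note ls = log_sobolev_potential[OF uk constants, folded r_def]
    have sg: "tf.subgaussian (Suc k) ((spec_norm (M (Suc k)))\<^sup>2 * r k)" for k
      using tf.subgaussian_if_log_sobolev[OF ls(2,1)] by (simp add: mult.commute)
    have dt: "tf.dual_transport (Suc k) (T k) ((spec_norm (M (Suc k)))\<^sup>2 * r k * r (Suc k))" for k
      using \<kappa>[of "Suc k"] ls(1)[of k] by (intro tf.dual_transport_log_sobolev[OF sg _ E_prob sets ls(3,1)]) simp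
    have "r (Suc (Suc k)) = r k" for k by (simp add: r_def u\<^sub>k_def u\<^sub>k'_def \<delta>\<^sub>k_def)
    from contraction[of r, OF ls(1) ls(1) this sg dt] show "let \<rho>u = \<rho> (inverse (spec_norm u)) (spec_norm u') \<delta>u;
          \<rho>v = \<rho> (inverse (spec_norm v)) (spec_norm v') \<delta>v;
          \<epsilon> = (spec_norm (matrix_inv \<tau> ** \<beta>))\<^sup>2 * \<rho>u * \<rho>v
      in \<forall>n\<ge>2. \<forall>p. rel_entropy P (sinkhorn_bridge \<mu> \<eta> K (n + p))
           \<le> ereal (inverse ((1 + \<phi> \<epsilon>) ^ (n - 2))) * rel_entropy P (sinkhorn_bridge \<mu> \<eta> K p)"
      by (simp add: Let_def r_def u\<^sub>k_def u\<^sub>k'_def \<delta>\<^sub>k_def marginals)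
  next
    assume H: "(\<forall>x. matrix_inv u \<le>\<^sub>L hess U x) \<and> (\<forall>y. matrix_inv v \<le>\<^sub>L hess V y)"
    define r where "r k = spec_norm (u\<^sub>k k)" for k
    have r0: "0 < r k" for k unfolding r_def by (rule spec_norm_pos[OF pos_def_imp_invertible[OF uk(1)]])
    then have inv: "0 < inverse (spec_norm (u\<^sub>k k))" for k by (simp add: r_def)
    have hess: "matrix_inv (u\<^sub>k k) \<le>\<^sub>L hess (E k) x" for k x using H by (simp add: u\<^sub>k_def E_def)
    have sg: "tf.subgaussian (Suc k) ((spec_norm (M (Suc k)))\<^sup>2 * r k)" for k
      using tf.subgaussian_if_strongly_convex[OF inv strongly_convex_potential[OF uk(1) hess]]
      by (simp add: r_def divide_inverse)
    have dt: "tf.dual_transport (Suc k) (T k) ((spec_norm (M (Suc k)))\<^sup>2 * r k * r (Suc k))" for k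
      using \<kappa>[of "Suc k"] r0[of k]
        tf.dual_transport_strongly_convex[OF sg _ E_measurable E_prob inv strongly_convex_if_hess_ge[OF smooth_E hess uk(1)], of k "Suc k"]
      by (simp add: r_def divide_inverse)
    have "r (Suc (Suc k)) = r k" for k by (simp add: r_def u\<^sub>k_def)
    from contraction[of r, OF r0 r0 this sg dt] show "let \<epsilon> = (spec_norm (matrix_inv \<tau> ** \<beta>))\<^sup>2 * spec_norm u * spec_norm v
       in \<forall>n\<ge>2. \<forall>p. rel_entropy P (sinkhorn_bridge \<mu> \<eta> K (n + p))
           \<le> ereal (inverse ((1 + \<phi> \<epsilon>) ^ (n - 2))) * rel_entropy P (sinkhorn_bridge \<mu> \<eta> K p)"
      by (simp add: Let_def r_def u\<^sub>k_def marginals)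
  qed
qed

end
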